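(* Let $0<\varepsilon<1$ and let $A=\sum_{i=1}^m v_i\otimes v_i$ with column vectors $v_i\in\mathbb{R}^n$ and $m\ge n$. Then there are non-negative weights $\{s_i\}_{i\le m}$, at most $\lceil n/\varepsilon^2\rceil$ of which are non-zero, such that $$(1-\varepsilon)^3A\preceq\widetilde A\preceq(1+\varepsilon)^3A,\qquad \widetilde A=\sum_{i=1}^m s_i\,v_i\otimes v_i.$$ Moreover, there is an algorithm that computes the weights $\{s_i\}$ in deterministic $\widetilde{\mathcal{O}}(mn^2\log^3n/\varepsilon^2+n^4\log n/\varepsilon^4)$ time.
   Context: For $x\in\mathbb{R}^n$, $x\otimes x$ is the $n\times n$ matrix with entries $x_ix_j$. For symmetric $X,Y$, $X\preceq Y$ means $Y-X$ is positive semi-definite. The $\widetilde{\mathcal{O}}(\cdot)$ notation hides $\log\log n$ and $\log\log(1/\varepsilon)$ factors. *)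

theory Defs
  imports Complex_Main "Jordan_Normal_Form.Matrix"
begin

section \<open>Spectral approximation of sums of rank-one matrices\<close>

definition outer :: "real vec \<Rightarrow> real mat" where
  "outer x = mat (dim_vec x) (dim_vec x) (\<lambda>(j, k). x $ j * x $ k)"

definition pos_semidef :: "real mat \<Rightarrow> bool" where
  "pos_semidef X \<longleftrightarrow> square_mat X \<and> transpose_mat X = X \<and>
     (\<forall>x \<in> carrier_vec (dim_row X). x \<bullet> (X *\<^sub>v x) \<ge> 0)"

definition loewner_le :: "real mat \<Rightarrow> real mat \<Rightarrow> bool" (infix "\<preceq>\<^sub>L" 50) where
  "X \<preceq>\<^sub>L Y \<longleftrightarrow> pos_semidef (Y - X)"

text \<open>
  Entrywise sum of the matrices \<open>s i \<cdot>\<^sub>m outer (v i)\<close>, \<open>i < m\<close>. (The type of matrices carries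
  no global zero, so the class-based sum operator does not apply to it directly.)
  Indices run over \<open>0, \<dots>, m - 1\<close>.
\<close>
definition weighted_sum :: "nat \<Rightarrow> nat \<Rightarrow> (nat \<Rightarrow> real vec) \<Rightarrow> (nat \<Rightarrow> real) \<Rightarrow> real mat" where
  "weighted_sum n m v s = mat n n (\<lambda>jk. \<Sum>i<m. (s i \<cdot>\<^sub>m outer (v i)) $$ jk)"

definition sparsifier_weights ::
  "nat \<Rightarrow> nat \<Rightarrow> real \<Rightarrow> (nat \<Rightarrow> real vec) \<Rightarrow> (nat \<Rightarrow> real) \<Rightarrow> bool" where
  "sparsifier_weights n m \<epsilon> v s \<longleftrightarrow>
     (let A = weighted_sum n m v (\<lambda>_. 1); A' = weighted_sum n m v s in
       (\<forall>i<m. s i \<ge> 0) \<and>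
       int (card {i. i < m \<and> s i \<noteq> 0}) \<le> \<lceil>real n / \<epsilon>\<^sup>2\<rceil> \<and>
       (1 - \<epsilon>) ^ 3 \<cdot>\<^sub>m A \<preceq>\<^sub>L A' \<and>
       A' \<preceq>\<^sub>L (1 + \<epsilon>) ^ 3 \<cdot>\<^sub>m A)"


section \<open>Deterministic real RAM\<close>

text \<open>
  A unit-cost real RAM, presented as a structured language. There are two separate memories, one
  for natural numbers (used for control and addressing) and one for exact real numbers; each
  consists of finitely many arrays, selected statically by a number in the program text, with
  dynamically computed indices. A scalar variable is a cell of an array.

  Arithmetic on reals is \<open>+, -, *, /\<close> and square root, with comparison; there is no rounding to
  integers. Naturals have only addition and truncated subtraction, so that long integers cannot be
  built by repeated squaring and used for bit-parallel computation. The only constants in a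
  program are natural numbers; reals are obtained from naturals by a cast and by arithmetic.
\<close>

record mem =
  nats :: "nat \<Rightarrow> nat \<Rightarrow> nat"
  reals :: "nat \<Rightarrow> nat \<Rightarrow> real"

datatype nexp =
    NLit nat
  | NLoad nat nexp
  | NAdd nexp nexp
  | NSub nexp nexp

datatype rexp =
    RNat nexp
  | RLoad nat nexp
  | RAdd rexp rexp
  | RSub rexp rexp
  | RMul rexp rexp
  | RDiv rexp rexp
  | RSqrt rexp

datatype bexp =
    NLess nexp nexp
  | RLess rexp rexp
  | BNot bexp
  | BAnd bexp bexp

datatype com =
    Skip
  | NStore nat nexp nexp
  | RStore nat nexp rexp
  | Seq com com
  | Cond bexp com com
  | While bexp com

primrec nval :: "nexp \<Rightarrow> mem \<Rightarrow> nat" where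
  "nval (NLit k) \<sigma> = k"
| "nval (NLoad a i) \<sigma> = nats \<sigma> a (nval i \<sigma>)"
| "nval (NAdd e f) \<sigma> = nval e \<sigma> + nval f \<sigma>"
| "nval (NSub e f) \<sigma> = nval e \<sigma> - nval f \<sigma>"

primrec rval :: "rexp \<Rightarrow> mem \<Rightarrow> real" where
  "rval (RNat e) \<sigma> = real (nval e \<sigma>)"
| "rval (RLoad a i) \<sigma> = reals \<sigma> a (nval i \<sigma>)"
| "rval (RAdd e f) \<sigma> = rval e \<sigma> + rval f \<sigma>"
| "rval (RSub e f) \<sigma> = rval e \<sigma> - rval f \<sigma>"
| "rval (RMul e f) \<sigma> = rval e \<sigma> * rval f \<sigma>"
| "rval (RDiv e f) \<sigma> = rval e \<sigma> / rval f \<sigma>"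
| "rval (RSqrt e) \<sigma> = sqrt (rval e \<sigma>)"

primrec bval :: "bexp \<Rightarrow> mem \<Rightarrow> bool" where
  "bval (NLess e f) \<sigma> \<longleftrightarrow> nval e \<sigma> < nval f \<sigma>"
| "bval (RLess e f) \<sigma> \<longleftrightarrow> rval e \<sigma> < rval f \<sigma>"
| "bval (BNot b) \<sigma> \<longleftrightarrow> \<not> bval b \<sigma>"
| "bval (BAnd b c) \<sigma> \<longleftrightarrow> bval b \<sigma> \<and> bval c \<sigma>"

text \<open>Every operation, including constants and memory accesses, costs one unit of time.\<close>

primrec ncost :: "nexp \<Rightarrow> nat" where
  "ncost (NLit k) = 1"
| "ncost (NLoad a i) = 1 + ncost i"
| "ncost (NAdd e f) = 1 + ncost e + ncost f"
| "ncost (NSub e f) = 1 + ncost e + ncost f"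

primrec rcost :: "rexp \<Rightarrow> nat" where
  "rcost (RNat e) = 1 + ncost e"
| "rcost (RLoad a i) = 1 + ncost i"
| "rcost (RAdd e f) = 1 + rcost e + rcost f"
| "rcost (RSub e f) = 1 + rcost e + rcost f"
| "rcost (RMul e f) = 1 + rcost e + rcost f"
| "rcost (RDiv e f) = 1 + rcost e + rcost f"
| "rcost (RSqrt e) = 1 + rcost e"

primrec bcost :: "bexp \<Rightarrow> nat" where
  "bcost (NLess e f) = 1 + ncost e + ncost f"
| "bcost (RLess e f) = 1 + rcost e + rcost f"
| "bcost (BNot b) = 1 + bcost b"
| "bcost (BAnd b c) = 1 + bcost b + bcost c"

text \<open>
  \<open>run c \<sigma> t \<tau>\<close>: started in memory \<open>\<sigma>\<close>, program \<open>c\<close> halts after exactly \<open>t\<close> units of time in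
  memory \<open>\<tau>\<close>.
\<close>
inductive run :: "com \<Rightarrow> mem \<Rightarrow> nat \<Rightarrow> mem \<Rightarrow> bool" where
  Skip: "run Skip \<sigma> 1 \<sigma>"
| NStore: "run (NStore a i e) \<sigma> (1 + ncost i + ncost e)
     (\<sigma>\<lparr>nats := (nats \<sigma>)(a := (nats \<sigma> a)(nval i \<sigma> := nval e \<sigma>))\<rparr>)"
| RStore: "run (RStore a i e) \<sigma> (1 + ncost i + rcost e)
     (\<sigma>\<lparr>reals := (reals \<sigma>)(a := (reals \<sigma> a)(nval i \<sigma> := rval e \<sigma>))\<rparr>)"
| Seq: "run c \<sigma> t \<rho> \<Longrightarrow> run d \<rho> u \<tau> \<Longrightarrow> run (Seq c d) \<sigma> (t + u) \<tau>"
| CondTrue: "bval b \<sigma> \<Longrightarrow> run c \<sigma> t \<tau> \<Longrightarrow> run (Cond b c d) \<sigma> (1 + bcost b + t) \<tau>"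
| CondFalse: "\<not> bval b \<sigma> \<Longrightarrow> run d \<sigma> t \<tau> \<Longrightarrow> run (Cond b c d) \<sigma> (1 + bcost b + t) \<tau>"
| WhileFalse: "\<not> bval b \<sigma> \<Longrightarrow> run (While b c) \<sigma> (1 + bcost b) \<sigma>"
| WhileTrue: "bval b \<sigma> \<Longrightarrow> run c \<sigma> t \<rho> \<Longrightarrow> run (While b c) \<rho> u \<tau> \<Longrightarrow>
     run (While b c) \<sigma> (1 + bcost b + t + u) \<tau>"

inductive_cases SkipE: "run Skip \<sigma> t \<tau>"
inductive_cases NStoreE: "run (NStore a i e) \<sigma> t \<tau>"
inductive_cases RStoreE: "run (RStore a i e) \<sigma> t \<tau>"
inductive_cases SeqE: "run (Seq c d) \<sigma> t \<tau>"
inductive_cases CondE: "run (Cond b c d) \<sigma> t \<tau>"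
inductive_cases WhileE: "run (While b c) \<sigma> t \<tau>"

lemma run_deterministic:
  "run c \<sigma> t \<tau> \<Longrightarrow> run c \<sigma> t' \<tau>' \<Longrightarrow> t' = t \<and> \<tau>' = \<tau>"
proof (induction arbitrary: t' \<tau>' rule: run.induct)
  case (Skip \<sigma>)
  from Skip.prems show ?case by (rule SkipE) simp
next
  case (NStore a i e \<sigma>)
  from NStore.prems show ?case by (rule NStoreE) simp
next
  case (RStore a i e \<sigma>)
  from RStore.prems show ?case by (rule RStoreE) simp
next
  case (Seq c \<sigma> t \<rho> d u \<tau>)
  from Seq.prems obtain t1 \<rho>1 t2
    where 1: "run c \<sigma> t1 \<rho>1" "run d \<rho>1 t2 \<tau>'" "t' = t1 + t2" by (rule SeqE)
  from Seq.IH(1)[OF 1(1)] Seq.IH(2) 1(2,3) show ?case by simp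
next
  case (CondTrue b \<sigma> c t \<tau> d)
  from CondTrue.prems obtain t1
    where 1: "run c \<sigma> t1 \<tau>'" "t' = 1 + bcost b + t1"
    by (rule CondE) (use CondTrue.hyps(1) in simp_all)
  from CondTrue.IH[OF 1(1)] 1(2) show ?case by simp
next
  case (CondFalse b \<sigma> d t \<tau> c)
  from CondFalse.prems obtain t1
    where 1: "run d \<sigma> t1 \<tau>'" "t' = 1 + bcost b + t1"
    by (rule CondE) (use CondFalse.hyps(1) in simp_all)
  from CondFalse.IH[OF 1(1)] 1(2) show ?case by simp
next
  case (WhileFalse b \<sigma> c)
  from WhileFalse.prems show ?case by (rule WhileE) (use WhileFalse.hyps in simp_all)
next
  case (WhileTrue b \<sigma> c t \<rho> u \<tau>)
  from WhileTrue.prems obtain t1 \<rho>1 t2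
    where 1: "run c \<sigma> t1 \<rho>1" "run (While b c) \<rho>1 t2 \<tau>'" "t' = 1 + bcost b + t1 + t2"
    by (rule WhileE) (use WhileTrue.hyps(1) in simp_all)
  from WhileTrue.IH(1)[OF 1(1)] WhileTrue.IH(2) 1(2,3) show ?case by simp
qed

text \<open>
  Input: the dimensions in cells 0 and 1 of natural array 0, \<open>\<epsilon>\<close> in cell 0 of real array 0, and the
  vectors, concatenated, in real array 1. All other cells are zero. The weights are read off from
  real array 2.
\<close>
definition input_mem :: "nat \<Rightarrow> nat \<Rightarrow> real \<Rightarrow> (nat \<Rightarrow> real vec) \<Rightarrow> mem" where
  "input_mem n m \<epsilon> v = \<lparr>
     nats = (\<lambda>_ _. 0)(0 := (\<lambda>_. 0)(0 := n, 1 := m)),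
     reals = (\<lambda>_ _. 0)(0 := (\<lambda>_. 0)(0 := \<epsilon>),
                       1 := (\<lambda>k. if k < m * n then v (k div n) $ (k mod n) else 0))\<rparr>"

definition output_weights :: "mem \<Rightarrow> nat \<Rightarrow> real" where
  "output_weights \<tau> = reals \<tau> 2"


section \<open>Time bounds\<close>

text \<open>
  Logarithm truncated below at 1, so that bounds with logarithmic factors remain meaningful for
  small arguments (\<open>ln 1 = 0\<close>, and \<open>ln (ln (1 / \<epsilon>))\<close> is negative or undefined for \<open>\<epsilon>\<close> near 1).
\<close>
definition lg :: "real \<Rightarrow> real" where
  "lg x = max 1 (ln x)"

text \<open>
  \<open>T n m \<epsilon>\<close> bounds the time up to a constant and to powers of \<open>log log n\<close> and
  \<open>log log (1 / \<epsilon>)\<close>; the program and the constants are uniform in all inputs.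
\<close>
definition sparsifier_computable_in_soft_O :: "(nat \<Rightarrow> nat \<Rightarrow> real \<Rightarrow> real) \<Rightarrow> bool" where
  "sparsifier_computable_in_soft_O T \<longleftrightarrow>
     (\<exists>c C k. \<forall>n m \<epsilon> v.
        1 \<le> n \<and> n \<le> m \<and> 0 < \<epsilon> \<and> \<epsilon> < 1 \<and> (\<forall>i<m. v i \<in> carrier_vec n) \<longrightarrow>
        (\<exists>t \<tau>. run c (input_mem n m \<epsilon> v) t \<tau> \<and>
           sparsifier_weights n m \<epsilon> v (output_weights \<tau>) \<and>
           real t \<le> C * T n m \<epsilon> * lg (lg (real n)) ^ k * lg (lg (1 / \<epsilon>)) ^ k))"

end

theory Submission
  imports Defs "HOL-Library.Function_Algebras"
begin

text \<open>
  Exact arithmetic allows an algorithm with rational potentials only, and no spectral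
  decompositions; it is faster than the stated bound. Let \<open>A\<close> be the sum of the \<open>v\<^sub>i \<otimes> v\<^sub>i\<close> and \<open>Q\<close> the
  orthogonal projector onto its kernel, so that \<open>A + Q\<close> is invertible.

  A first pass scans the vectors once. It keeps the inverses of an upper and a lower barrier
  \<open>X = \<eta>(A + Q) + (1 + \<eta>)A' - S\<close> and \<open>Y = \<eta>(A + Q) - (1 - \<eta>)A' + S\<close>, where \<open>A'\<close> is the part of \<open>A\<close>
  already scanned and \<open>S\<close> the weighted sum of the vectors taken. It takes \<open>v\<close> with weight \<open>1/p\<close> or drops
  it, where \<open>p\<close> is proportional to \<open>v\<cdot>X\<^sup>-\<^sup>1v + v\<cdot>Y\<^sup>-\<^sup>1v\<close> (if \<open>p \<ge> 1\<close>, it takes \<open>v\<close> with weight 1).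
  If \<open>v\<close> were taken with probability \<open>p\<close>, the number of vectors taken so far (suitably scaled) plus
  \<open>tr ((A - A')(X\<^sup>-\<^sup>1 + Y\<^sup>-\<^sup>1))\<close> would not increase in expectation, so one of the two choices does not
  increase it. Since each step is a rank-one update, the pass costs \<open>O(mn\<^sup>2)\<close>, and with
  \<open>\<eta> = \<epsilon>/2\<close> it keeps at most \<open>12n/\<epsilon>\<^sup>2\<close> vectors and a factor \<open>1 \<plusminus> \<epsilon>\<close>.

  The barrier method of Batson, Spielman and Srivastava, run on these vectors for \<open>\<lceil>n/\<epsilon>\<^sup>2\<rceil>\<close> rounds, loses
  a further factor \<open>(1 \<plusminus> \<epsilon>)\<^sup>2\<close>. A round costs \<open>O(m + n\<^sup>3/\<epsilon>\<^sup>2)\<close> because moving the barriers by a multiple of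
  the sum is again a sequence of rank-one updates.
\<close>

section \<open>Symmetric operators and rank-one updates\<close>

text \<open>The form is only semidefinite because it is used on all of
  \<open>nat \<Rightarrow> real\<close> while seeing the leading coordinates alone; in return one
  type serves every dimension. The potentials \<open>\<Sum>i. v i \<star> M (v i)\<close> are the
  traces of \<open>A M\<close>. Such a trace is unchanged by the usual normalisation of
  \<open>A\<close> to the identity, so no inverse square root of \<open>A\<close> is ever formed.
  Positivity of a barrier is never tested: an update by \<open>c\<close> times
  \<open>v \<otimes> v\<close> keeps it as long as \<open>1 + c * (v \<star> M v)\<close> is
  positive, and each step argues for this one denominator. \<open>Q\<close> only makes the barriers
  invertible; being orthogonal to all vectors, it drops out of every final inequality. The delicate
  move is the advance of the lower barrier, which could cross the matrix it bounds; a trace below 1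
  prevents this. Two equations fix the constants: \<open>(1 + \<eta>) * K = \<eta>\<close> for the
  scale \<open>K\<close> of the sampling rates, and \<open>1 / \<delta> + E = 1 - F\<close> for the
  barriers, where the upper one moves \<delta> times as fast as the lower one and \<open>E\<close>,
  \<open>F\<close> bound their traces.\<close>

locale psd_form =
  fixes ip :: "'a::real_vector \<Rightarrow> 'a \<Rightarrow> real" (infixl "\<star>" 70)
  assumes ip_commute: "x \<star> y = y \<star> x"
    and ip_add_left: "(x + y) \<star> z = x \<star> z + y \<star> z"
    and ip_scale_left: "(r *\<^sub>R x) \<star> y = r * (x \<star> y)"
    and ip_nonneg: "0 \<le> x \<star> x"
begin

lemma ip_add_right: "x \<star> (y + z) = x \<star> y + x \<star> z"
  by (metis ip_commute ip_add_left)

lemma ip_scale_right: "x \<star> (r *\<^sub>R y) = r * (x \<star> y)"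
  by (metis ip_commute ip_scale_left)

lemma ip_zero_left [simp]: "0 \<star> x = 0"
  using ip_scale_left[of 0 0 x] by simp

lemma ip_zero_right [simp]: "x \<star> 0 = 0"
  by (metis ip_commute ip_zero_left)

lemma ip_minus_left: "(- x) \<star> y = - (x \<star> y)"
  using ip_scale_left[of "-1" x y] by simp

lemma ip_minus_right: "x \<star> (- y) = - (x \<star> y)"
  by (metis ip_commute ip_minus_left)

lemma ip_diff_left: "(x - y) \<star> z = x \<star> z - y \<star> z"
  using ip_add_left[of x "- y" z] by (simp add: ip_minus_left)

lemma ip_diff_right: "x \<star> (y - z) = x \<star> y - x \<star> z"
  by (metis ip_commute ip_diff_left)

lemma ip_sum_left: "sum f S \<star> y = (\<Sum>i\<in>S. f i \<star> y)"
  by (induction S rule: infinite_finite_induct) (auto simp: ip_add_left)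

lemma ip_sum_right: "y \<star> sum f S = (\<Sum>i\<in>S. y \<star> f i)"
  by (induction S rule: infinite_finite_induct) (auto simp: ip_add_right)

lemmas ip_simps = ip_add_left ip_add_right ip_scale_left ip_scale_right ip_diff_left ip_diff_right
  ip_minus_left ip_minus_right ip_sum_left ip_sum_right

definition symop :: "('a \<Rightarrow> 'a) \<Rightarrow> bool" where
  "symop f \<longleftrightarrow> linear f \<and> (\<forall>x y. f x \<star> y = x \<star> f y)"

definition psdop :: "('a \<Rightarrow> 'a) \<Rightarrow> bool" where
  "psdop f \<longleftrightarrow> symop f \<and> (\<forall>x. 0 \<le> x \<star> f x)"

definition inverse_pair :: "('a \<Rightarrow> 'a) \<Rightarrow> ('a \<Rightarrow> 'a) \<Rightarrow> bool" where
  "inverse_pair X M \<longleftrightarrow> psdop X \<and> symop M \<and> (\<forall>x. X (M x) = x) \<and> (\<forall>x. M (X x) = x)"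

definition rank1 :: "('a \<Rightarrow> 'a) \<Rightarrow> real \<Rightarrow> 'a \<Rightarrow> 'a \<Rightarrow> 'a" where
  "rank1 M c w = (\<lambda>x. M x + (c * (w \<star> x)) *\<^sub>R w)"

lemma symopD:
  assumes "symop f"
  shows "f (x + y) = f x + f y" "f (r *\<^sub>R x) = r *\<^sub>R f x" "f (x - y) = f x - f y" "f x \<star> y = x \<star> f y"
    "f 0 = 0"
  using assms unfolding symop_def by (auto simp: linear_add linear_scale linear_diff linear_0)

lemma symop_rank1: "symop M \<Longrightarrow> symop (rank1 M c w)"
  unfolding symop_def rank1_def
  by (auto intro!: linearI simp: linear_add linear_scale ip_simps ip_commute algebra_simps
      scaleR_add_left scaleR_add_right)

lemma rank1_zero [simp]: "rank1 M 0 w = M" "rank1 M c 0 = M"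
  unfolding rank1_def by auto

lemma psdop_CS:
  assumes "psdop X"
  shows "(x \<star> X y)\<^sup>2 \<le> (x \<star> X x) * (y \<star> X y)"
proof -
  have s: "symop X" and nn: "\<And>z. 0 \<le> z \<star> X z" using assms by (auto simp: psdop_def)
  have yx: "y \<star> X x = x \<star> X y" using symopD(4)[OF s] ip_commute by metis
  have q: "0 \<le> t\<^sup>2 * (x \<star> X x) + 2 * t * (x \<star> X y) + y \<star> X y" for t
    using nn[of "t *\<^sub>R x + y"]
    by (simp add: symopD[OF s] ip_simps yx power2_eq_square algebra_simps)
  show ?thesis
  proof (cases "x \<star> X x = 0")
    case True
    have "x \<star> X y = 0"
    proof (rule ccontr)
      assume "x \<star> X y \<noteq> 0"
      \<comment> \<open>At this \<open>t\<close> the linear term is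
        \<open>- (y \<star> X y) - 1\<close>, so the nonnegative expression equals -1.\<close>
      with q[of "- (y \<star> X y + 1) / (2 * (x \<star> X y))"] True show False by (simp add: field_simps)
    qed
    with True show ?thesis by simp
  next
    case False
    with nn[of x] have p: "0 < x \<star> X x" by simp
    let ?a = "x \<star> X x" and ?b = "x \<star> X y"
    have "0 \<le> (- ?b / ?a)\<^sup>2 * ?a + 2 * (- ?b / ?a) * ?b + y \<star> X y" by (rule q)
    also have "\<dots> = y \<star> X y - ?b\<^sup>2 / ?a" using p by (simp add: field_simps power2_eq_square)
    finally have "?b\<^sup>2 / ?a \<le> y \<star> X y" by simp
    with p show ?thesis by (simp add: field_simps)
  qed
qed

lemma psdop_id: "psdop (\<lambda>x. x)"
  unfolding psdop_def symop_def by (auto simp: ip_nonneg linear_id[unfolded id_def])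

lemma ip_CS: "(x \<star> y)\<^sup>2 \<le> (x \<star> x) * (y \<star> y)"
  using psdop_CS[OF psdop_id] by simp

lemma inverse_pairD:
  assumes "inverse_pair X M"
  shows "psdop X" "psdop M" "symop X" "symop M" "X (M x) = x" "M (X x) = x"
proof -
  show 1: "psdop X" "symop M" "X (M x) = x" "M (X x) = x" "symop X"
    using assms by (auto simp: inverse_pair_def psdop_def)
  have "0 \<le> x \<star> M x" for x
  proof -
    have "0 \<le> M x \<star> X (M x)" using 1 by (auto simp: psdop_def)
    then show ?thesis using assms by (simp add: inverse_pair_def ip_commute)
  qed
  with 1 show "psdop M" by (auto simp: psdop_def)
qed

lemma inverse_pair_nonneg: "inverse_pair X M \<Longrightarrow> 0 \<le> x \<star> M x"
  using inverse_pairD(2) by (auto simp: psdop_def)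

text \<open>Cauchy-Schwarz for \<open>X\<close> at \<open>M x\<close> and \<open>y\<close>: the
  quadratic forms of \<open>M\<close> and \<open>X\<close> are dual to each other. In particular
  \<open>x \<star> M x = 0\<close> makes \<open>x\<close> orthogonal to everything, which is how
  null vectors are recognised later.\<close>

lemma inverse_pair_CS:
  assumes "inverse_pair X M"
  shows "(x \<star> y)\<^sup>2 \<le> (x \<star> M x) * (y \<star> X y)"
proof -
  note D = inverse_pairD[OF assms]
  have "(M x \<star> X y)\<^sup>2 \<le> (M x \<star> X (M x)) * (y \<star> X y)" by (rule psdop_CS[OF D(1)])
  then show ?thesis using D(5,6) symopD(4)[OF D(4)] by simp
qed

text \<open>The Sherman-Morrison formula. Positivity is an issue only for negative \<open>c\<close>;
  then the loss \<open>c * (v \<star> y)\<^sup>2\<close> is controlled by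
  \<open>inverse_pair_CS\<close>, and what remains is \<open>1 + c * (v \<star> M v)\<close> times
  the old form.\<close>

lemma inverse_pair_rank1:
  assumes "inverse_pair X M" and pos: "0 < 1 + c * (v \<star> M v)"
  shows "inverse_pair (rank1 X c v) (rank1 M (- (c / (1 + c * (v \<star> M v)))) (M v))"
proof -
  note D = inverse_pairD[OF assms(1)]
  let ?x = "v \<star> M v"
  have x0: "0 \<le> ?x" using inverse_pair_nonneg[OF assms(1)] .
  have psd: "0 \<le> y \<star> rank1 X c v y" for y
  proof -
    have yy: "0 \<le> y \<star> X y" using D(1) by (auto simp: psdop_def)
    have cs: "(v \<star> y)\<^sup>2 \<le> ?x * (y \<star> X y)" by (rule inverse_pair_CS[OF assms(1)])
    have "y \<star> rank1 X c v y = y \<star> X y + c * (v \<star> y)\<^sup>2"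
      by (simp add: rank1_def ip_simps power2_eq_square ip_commute)
    moreover have "0 \<le> y \<star> X y + c * (v \<star> y)\<^sup>2"
    proof (cases "0 \<le> c")
      case False
      then have "c * (?x * (y \<star> X y)) \<le> c * (v \<star> y)\<^sup>2" using cs by (intro mult_left_mono_neg) auto
      moreover have "0 \<le> (1 + c * ?x) * (y \<star> X y)" using pos yy by simp
      ultimately show ?thesis by (simp add: algebra_simps)
    qed (use yy in auto)
    ultimately show ?thesis by simp
  qed
  define k where "k = - (c / (1 + c * ?x))"
  have c1: "c + k + c * k * ?x = 0"
    unfolding k_def using pos by (simp add: field_simps)
  have XM: "rank1 X c v (rank1 M k (M v) y) = y" for y
  proof -
    have "rank1 X c v (rank1 M k (M v) y) =
      y + ((c + k + c * k * ?x) * (v \<star> M y)) *\<^sub>R v"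
      by (simp add: rank1_def symopD[OF D(3)] D(5) ip_simps symopD(4)[OF D(4)])
        (simp add: algebra_simps)
    then show ?thesis unfolding c1 by simp
  qed
  have MX: "rank1 M k (M v) (rank1 X c v y) = y" for y
  proof -
    have "rank1 M k (M v) (rank1 X c v y) =
      y + ((c + k + c * k * ?x) * (v \<star> y)) *\<^sub>R M v"
      by (simp add: rank1_def symopD[OF D(4)] D(6) ip_simps)
        (simp add: algebra_simps)
    then show ?thesis unfolding c1 by simp
  qed
  show ?thesis unfolding k_def[symmetric] inverse_pair_def psdop_def
    using psd XM MX symop_rank1[OF D(3)] symop_rank1[OF D(4)] by blast
qed

section \<open>Barriers as weighted sums of rank-one operators\<close>

definition comb :: "nat \<Rightarrow> (nat \<Rightarrow> 'a) \<Rightarrow> (nat \<Rightarrow> real) \<Rightarrow> 'a \<Rightarrow> 'a" where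
  "comb m v g x = (\<Sum>i<m. (g i * (v i \<star> x)) *\<^sub>R v i)"

text \<open>Every barrier of both passes has this shape for a fixed family of vectors, with only the
  coefficients \<open>g\<close> varying. Treating one vector changes one coefficient, hence is a
  rank-one update, and the invariants become statements about coefficient functions.\<close>

definition barrier :: "nat \<Rightarrow> (nat \<Rightarrow> 'a) \<Rightarrow> ('a \<Rightarrow> 'a) \<Rightarrow> real \<Rightarrow> (nat \<Rightarrow> real) \<Rightarrow> 'a \<Rightarrow> 'a" where
  "barrier m v Q \<beta> g = (\<lambda>x. comb m v g x + \<beta> *\<^sub>R Q x)"

text \<open>The range of \<open>Q\<close> lies in the kernel of \<open>A\<close>. That it is the
  whole kernel is expressed by the accompanying inverse of \<open>A + Q\<close>: if
  \<open>A x = 0\<close>, then \<open>A + Q\<close> agrees on \<open>x\<close> and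
  \<open>Q x\<close>.\<close>

definition projector_off :: "nat \<Rightarrow> (nat \<Rightarrow> 'a) \<Rightarrow> ('a \<Rightarrow> 'a) \<Rightarrow> bool" where
  "projector_off m v Q \<longleftrightarrow> symop Q \<and> (\<forall>x. Q (Q x) = Q x) \<and> (\<forall>i<m. \<forall>x. v i \<star> Q x = 0)"

lemma ip_comb: "y \<star> comb m v g x = (\<Sum>i<m. g i * (v i \<star> x) * (v i \<star> y))"
  unfolding comb_def by (simp add: ip_simps ip_commute)

lemma ip_barrier_self:
  "x \<star> barrier m v Q \<beta> g x = (\<Sum>i<m. g i * (v i \<star> x)\<^sup>2) + \<beta> * (x \<star> Q x)"
  unfolding barrier_def by (simp add: ip_simps ip_comb power2_eq_square mult.assoc)

lemma comb_cong: "(\<And>i. i < m \<Longrightarrow> g i = h i) \<Longrightarrow> comb m v g = comb m v h"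
  unfolding comb_def by (auto intro!: sum.cong)

lemma barrier_cong: "(\<And>i. i < m \<Longrightarrow> g i = h i) \<Longrightarrow> barrier m v Q \<beta> g = barrier m v Q \<beta> h"
  unfolding barrier_def using comb_cong[of m g h v] by auto

lemma comb_upd:
  assumes "i < m"
  shows "comb m v (g(i := g i + c)) x = comb m v g x + (c * (v i \<star> x)) *\<^sub>R v i"
proof -
  have "comb m v (g(i := g i + c)) x = (\<Sum>j<m. (g j * (v j \<star> x)) *\<^sub>R v j + (if j = i then (c * (v i \<star> x)) *\<^sub>R v i else 0))"
    unfolding comb_def by (intro sum.cong) (auto simp: algebra_simps)
  with assms show ?thesis by (simp add: sum.distrib comb_def)
qed

lemma barrier_upd: "i < m \<Longrightarrow> barrier m v Q \<beta> (g(i := g i + c)) = rank1 (barrier m v Q \<beta> g) c (v i)"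
  unfolding barrier_def rank1_def by (rule ext) (simp add: comb_upd)

lemma barrier_inverse_step:
  assumes "inverse_pair (barrier m v Q \<beta> g) M" "i < m" "0 < 1 + c * (v i \<star> M (v i))"
  shows "inverse_pair (barrier m v Q \<beta> (g(i := g i + c)))
    (rank1 M (- (c / (1 + c * (v i \<star> M (v i))))) (M (v i)))"
  using inverse_pair_rank1[OF assms(1,3)] barrier_upd[OF assms(2)] by simp

text \<open>Testing the barrier on \<open>x - Q x\<close> annihilates the \<open>Q\<close> term and
  leaves every \<open>v i \<star> x\<close> unchanged.\<close>

lemma barrier_psd_imp:
  assumes "psdop (barrier m v Q \<beta> g)" "projector_off m v Q"
  shows "0 \<le> (\<Sum>i<m. g i * (v i \<star> x)\<^sup>2)"
proof -
  have Q: "symop Q" "Q (Q x) = Q x" "\<And>i y. i < m \<Longrightarrow> v i \<star> Q y = 0"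
    using assms(2) by (auto simp: projector_off_def)
  let ?y = "x - Q x"
  have "0 \<le> ?y \<star> barrier m v Q \<beta> g ?y" using assms(1) by (auto simp: psdop_def)
  also have "\<dots> = (\<Sum>i<m. g i * (v i \<star> ?y)\<^sup>2)"
    using Q(2) by (simp add: ip_barrier_self symopD[OF Q(1)])
  also have "\<dots> = (\<Sum>i<m. g i * (v i \<star> x)\<^sup>2)"
    by (intro sum.cong) (auto simp: ip_simps Q(3))
  finally show ?thesis .
qed

lemma inverse_pair_scale:
  assumes "inverse_pair (barrier m v Q \<beta> g) H" "0 < c"
  shows "inverse_pair (barrier m v Q (c * \<beta>) (\<lambda>i. c * g i)) (\<lambda>x. (1 / c) *\<^sub>R H x)"
proof -
  note D = inverse_pairD[OF assms(1)]
  have eq: "barrier m v Q (c * \<beta>) (\<lambda>i. c * g i) = (\<lambda>x. c *\<^sub>R barrier m v Q \<beta> g x)"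
    unfolding barrier_def comb_def by (simp add: scaleR_sum_right algebra_simps)
  have s: "symop (\<lambda>x. r *\<^sub>R f x)" if "symop f" for r f
    using that unfolding symop_def by (auto intro!: linearI simp: linear_add linear_scale algebra_simps ip_simps)
  show ?thesis unfolding eq inverse_pair_def psdop_def
    using s[OF D(3)] s[OF D(4)] D(1) assms(2) D(5,6)
    by (auto simp: psdop_def ip_simps symopD[OF D(3)] symopD[OF D(4)])
qed

section \<open>Incremental construction of the kernel projector and of the inverse of A + Q\<close>

lemma projector_inverse_init:
  "projector_off 0 v (\<lambda>x. x)" "inverse_pair (barrier 0 v (\<lambda>x. x) 1 (\<lambda>_. 1)) (\<lambda>x. x)"
  using psdop_id by (auto simp: projector_off_def inverse_pair_def psdop_def barrier_def comb_def)

text \<open>The part \<open>z\<close> of the new vector inside the old kernel leaves the kernel, so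
  \<open>Q\<close> loses the direction \<open>z\<close>, whose squared length is \<rho>. The inverse
  follows by two Sherman-Morrison steps, adding \<open>v i \<otimes> v i\<close> and subtracting
  \<open>z \<otimes> z / \<rho>\<close>. Since \<open>A + Q\<close> fixes \<open>z\<close>, so does
  \<open>H\<close>; this makes the second denominator \<open>\<rho> / (1 + \<xi>)\<close> and
  explains the coefficient \<open>(1 + \<xi>) / \<rho>\<^sup>2\<close>.\<close>

lemma projector_inverse_step:
  assumes z_def: "z = Q (v i)" and w_def: "w = H (v i)"
    and \<rho>_def: "\<rho> = v i \<star> z" and \<xi>_def: "\<xi> = v i \<star> w"
    and Q'_def: "Q' = rank1 Q (- 1 / \<rho>) z"
    and H'_def: "H' = rank1 (rank1 H (- 1 / (1 + \<xi>)) w) ((1 + \<xi>) / \<rho>\<^sup>2) (z - (\<rho> / (1 + \<xi>)) *\<^sub>R w)"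
  assumes Q: "projector_off i v Q" and H: "inverse_pair (barrier i v Q 1 (\<lambda>_. 1)) H"
  shows "projector_off (Suc i) v Q' \<and> inverse_pair (barrier (Suc i) v Q' 1 (\<lambda>_. 1)) H'"
proof -
  let ?B = "barrier i v Q 1 (\<lambda>_. 1)"
  let ?u = "v i"
  note D = inverse_pairD[OF H]
  have sQ: "symop Q" and QQ: "\<And>x. Q (Q x) = Q x" and Qv: "\<And>j x. j < i \<Longrightarrow> v j \<star> Q x = 0"
    using Q by (auto simp: projector_off_def)
  have zz: "z \<star> z = \<rho>" and zx: "\<And>x. ?u \<star> Q x = z \<star> x" and Qz: "Q z = z"
    unfolding \<rho>_def z_def using QQ symopD(4)[OF sQ] by (metis, metis, metis)
  have x0: "0 \<le> \<xi>" unfolding \<xi>_def w_def using inverse_pair_nonneg[OF H] .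
  have sQ': "symop Q'" unfolding Q'_def by (rule symop_rank1[OF sQ])
  have C: "inverse_pair (rank1 ?B 1 ?u) (rank1 H (- 1 / (1 + \<xi>)) w)"
    using inverse_pair_rank1[OF H, of 1 ?u] x0 by (simp add: \<xi>_def w_def)
  have comb_Suc: "comb (Suc i) v (\<lambda>_. 1) x = comb i v (\<lambda>_. 1) x + (?u \<star> x) *\<^sub>R ?u" for x
    by (simp add: comb_def)
  have zj: "v j \<star> z = 0" if "j < i" for j using Qv[OF that] z_def by simp
  show ?thesis
  proof (cases "\<rho> = 0")
    case True
    \<comment> \<open>Here \<open>z\<close> is a null vector, so the new vector is already
      orthogonal to the range of \<open>Q\<close>. As \<open>x / 0 = 0\<close>, the formulas for
      \<open>Q'\<close> and for the second update of \<open>H\<close> degenerate to no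
      change.\<close>
    have z0: "z \<star> x = 0" for x using ip_CS[of z x] zz True by simp
    have [simp]: "Q' = Q" "H' = rank1 H (- 1 / (1 + \<xi>)) w" by (auto simp: Q'_def H'_def True)
    have "projector_off (Suc i) v Q"
      unfolding projector_off_def using sQ QQ Qv zx z0 by (auto simp: less_Suc_eq)
    moreover have "barrier (Suc i) v Q 1 (\<lambda>_. 1) = rank1 ?B 1 ?u"
      by (rule ext) (simp add: barrier_def rank1_def comb_Suc)
    ultimately show ?thesis using C by simp
  next
    case False
    then have r0: "0 < \<rho>" using zz ip_nonneg[of z] by simp
    let ?M = "rank1 H (- 1 / (1 + \<xi>)) w"
    have "?B z = z" by (simp add: barrier_def comb_def zj Qz)
    then have Hz: "H z = z" using D(6)[of z] by simp
    have wz: "w \<star> z = \<rho>" unfolding w_def symopD(4)[OF D(4)] Hz by (simp add: \<rho>_def)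
    have Mz: "?M z = z - (\<rho> / (1 + \<xi>)) *\<^sub>R w" by (simp add: rank1_def Hz wz)
    have zMz: "z \<star> ?M z = \<rho> - \<rho>\<^sup>2 / (1 + \<xi>)"
      using wz unfolding Mz by (simp add: ip_simps zz ip_commute power2_eq_square)
    have den: "1 + (- 1 / \<rho>) * (z \<star> ?M z) = \<rho> / (1 + \<xi>)"
      unfolding zMz right_diff_distrib using r0 by (simp add: power2_eq_square)
    have "0 < 1 + (- 1 / \<rho>) * (z \<star> ?M z)" unfolding den using r0 x0 by simp
    from inverse_pair_rank1[OF C this]
    have "inverse_pair (rank1 (rank1 ?B 1 ?u) (- 1 / \<rho>) z)
      (rank1 ?M (- ((- 1 / \<rho>) / (\<rho> / (1 + \<xi>)))) (z - (\<rho> / (1 + \<xi>)) *\<^sub>R w))"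
      unfolding den unfolding Mz .
    moreover have "rank1 (rank1 ?B 1 ?u) (- 1 / \<rho>) z = barrier (Suc i) v Q' 1 (\<lambda>_. 1)"
      by (rule ext) (simp add: barrier_def rank1_def comb_Suc Q'_def)
    moreover have "rank1 ?M (- ((- 1 / \<rho>) / (\<rho> / (1 + \<xi>)))) (z - (\<rho> / (1 + \<xi>)) *\<^sub>R w) = H'"
      unfolding H'_def by (simp add: power2_eq_square)
    ultimately have "inverse_pair (barrier (Suc i) v Q' 1 (\<lambda>_. 1)) H'" by simp
    moreover have "Q' (Q' x) = Q' x" for x
      using r0 by (simp add: Q'_def rank1_def symopD[OF sQ] QQ Qz ip_simps zz)
        (simp add: symopD(4)[OF sQ, symmetric] Qz)
    moreover have "v j \<star> Q' x = 0" if "j < Suc i" for j x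
      using that r0 zj[of j] Qv[of j] by (auto simp: less_Suc_eq Q'_def rank1_def ip_simps zx \<rho>_def[symmetric])
    ultimately show ?thesis using sQ' by (auto simp: projector_off_def)
  qed
qed

end

section \<open>Traces in an orthonormal basis\<close>

locale psd_form_basis = psd_form +
  fixes n :: nat and e :: "nat \<Rightarrow> 'a"
  assumes basis_norm: "i < n \<Longrightarrow> e i \<star> e i = 1"
    and parseval: "x \<star> y = (\<Sum>i<n. (x \<star> e i) * (e i \<star> y))"
begin

text \<open>The sum is the trace of \<open>H A\<close>, and \<open>H A = I - H Q\<close> because
  \<open>H\<close> inverts \<open>A + Q\<close>. By cyclicity and \<open>Q Q = Q\<close> the trace
  of \<open>H Q\<close> is that of \<open>Q H Q\<close>, hence nonnegative. Cyclicity appears as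
  exchanging the sums of two Parseval expansions.\<close>

lemma trace_le_dim:
  assumes Q: "projector_off m v Q" and H: "inverse_pair (barrier m v Q 1 (\<lambda>_. 1)) H"
  shows "(\<Sum>i<m. v i \<star> H (v i)) \<le> real n"
proof -
  note D = inverse_pairD[OF H]
  have sQ: "symop Q" and QQ: "\<And>x. Q (Q x) = Q x"
    using Q by (auto simp: projector_off_def)
  have "(\<Sum>i<m. v i \<star> H (v i)) = (\<Sum>i<m. \<Sum>j<n. (v i \<star> e j) * (e j \<star> H (v i)))"
    by (intro sum.cong refl parseval)
  also have "\<dots> = (\<Sum>j<n. \<Sum>i<m. (v i \<star> e j) * (e j \<star> H (v i)))" by (rule sum.swap)
  also have "\<dots> = (\<Sum>j<n. H (e j) \<star> comb m v (\<lambda>_. 1) (e j))"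
    by (simp add: ip_comb symopD(4)[OF D(4)] ip_commute[of "H (e _)" "v _"])
      (simp add: symopD(4)[OF D(4), symmetric] ip_commute[of "H (v _)" "e _"])
  also have "\<dots> = (\<Sum>j<n. 1 - H (e j) \<star> Q (e j))"
  proof (intro sum.cong refl)
    fix j assume "j \<in> {..<n}"
    have "comb m v (\<lambda>_. 1) (e j) = barrier m v Q 1 (\<lambda>_. 1) (e j) - Q (e j)" by (simp add: barrier_def)
    then show "H (e j) \<star> comb m v (\<lambda>_. 1) (e j) = 1 - H (e j) \<star> Q (e j)"
      using basis_norm \<open>j \<in> {..<n}\<close> by (simp add: ip_simps symopD(4)[OF D(4)] D(6))
  qed
  also have "\<dots> = real n - (\<Sum>j<n. H (e j) \<star> Q (e j))" by (simp add: sum_subtractf)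
  also have "(\<Sum>j<n. H (e j) \<star> Q (e j)) = (\<Sum>j<n. Q (H (e j)) \<star> Q (e j))"
    by (simp add: symopD(4)[OF sQ] QQ)
  also have "\<dots> = (\<Sum>j<n. \<Sum>k<n. (Q (H (e j)) \<star> e k) * (e k \<star> Q (e j)))"
    by (intro sum.cong refl parseval)
  also have "\<dots> = (\<Sum>k<n. \<Sum>j<n. (Q (H (e j)) \<star> e k) * (e k \<star> Q (e j)))" by (rule sum.swap)
  also have "\<dots> = (\<Sum>k<n. H (Q (e k)) \<star> Q (e k))"
  proof (intro sum.cong refl)
    fix k
    show "(\<Sum>j<n. (Q (H (e j)) \<star> e k) * (e k \<star> Q (e j))) = H (Q (e k)) \<star> Q (e k)"
      unfolding parseval[of "H (Q (e k))" "Q (e k)"]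
      by (intro sum.cong refl)
        (metis ip_commute mult.commute symopD(4)[OF sQ] symopD(4)[OF D(4)])
  qed
  finally have "(\<Sum>i<m. v i \<star> H (v i)) = real n - (\<Sum>k<n. H (Q (e k)) \<star> Q (e k))" .
  moreover have "0 \<le> (\<Sum>k<n. H (Q (e k)) \<star> Q (e k))"
    using inverse_pair_nonneg[OF H] by (intro sum_nonneg) (simp add: ip_commute)
  ultimately show ?thesis by simp
qed

end

section \<open>One-pass sampling\<close>

text \<open>If dropping also increased the potential, then so would the average of the two choices with
  probabilities \<open>p = (x + y) / K\<close> and \<open>1 - p\<close>.\<close>

lemma sampling_step_scalar:
  fixes \<eta> K x y a b s :: real
  defines "f \<equiv> \<lambda>c x. c / (1 + c * x)"
  assumes \<eta>: "0 < \<eta>" "\<eta> < 1" and K: "K = \<eta> / (1 + \<eta>)"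
    and nn: "0 \<le> x" "0 \<le> y" "0 \<le> a" "0 \<le> b" and p: "x + y < K" "0 < x + y" and s: "s = K / (x + y)"
    and no: "x + y < K - f (1 + \<eta> - s) x * a - f (s - 1 + \<eta>) y * b"
  shows "- f (1 + \<eta>) x * a - f (\<eta> - 1) y * b \<le> x + y"
proof -
  define p where "p = (x + y) / K"
  have K0: "0 < K" "K < 1" using \<eta> K by auto
  have p0: "0 < p" "p < 1" and s1: "s = 1 / p" using p K0 s by (auto simp: p_def)
  have pK: "p * K = x + y" using K0 by (simp add: p_def)
  have e1: "(1 + \<eta>) * K = \<eta>" using K \<eta> by simp
  have xK: "x \<le> p * K" and yK: "y \<le> p * K" using pK nn by auto
  \<comment> \<open>\<open>c\<close> and \<open>d\<close> are the coefficient changes when the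
    vector is taken and when it is dropped. Over the common denominator the cross terms
    \<open>p * c * d * t\<close> and \<open>(1 - p) * c * d * t\<close> add up to
    \<open>c * d * t\<close>, so only one numerator has to be checked.\<close>
  have key: "0 \<le> p * (c / (1 + c * t)) + (1 - p) * (d / (1 + d * t))"
    if "0 < 1 + c * t" "0 < 1 + d * t" "0 \<le> p * c + (1 - p) * d + c * d * t" for c d t
  proof -
    have "p * (c / (1 + c * t)) + (1 - p) * (d / (1 + d * t))
      = (p * c + (1 - p) * d + c * d * t) / ((1 + c * t) * (1 + d * t))"
      using that(1,2) by (simp add: divide_simps) (simp add: algebra_simps)
    with that show ?thesis by simp
  qed
  have xs: "s * x \<le> K" using xK p0 by (simp add: s1 field_simps)
  have ys: "s * y \<le> K" using yK p0 by (simp add: s1 field_simps)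
  have ps: "p * s = 1" using p0 by (simp add: s1)
  have ux: "0 < 1 + (1 + \<eta> - s) * x"
  proof -
    have "0 \<le> (1 + \<eta>) * x" using \<eta> nn by simp
    then show ?thesis using xs K0 by (simp add: algebra_simps)
  qed
  have pKK: "p * K < K" using p0 K0 by simp
  have y1: "y < 1" using yK pKK K0 by linarith
  have s_gt: "1 < s" using p0 by (simp add: s1)
  \<comment> \<open>Because \<open>p * s = 1\<close>, the mean coefficient change is \<eta>. It has
    to absorb \<open>(1 + \<eta>) * (s * x)\<close>, which is at most
    \<open>(1 + \<eta>) * K = \<eta>\<close>; this is where \<open>K\<close> comes from.\<close>
  have U: "0 \<le> p * f (1 + \<eta> - s) x + (1 - p) * f (1 + \<eta>) x"
    unfolding f_def
  proof (rule key)
    show "0 < 1 + (1 + \<eta>) * x" using \<eta> nn by (simp add: add_pos_nonneg)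
    have "(1 + \<eta>) * (s * x) \<le> (1 + \<eta>) * K" using xs \<eta> by (intro mult_left_mono) auto
    moreover have "0 \<le> (1 + \<eta>) * (1 + \<eta>) * x" using \<eta> nn by simp
    moreover have "p * (1 + \<eta> - s) + (1 - p) * (1 + \<eta>) + (1 + \<eta> - s) * (1 + \<eta>) * x
      = \<eta> + (1 - p * s) + (1 + \<eta>) * (1 + \<eta>) * x - (1 + \<eta>) * (s * x)" by (simp add: algebra_simps)
    ultimately show "0 \<le> p * (1 + \<eta> - s) + (1 - p) * (1 + \<eta>) + (1 + \<eta> - s) * (1 + \<eta>) * x"
      using ps e1 by simp
  qed (rule ux)
  \<comment> \<open>For the lower barrier the mean change is again \<eta>, and the term to absorb
    carries the smaller factor \<open>1 - \<eta>\<close>, so the same \<open>K\<close>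
    suffices.\<close>
  have L: "0 \<le> p * f (s - 1 + \<eta>) y + (1 - p) * f (\<eta> - 1) y"
    unfolding f_def
  proof (rule key)
    show "0 < 1 + (s - 1 + \<eta>) * y" using s_gt \<eta> nn by (intro add_pos_nonneg) auto
    have "(1 - \<eta>) * y \<le> 1 * y" using \<eta> nn by (intro mult_right_mono) auto
    then show "0 < 1 + (\<eta> - 1) * y" using y1 by (simp add: algebra_simps)
    have "(1 - \<eta>) * (s * y) \<le> (1 + \<eta>) * K" using ys \<eta> nn s_gt by (intro mult_mono) auto
    moreover have "0 \<le> (1 - \<eta>) * (1 - \<eta>) * y" using \<eta> nn by simp
    moreover have "p * (s - 1 + \<eta>) + (1 - p) * (\<eta> - 1) + (s - 1 + \<eta>) * (\<eta> - 1) * y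
      = \<eta> + (p * s - 1) + (1 - \<eta>) * (1 - \<eta>) * y - (1 - \<eta>) * (s * y)" by (simp add: algebra_simps)
    ultimately show "0 \<le> p * (s - 1 + \<eta>) + (1 - p) * (\<eta> - 1) + (s - 1 + \<eta>) * (\<eta> - 1) * y"
      using ps e1 by simp
  qed
  show ?thesis
  proof (rule ccontr)
    assume neg: "\<not> ?thesis"
    have "p * (x + y) + (1 - p) * (x + y) < p * (K - f (1 + \<eta> - s) x * a - f (s - 1 + \<eta>) y * b)
       + (1 - p) * (- f (1 + \<eta>) x * a - f (\<eta> - 1) y * b)"
      using no neg p0 by (intro add_strict_mono mult_strict_left_mono) auto
    also have "\<dots> = p * K - (p * f (1 + \<eta> - s) x + (1 - p) * f (1 + \<eta>) x) * a
        - (p * f (s - 1 + \<eta>) y + (1 - p) * f (\<eta> - 1) y) * b" by (simp add: algebra_simps)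
    also have "\<dots> \<le> p * K" using mult_nonneg_nonneg[OF U nn(3)] mult_nonneg_nonneg[OF L nn(4)] by simp
    finally show False using pK by (simp add: algebra_simps)
  qed
qed

context psd_form
begin

lemma quad_rank1: "u \<star> rank1 M c w u = u \<star> M u + c * (u \<star> w)\<^sup>2"
  by (simp add: rank1_def ip_simps power2_eq_square ip_commute)

lemma trace_rank1:
  "(\<Sum>j\<in>S. v j \<star> rank1 M c w (v j)) = (\<Sum>j\<in>S. v j \<star> M (v j)) + c * (\<Sum>j\<in>S. (v j \<star> w)\<^sup>2)"
  by (simp add: quad_rank1 sum.distrib sum_distrib_left)

text \<open>A vector still to be scanned has coefficient \<eta> in both barriers; a scanned one has
  \<open>1 + 2 * \<eta> - s j\<close> in the upper and \<open>s j - 1 + 2 * \<eta>\<close> in the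
  lower. At \<open>i = m\<close> nonnegativity of the barriers is therefore approximation within
  \<open>1 \<plusminus> 2 * \<eta>\<close>. The traces run over the vectors still to come, so that a
  scanned vector pays for its step by leaving them.\<close>

definition sampling_inv where
  "sampling_inv m v Q \<eta> \<Psi> i M N s \<longleftrightarrow>
    inverse_pair (barrier m v Q \<eta> (\<lambda>j. \<eta> + (if j < i then 1 + \<eta> - s j else 0))) M \<and>
    inverse_pair (barrier m v Q \<eta> (\<lambda>j. \<eta> + (if j < i then s j - 1 + \<eta> else 0))) N \<and>
    (\<forall>j. 0 \<le> s j) \<and>
    \<eta> / (1 + \<eta>) * real (card {j. j < i \<and> s j \<noteq> 0}) + (\<Sum>j\<in>{i..<m}. v j \<star> M (v j))
      + (\<Sum>j\<in>{i..<m}. v j \<star> N (v j)) \<le> \<Psi>"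

lemma sampling_step:
  assumes inv: "sampling_inv m v Q \<eta> \<Psi> i M N s" and i: "i < m" and \<eta>: "0 < \<eta>" "\<eta> < 1"
    and w: "w = M (v i)" and z: "z = N (v i)" and x: "x = v i \<star> w" and y: "y = v i \<star> z"
    and a: "a = (\<Sum>j\<in>{Suc i..<m}. (v j \<star> w)\<^sup>2)" and b: "b = (\<Sum>j\<in>{Suc i..<m}. (v j \<star> z)\<^sup>2)"
    and K: "K = \<eta> / (1 + \<eta>)"
    and r: "r = (if K \<le> x + y then 1 else
       let t = K / (x + y) in
       if K - (1 + \<eta> - t) / (1 + (1 + \<eta> - t) * x) * a - (t - 1 + \<eta>) / (1 + (t - 1 + \<eta>) * y) * b \<le> x + y
       then t else 0)"
  shows "sampling_inv m v Q \<eta> \<Psi> (Suc i)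
    (rank1 M (- ((1 + \<eta> - r) / (1 + (1 + \<eta> - r) * x))) w)
    (rank1 N (- ((r - 1 + \<eta>) / (1 + (r - 1 + \<eta>) * y))) z) (s(i := r))"
proof -
  let ?f = "\<lambda>c x. c / (1 + c * x :: real)"
  have M: "inverse_pair (barrier m v Q \<eta> (\<lambda>j. \<eta> + (if j < i then 1 + \<eta> - s j else 0))) M"
    and N: "inverse_pair (barrier m v Q \<eta> (\<lambda>j. \<eta> + (if j < i then s j - 1 + \<eta> else 0))) N"
    and s: "\<And>j. 0 \<le> s j"
    and pot: "K * real (card {j. j < i \<and> s j \<noteq> 0}) + (\<Sum>j\<in>{i..<m}. v j \<star> M (v j))
      + (\<Sum>j\<in>{i..<m}. v j \<star> N (v j)) \<le> \<Psi>"
    using inv K by (auto simp: sampling_inv_def)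
  have K0: "0 < K" "K < 1" using \<eta> K by auto
  have nn: "0 \<le> x" "0 \<le> y" using inverse_pair_nonneg M N by (auto simp: x y w z)
  have ab: "0 \<le> a" "0 \<le> b" by (auto simp: a b sum_nonneg)
  \<comment> \<open>If \<open>x + y = 0\<close>, the tentative weight \<open>K / (x + y)\<close> is
    0 and both branches drop the vector. The vector is then orthogonal to everything, so
    \<open>a\<close> and \<open>b\<close> vanish and the potential does not move.\<close>
  have null: "a = 0" "b = 0" if "x + y = 0"
  proof -
    have xy: "x = 0" "y = 0" using that nn by auto
    have 1: "(v i \<star> u)\<^sup>2 \<le> 0" for u
      using inverse_pair_CS[OF M, of "v i" u] xy by (simp add: x w)
    have 2: "v j \<star> w = 0" "v j \<star> z = 0" for j
      using 1[of "M (v j)"] 1[of "N (v j)"] symopD(4)[OF inverse_pairD(4)[OF M], of "v j" "v i"]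
        symopD(4)[OF inverse_pairD(4)[OF N], of "v j" "v i"] ip_commute[of "v i"]
      by (simp_all add: w z)
    show "a = 0" "b = 0" using 2 by (simp_all add: a b)
  qed
  have r_cases: "(K \<le> x + y \<and> r = 1) \<or>
     (x + y < K \<and> 0 < x + y \<and> r = K / (x + y) \<and> K - ?f (1 + \<eta> - r) x * a - ?f (r - 1 + \<eta>) y * b \<le> x + y) \<or>
     (x + y < K \<and> r = 0 \<and> - ?f (1 + \<eta>) x * a - ?f (\<eta> - 1) y * b \<le> x + y)"
  proof (cases "K \<le> x + y")
    case False
    show ?thesis
    proof (cases "x + y = 0")
      case True
      then show ?thesis using null[OF True] False K0 by (auto simp: r Let_def)
    next
      case nz: False
      show ?thesis
        using False nz nn sampling_step_scalar[OF \<eta> K nn ab, of "K / (x + y)"]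
        by (auto simp: r Let_def)
    qed
  qed (simp add: r)
  have r0: "0 \<le> r" using r_cases K0 nn by auto
  have rx: "r * x \<le> K \<or> r = 1"
    using r_cases K0 nn by (auto simp: field_simps)
  have den1: "0 < 1 + (1 + \<eta> - r) * x"
    using rx
  proof
    assume "r * x \<le> K"
    moreover have "0 \<le> (1 + \<eta>) * x" using \<eta> nn by simp
    ultimately show ?thesis using K0 by (simp add: algebra_simps)
  qed (use \<eta> nn in \<open>simp add: add_pos_nonneg\<close>)
  \<comment> \<open>Dropping lowers the coefficient by \<open>1 - \<eta>\<close>, which is safe
    because it happens only when \<open>y \<le> x + y < K < 1\<close>. Any nonzero weight is at
    least 1 and raises the coefficient.\<close>
  have den2: "0 < 1 + (r - 1 + \<eta>) * y"
  proof (cases "r = 0")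
    case True
    have "y < 1" using r_cases True K0 nn by auto
    moreover have "(1 - \<eta>) * y \<le> 1 * y" using \<eta> nn by (intro mult_right_mono) auto
    ultimately show ?thesis using True by (simp add: algebra_simps)
  next
    case False
    then have "1 \<le> r" using r_cases nn by auto
    then show ?thesis using \<eta> nn by (intro add_pos_nonneg) auto
  qed
  let ?M = "rank1 M (- ?f (1 + \<eta> - r) x) w" and ?N = "rank1 N (- ?f (r - 1 + \<eta>) y) z"
  have M': "inverse_pair (barrier m v Q \<eta> (\<lambda>j. \<eta> + (if j < Suc i then 1 + \<eta> - (s(i := r)) j else 0))) ?M"
  proof -
    have "(\<lambda>j. \<eta> + (if j < i then 1 + \<eta> - s j else 0))(i := \<eta> + (if i < i then 1 + \<eta> - s i else 0) + (1 + \<eta> - r))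
      = (\<lambda>j. \<eta> + (if j < Suc i then 1 + \<eta> - (s(i := r)) j else 0))"
      by (auto simp: fun_eq_iff less_Suc_eq)
    with barrier_inverse_step[OF M i, of "1 + \<eta> - r"] den1 show ?thesis by (simp add: x w)
  qed
  have N': "inverse_pair (barrier m v Q \<eta> (\<lambda>j. \<eta> + (if j < Suc i then (s(i := r)) j - 1 + \<eta> else 0))) ?N"
  proof -
    have "(\<lambda>j. \<eta> + (if j < i then s j - 1 + \<eta> else 0))(i := \<eta> + (if i < i then s i - 1 + \<eta> else 0) + (r - 1 + \<eta>))
      = (\<lambda>j. \<eta> + (if j < Suc i then (s(i := r)) j - 1 + \<eta> else 0))"
      by (auto simp: fun_eq_iff less_Suc_eq)
    with barrier_inverse_step[OF N i, of "r - 1 + \<eta>"] den2 show ?thesis by (simp add: y z)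
  qed
  have card: "real (card {j. j < Suc i \<and> (s(i := r)) j \<noteq> 0}) = real (card {j. j < i \<and> s j \<noteq> 0}) + (if r = 0 then 0 else 1)"
  proof -
    have "{j. j < Suc i \<and> (s(i := r)) j \<noteq> 0} = {j. j < i \<and> s j \<noteq> 0} \<union> (if r = 0 then {} else {i})"
      by (auto simp: less_Suc_eq)
    then show ?thesis by auto
  qed
  have tr: "(\<Sum>j\<in>{i..<m}. g j) = g i + (\<Sum>j\<in>{Suc i..<m}. g j)" for g :: "nat \<Rightarrow> real"
    using i by (simp add: sum.atLeast_Suc_lessThan)
  \<comment> \<open>The right-hand side is what the potential loses when the vector leaves the two
    sums. It pays for the counter and for the growth of the remaining traces. A forced vector of
    weight 1 raises both coefficients by \<eta>, so the traces fall, and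
    \<open>K \<le> x + y\<close> covers the counter.\<close>
  have dec: "K * (if r = 0 then 0 else 1) - ?f (1 + \<eta> - r) x * a - ?f (r - 1 + \<eta>) y * b \<le> x + y"
    using r_cases
  proof (elim disjE conjE)
    assume "K \<le> x + y" "r = 1"
    moreover have "0 \<le> ?f \<eta> x * a" "0 \<le> ?f \<eta> y * b" using \<eta> nn ab by auto
    ultimately show ?thesis by simp
  qed (use K0 in auto)
  have "K * real (card {j. j < Suc i \<and> (s(i := r)) j \<noteq> 0}) + (\<Sum>j\<in>{Suc i..<m}. v j \<star> ?M (v j))
      + (\<Sum>j\<in>{Suc i..<m}. v j \<star> ?N (v j)) \<le> \<Psi>"
    using pot dec unfolding card trace_rank1 a[symmetric] b[symmetric] tr
    by (simp add: x[unfolded w, symmetric] y[unfolded z, symmetric] algebra_simps)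
  with M' N' s r0 show ?thesis unfolding sampling_inv_def K by auto
qed

lemma sampling_inv_init:
  assumes H: "inverse_pair (barrier m v Q 1 (\<lambda>_. 1)) H" and tr: "(\<Sum>i<m. v i \<star> H (v i)) \<le> d" and \<eta>: "0 < \<eta>"
  shows "sampling_inv m v Q \<eta> (2 * d / \<eta>) 0 (\<lambda>x. (1 / \<eta>) *\<^sub>R H x) (\<lambda>x. (1 / \<eta>) *\<^sub>R H x) (\<lambda>_. 0)"
proof -
  have "(\<Sum>j\<in>{0..<m}. v j \<star> (1 / \<eta>) *\<^sub>R H (v j)) \<le> d / \<eta>"
    using tr \<eta> by (simp add: ip_simps sum_divide_distrib[symmetric] divide_right_mono atLeast0LessThan)
  then show ?thesis using inverse_pair_scale[OF H \<eta>]
    by (simp add: sampling_inv_def)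
qed

lemma sampling_inv_final:
  assumes inv: "sampling_inv m v Q \<eta> \<Psi> m M N s" and Q: "projector_off m v Q" and \<eta>: "0 < \<eta>"
  shows "(\<Sum>j<m. s j * (v j \<star> x)\<^sup>2) \<le> (1 + 2 * \<eta>) * (\<Sum>j<m. (v j \<star> x)\<^sup>2)"
    and "(1 - 2 * \<eta>) * (\<Sum>j<m. (v j \<star> x)\<^sup>2) \<le> (\<Sum>j<m. s j * (v j \<star> x)\<^sup>2)"
    and "\<eta> / (1 + \<eta>) * real (card {j. j < m \<and> s j \<noteq> 0}) \<le> \<Psi>"
proof -
  have M: "inverse_pair (barrier m v Q \<eta> (\<lambda>j. \<eta> + (if j < m then 1 + \<eta> - s j else 0))) M"
    and N: "inverse_pair (barrier m v Q \<eta> (\<lambda>j. \<eta> + (if j < m then s j - 1 + \<eta> else 0))) N"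
    using inv by (auto simp: sampling_inv_def)
  have "0 \<le> (\<Sum>j<m. (\<eta> + (if j < m then 1 + \<eta> - s j else 0)) * (v j \<star> x)\<^sup>2)"
    using barrier_psd_imp[OF inverse_pairD(1)[OF M] Q] .
  also have "\<dots> = (\<Sum>j<m. (1 + 2 * \<eta>) * (v j \<star> x)\<^sup>2 - s j * (v j \<star> x)\<^sup>2)"
    by (intro sum.cong) (auto simp: algebra_simps)
  finally show "(\<Sum>j<m. s j * (v j \<star> x)\<^sup>2) \<le> (1 + 2 * \<eta>) * (\<Sum>j<m. (v j \<star> x)\<^sup>2)"
    by (simp add: sum_subtractf sum_distrib_left)
  have "0 \<le> (\<Sum>j<m. (\<eta> + (if j < m then s j - 1 + \<eta> else 0)) * (v j \<star> x)\<^sup>2)"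
    using barrier_psd_imp[OF inverse_pairD(1)[OF N] Q] .
  also have "\<dots> = (\<Sum>j<m. s j * (v j \<star> x)\<^sup>2 - (1 - 2 * \<eta>) * (v j \<star> x)\<^sup>2)"
    by (intro sum.cong) (auto simp: algebra_simps)
  finally show "(1 - 2 * \<eta>) * (\<Sum>j<m. (v j \<star> x)\<^sup>2) \<le> (\<Sum>j<m. s j * (v j \<star> x)\<^sup>2)"
    by (simp add: sum_subtractf sum_distrib_left)
  show "\<eta> / (1 + \<eta>) * real (card {j. j < m \<and> s j \<noteq> 0}) \<le> \<Psi>"
    using inv by (simp add: sampling_inv_def)
qed

section \<open>Barrier method\<close>

text \<open>The two sums are the upper and lower potentials. The multiples \<beta> and \<gamma> of
  \<open>Q\<close> keep their initial values while \<open>u\<close> and \<open>l\<close> move, since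
  on the range of \<open>Q\<close> there is nothing to bound.\<close>

definition bss_inv where
  "bss_inv m v Q \<beta> \<gamma> E F u l M N g \<longleftrightarrow>
    inverse_pair (barrier m v Q \<beta> (\<lambda>j. u - g j)) M \<and>
    inverse_pair (barrier m v Q \<gamma> (\<lambda>j. g j - l)) N \<and>
    (\<forall>j. 0 \<le> g j) \<and> (\<Sum>j<m. v j \<star> M (v j)) \<le> E \<and> (\<Sum>j<m. v j \<star> N (v j)) \<le> F"

text \<open>The barriers have been moved along the first \<open>i\<close> vectors. The last conjunct is what keeps the
  lower barrier positive while it moves.\<close>

definition shift_inv where
  "shift_inv m v Q \<beta> \<gamma> u l \<delta> g i M N \<longleftrightarrow>
    inverse_pair (barrier m v Q \<beta> (\<lambda>j. u + (if j < i then \<delta> else 0) - g j)) M \<and>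
    inverse_pair (barrier m v Q \<gamma> (\<lambda>j. g j - l - (if j < i then 1 else 0))) N \<and>
    (\<Sum>j\<in>{i..<m}. v j \<star> N (v j)) < 1"

lemma shift_inv_init:
  assumes "bss_inv m v Q \<beta> \<gamma> E F u l M N g" "F < 1"
  shows "shift_inv m v Q \<beta> \<gamma> u l \<delta> g 0 M N"
  using assms by (auto simp: bss_inv_def shift_inv_def atLeast0LessThan)

text \<open>Only the lower barrier is in danger. With \<open>y\<close> the share of the current
  vector and \<open>r\<close> that of the later ones, Cauchy-Schwarz for \<open>N\<close> bounds the
  new remaining trace by \<open>r + r * y / (1 - y) = r / (1 - y)\<close>. This is below 1 exactly
  when \<open>y + r < 1\<close>, so the condition reproduces itself.\<close>

lemma shift_inv_step:
  assumes inv: "shift_inv m v Q \<beta> \<gamma> u l \<delta> g i M N" and i: "i < m" and \<delta>: "0 \<le> \<delta>"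
    and w: "w = M (v i)" and z: "z = N (v i)" and x: "x = v i \<star> w" and y: "y = v i \<star> z"
  shows "shift_inv m v Q \<beta> \<gamma> u l \<delta> g (Suc i) (rank1 M (- (\<delta> / (1 + \<delta> * x))) w) (rank1 N (1 / (1 - y)) z)"
proof -
  have M: "inverse_pair (barrier m v Q \<beta> (\<lambda>j. u + (if j < i then \<delta> else 0) - g j)) M"
    and N: "inverse_pair (barrier m v Q \<gamma> (\<lambda>j. g j - l - (if j < i then 1 else 0))) N"
    and R: "(\<Sum>j\<in>{i..<m}. v j \<star> N (v j)) < 1"
    using inv by (auto simp: shift_inv_def)
  have nn: "0 \<le> x" "0 \<le> y" using inverse_pair_nonneg M N by (auto simp: x y w z)
  define r where "r = (\<Sum>j\<in>{Suc i..<m}. v j \<star> N (v j))"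
  have ry: "y + r < 1" using R i by (simp add: sum.atLeast_Suc_lessThan r_def y z)
  have r0: "0 \<le> r" unfolding r_def using inverse_pair_nonneg[OF N] by (intro sum_nonneg) auto
  have "(\<lambda>j. u + (if j < i then \<delta> else 0) - g j)(i := u + (if i < i then \<delta> else 0) - g i + \<delta>)
      = (\<lambda>j. u + (if j < Suc i then \<delta> else 0) - g j)"
    by (auto simp: fun_eq_iff less_Suc_eq)
  moreover have "0 < 1 + \<delta> * (v i \<star> M (v i))" using \<delta> nn(1) by (simp add: x w add_pos_nonneg)
  ultimately have 1: "inverse_pair (barrier m v Q \<beta> (\<lambda>j. u + (if j < Suc i then \<delta> else 0) - g j))
      (rank1 M (- (\<delta> / (1 + \<delta> * x))) w)"
    using barrier_inverse_step[OF M i, of \<delta>] by (simp add: x w)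
  have "(\<lambda>j. g j - l - (if j < i then 1 else 0))(i := g i - l - (if i < i then 1 else 0) + (- 1))
      = (\<lambda>j. g j - l - (if j < Suc i then 1 else 0))"
    by (auto simp: fun_eq_iff less_Suc_eq)
  moreover have "0 < 1 + (- 1) * (v i \<star> N (v i))" using ry r0 by (simp add: y z)
  ultimately have 2: "inverse_pair (barrier m v Q \<gamma> (\<lambda>j. g j - l - (if j < Suc i then 1 else 0)))
      (rank1 N (1 / (1 - y)) z)"
    using barrier_inverse_step[OF N i, of "- 1"] by (simp add: y z)
  have "(\<Sum>j\<in>{Suc i..<m}. (v j \<star> z)\<^sup>2) \<le> (\<Sum>j\<in>{Suc i..<m}. (v j \<star> N (v j)) * y)"
    using psdop_CS[OF inverse_pairD(2)[OF N]] by (intro sum_mono) (simp add: y z)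
  then have "(\<Sum>j\<in>{Suc i..<m}. (v j \<star> z)\<^sup>2) \<le> r * y" by (simp add: r_def sum_distrib_right)
  then have "(\<Sum>j\<in>{Suc i..<m}. (v j \<star> z)\<^sup>2) / (1 - y) \<le> r * y / (1 - y)"
    using ry r0 by (intro divide_right_mono) auto
  then have "r + (\<Sum>j\<in>{Suc i..<m}. (v j \<star> z)\<^sup>2) / (1 - y) \<le> r + r * y / (1 - y)" by simp
  also have "\<dots> = r / (1 - y)" using ry r0 by (simp add: field_simps)
  also have "\<dots> < 1" using ry r0 by (simp add: field_simps)
  finally have 3: "(\<Sum>j\<in>{Suc i..<m}. v j \<star> rank1 N (1 / (1 - y)) z (v j)) < 1"
    by (simp add: trace_rank1 r_def)
  show ?thesis using 1 2 3 by (auto simp: shift_inv_def)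
qed

section \<open>Resolvent identity and selection of the next vector\<close>

lemma resolvent:
  assumes P: "inverse_pair (barrier m v Q \<beta> g) P" and R: "inverse_pair (barrier m v Q \<beta> (\<lambda>j. g j + \<delta>)) R"
  shows "P x = R x + \<delta> *\<^sub>R P (comb m v (\<lambda>_. 1) (R x))" and "P x = R x + \<delta> *\<^sub>R R (comb m v (\<lambda>_. 1) (P x))"
proof -
  let ?X = "barrier m v Q \<beta> g" and ?Y = "barrier m v Q \<beta> (\<lambda>j. g j + \<delta>)" and ?A = "comb m v (\<lambda>_. 1)"
  have Y: "?Y y = ?X y + \<delta> *\<^sub>R ?A y" for y
    by (simp add: barrier_def comb_def scaleR_sum_right sum.distrib[symmetric] algebra_simps)
  note DP = inverse_pairD[OF P] and DR = inverse_pairD[OF R]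
  have "P x = P (?Y (R x))" by (simp add: DR)
  also have "\<dots> = R x + \<delta> *\<^sub>R P (?A (R x))" unfolding Y by (simp add: symopD[OF DP(4)] DP)
  finally show "P x = R x + \<delta> *\<^sub>R P (?A (R x))" .
  have "P x = R (?Y (P x))" by (simp add: DR)
  also have "\<dots> = R x + \<delta> *\<^sub>R R (?A (P x))" unfolding Y by (simp add: symopD[OF DR(4)] DP)
  finally show "P x = R x + \<delta> *\<^sub>R R (?A (P x))" .
qed

text \<open>The double sums stand for the traces of \<open>P A R A\<close>, \<open>R A R A\<close> and \<open>P A P A\<close>.\<close>

lemma resolvent_traces:
  assumes P: "inverse_pair (barrier m v Q \<beta> g) P" and R: "inverse_pair (barrier m v Q \<beta> (\<lambda>j. g j + \<delta>)) R"
    and \<delta>: "0 \<le> \<delta>"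
  defines "S \<equiv> \<Sum>i<m. \<Sum>j<m. (v j \<star> P (v i)) * (v j \<star> R (v i))"
  shows "(\<Sum>i<m. v i \<star> P (v i)) - (\<Sum>i<m. v i \<star> R (v i)) = \<delta> * S"
    and "(\<Sum>i<m. \<Sum>j<m. (v j \<star> R (v i))\<^sup>2) \<le> S"
    and "(\<Sum>i<m. v i \<star> R (v i)) \<le> 1 \<Longrightarrow> S + \<delta> * S\<^sup>2 \<le> (\<Sum>i<m. \<Sum>j<m. (v j \<star> P (v i))\<^sup>2)"
proof -
  let ?A = "comb m v (\<lambda>_. 1)"
  note DP = inverse_pairD[OF P] and DR = inverse_pairD[OF R]
  have A: "a \<star> ?A b = (\<Sum>j<m. (v j \<star> a) * (v j \<star> b))" for a b
    by (simp add: ip_comb mult.commute)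
  have A': "?A a \<star> b = (\<Sum>j<m. (v j \<star> a) * (v j \<star> b))" for a b
    using A[of b a] by (simp add: ip_commute mult.commute)
  have S: "S = (\<Sum>i<m. P (v i) \<star> ?A (R (v i)))" unfolding S_def A ..
  have "v i \<star> P (v i) - v i \<star> R (v i) = \<delta> * (P (v i) \<star> ?A (R (v i)))" for i
  proof -
    have "v i \<star> P (v i) = v i \<star> R (v i) + \<delta> * (v i \<star> P (?A (R (v i))))"
      by (subst resolvent(1)[OF P R]) (simp add: ip_simps)
    then show ?thesis by (simp add: symopD(4)[OF DP(4), symmetric])
  qed
  then show "(\<Sum>i<m. v i \<star> P (v i)) - (\<Sum>i<m. v i \<star> R (v i)) = \<delta> * S"
    by (simp add: S sum_subtractf[symmetric] sum_distrib_left)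
  have "(\<Sum>j<m. (v j \<star> R (v i))\<^sup>2) \<le> P (v i) \<star> ?A (R (v i))" for i
  proof -
    let ?a = "?A (R (v i))"
    have "P (v i) \<star> ?a = R (v i) \<star> ?a + \<delta> * (P ?a \<star> ?a)"
      by (subst resolvent(1)[OF P R]) (simp add: ip_simps)
    moreover have "0 \<le> P ?a \<star> ?a" using inverse_pair_nonneg[OF P, of ?a] by (simp add: ip_commute)
    moreover have "R (v i) \<star> ?a = (\<Sum>j<m. (v j \<star> R (v i))\<^sup>2)" by (simp add: A power2_eq_square)
    ultimately show ?thesis using \<delta> by simp
  qed
  then show "(\<Sum>i<m. \<Sum>j<m. (v j \<star> R (v i))\<^sup>2) \<le> S" unfolding S by (intro sum_mono)
  assume tr: "(\<Sum>i<m. v i \<star> R (v i)) \<le> 1"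
  define T where "T = (\<Sum>i<m. ?A (P (v i)) \<star> R (?A (P (v i))))"
  have "(\<Sum>j<m. (v j \<star> P (v i))\<^sup>2) = P (v i) \<star> ?A (R (v i)) + \<delta> * (?A (P (v i)) \<star> R (?A (P (v i))))" for i
  proof -
    let ?a = "?A (P (v i))"
    have "(\<Sum>j<m. (v j \<star> P (v i))\<^sup>2) = ?a \<star> P (v i)" by (simp add: A' power2_eq_square)
    also have "\<dots> = ?a \<star> R (v i) + \<delta> * (?a \<star> R ?a)"
      by (subst (2) resolvent(2)[OF P R]) (simp add: ip_simps)
    also have "?a \<star> R (v i) = P (v i) \<star> ?A (R (v i))" unfolding A A' ..
    finally show ?thesis .
  qed
  then have 1: "(\<Sum>i<m. \<Sum>j<m. (v j \<star> P (v i))\<^sup>2) = S + \<delta> * T"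
    by (simp add: S T_def sum.distrib sum_distrib_left)
  \<comment> \<open>A Cauchy-Schwarz inequality by completing the square: expanded, it reads
    \<open>0 \<le> S\<^sup>2 * tr (R A) - 2 * S\<^sup>2 + T\<close>. With the trace of
    \<open>R A\<close> at most 1 this leaves \<open>S\<^sup>2 \<le> T\<close>.\<close>
  have "0 \<le> (\<Sum>i<m. (S *\<^sub>R v i - ?A (P (v i))) \<star> R (S *\<^sub>R v i - ?A (P (v i))))"
    using inverse_pair_nonneg[OF R] by (intro sum_nonneg)
  also have "\<dots> = (\<Sum>i<m. S\<^sup>2 * (v i \<star> R (v i)) - 2 * S * (P (v i) \<star> ?A (R (v i))) + ?A (P (v i)) \<star> R (?A (P (v i))))"
  proof (intro sum.cong refl)
    fix i
    let ?a = "?A (P (v i))"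
    have "v i \<star> R ?a = ?a \<star> R (v i)" by (metis ip_commute symopD(4)[OF DR(4)])
    moreover have "?a \<star> R (v i) = P (v i) \<star> ?A (R (v i))" unfolding A A' ..
    ultimately show "(S *\<^sub>R v i - ?a) \<star> R (S *\<^sub>R v i - ?a)
       = S\<^sup>2 * (v i \<star> R (v i)) - 2 * S * (P (v i) \<star> ?A (R (v i))) + ?a \<star> R ?a"
      by (simp add: symopD(1,2,3)[OF DR(4)] ip_simps power2_eq_square algebra_simps)
  qed
  also have "\<dots> = S\<^sup>2 * (\<Sum>i<m. v i \<star> R (v i)) - 2 * S * S + T"
    by (simp add: sum.distrib sum_subtractf T_def S sum_distrib_left[symmetric])
  finally have "2 * S\<^sup>2 \<le> S\<^sup>2 * (\<Sum>i<m. v i \<star> R (v i)) + T" by (simp add: power2_eq_square)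
  moreover have "S\<^sup>2 * (\<Sum>i<m. v i \<star> R (v i)) \<le> S\<^sup>2 * 1" using tr by (intro mult_left_mono) auto
  ultimately have "S\<^sup>2 \<le> T" by simp
  then show "S + \<delta> * S\<^sup>2 \<le> (\<Sum>i<m. \<Sum>j<m. (v j \<star> P (v i))\<^sup>2)"
    unfolding 1 using \<delta> by (simp add: mult_left_mono)
qed

lemma null_vector:
  assumes "inverse_pair X M" "u \<star> M u = 0"
  shows "u \<star> y = 0"
  using inverse_pair_CS[OF assms(1), of u y] assms(2) by simp

text \<open>If every candidate failed, summing \<open>L i < U i\<close> over the candidates would contradict the bounds
  \<open>\<Sum>U \<le> 1/\<delta> + E\<close> and \<open>1 - F \<le> \<Sum>L\<close>, unless all vectors are null.\<close>

lemma bss_select: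
  assumes inv: "bss_inv m v Q \<beta> \<gamma> E F u l M N g" and sh: "shift_inv m v Q \<beta> \<gamma> u l \<delta> g m M1 N1"
    and F: "F < 1" and \<delta>: "0 < \<delta>" and EF: "0 \<le> E" "1 / \<delta> + E \<le> 1 - F"
  defines "DX \<equiv> (\<Sum>j<m. v j \<star> M (v j)) - (\<Sum>j<m. v j \<star> M1 (v j))"
    and "DY \<equiv> (\<Sum>j<m. v j \<star> N1 (v j)) - (\<Sum>j<m. v j \<star> N (v j))"
  defines "U \<equiv> \<lambda>i. (\<Sum>j<m. (v j \<star> M1 (v i))\<^sup>2) / DX + v i \<star> M1 (v i)"
    and "L \<equiv> \<lambda>i. (\<Sum>j<m. (v j \<star> N1 (v i))\<^sup>2) / DY - v i \<star> N1 (v i)"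
  shows "i < m \<Longrightarrow> 0 < U i \<Longrightarrow> U i \<le> L i \<Longrightarrow> bss_inv m v Q \<beta> \<gamma> E F (u + \<delta>) (l + 1)
      (rank1 M1 (1 / (U i - v i \<star> M1 (v i))) (M1 (v i)))
      (rank1 N1 (- (1 / (U i + v i \<star> N1 (v i)))) (N1 (v i))) (g(i := g i + 1 / U i))" (is "?i1 \<Longrightarrow> ?i2 \<Longrightarrow> ?i3 \<Longrightarrow> ?sel")
    and "(\<And>i. i < m \<Longrightarrow> 0 < U i \<Longrightarrow> \<not> U i \<le> L i) \<Longrightarrow> bss_inv m v Q \<beta> \<gamma> E F (u + \<delta>) (l + 1) M1 N1 g"
proof -
  let ?T = "\<lambda>P. \<Sum>i<m. \<Sum>j<m. (v j \<star> P (v i))\<^sup>2"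
  let ?tr = "\<lambda>P. \<Sum>i<m. v i \<star> P (v i)"
  have M: "inverse_pair (barrier m v Q \<beta> (\<lambda>j. u - g j)) M"
    and N: "inverse_pair (barrier m v Q \<gamma> (\<lambda>j. g j - l)) N"
    and g0: "\<And>j. 0 \<le> g j" and E: "?tr M \<le> E" and trF: "?tr N \<le> F"
    using inv by (auto simp: bss_inv_def)
  have "barrier m v Q \<beta> (\<lambda>j. u + (if j < m then \<delta> else 0) - g j) = barrier m v Q \<beta> (\<lambda>j. u + \<delta> - g j)"
    and "barrier m v Q \<gamma> (\<lambda>j. g j - l - (if j < m then 1 else 0)) = barrier m v Q \<gamma> (\<lambda>j. g j - (l + 1))"
    by (auto intro!: barrier_cong)
  then have M1: "inverse_pair (barrier m v Q \<beta> (\<lambda>j. u + \<delta> - g j)) M1"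
    and N1: "inverse_pair (barrier m v Q \<gamma> (\<lambda>j. g j - (l + 1))) N1"
    using sh by (auto simp: shift_inv_def)
  have nnM: "0 \<le> x \<star> M1 x" and nnN: "0 \<le> x \<star> N1 x" for x
    using inverse_pair_nonneg M1 N1 by auto
  have F0: "0 \<le> F" using trF inverse_pair_nonneg[OF N] by (meson order_trans sum_nonneg)
  define SX where "SX = (\<Sum>i<m. \<Sum>j<m. (v j \<star> M (v i)) * (v j \<star> M1 (v i)))"
  define SY where "SY = (\<Sum>i<m. \<Sum>j<m. (v j \<star> N1 (v i)) * (v j \<star> N (v i)))"
  have "(\<lambda>j. u - g j + \<delta>) = (\<lambda>j. u + \<delta> - g j)" and "(\<lambda>j. g j - (l + 1) + 1) = (\<lambda>j. g j - l)"
    by (auto simp: fun_eq_iff)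
  \<comment> \<open>The roles are opposite: the upper barrier recedes from \<open>P = M\<close> to
    \<open>R = M1\<close> by \<delta>, whereas the lower one advances from \<open>R = N\<close> to
    \<open>P = N1\<close> by 1. Thus \<open>DX\<close> is the drop of the upper potential and
    \<open>DY\<close> the rise of the lower one.\<close>
  note X = resolvent_traces[OF M, of \<delta> M1, unfolded this(1), OF M1, folded SX_def]
    and Y = resolvent_traces[OF N1, of 1 N, unfolded this(2), OF N, folded SY_def]
  have DX: "DX = \<delta> * SX" "?T M1 \<le> SX" using X \<delta> by (auto simp: DX_def)
  have DY: "DY = SY" "?T N \<le> SY" "DY + DY\<^sup>2 \<le> ?T N1" using Y F trF by (auto simp: DY_def)
  have diag: "(v i \<star> P (v i))\<^sup>2 \<le> (\<Sum>j<m. (v j \<star> P (v i))\<^sup>2)"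
    and diag2: "(v i \<star> P (v i))\<^sup>2 \<le> ?T P" if "i < m" for i P
  proof -
    show 1: "(v i \<star> P (v i))\<^sup>2 \<le> (\<Sum>j<m. (v j \<star> P (v i))\<^sup>2)"
      using member_le_sum[of i "{..<m}" "\<lambda>j. (v j \<star> P (v i))\<^sup>2"] that by simp
    also have "\<dots> \<le> ?T P"
      using member_le_sum[of i "{..<m}" "\<lambda>i. \<Sum>j<m. (v j \<star> P (v i))\<^sup>2"] that by (simp add: sum_nonneg)
    finally show "(v i \<star> P (v i))\<^sup>2 \<le> ?T P" .
  qed
  have T0: "0 \<le> ?T P" for P by (intro sum_nonneg) auto
  \<comment> \<open>\<open>U\<close> and \<open>L\<close> divide by \<open>DX\<close> and
    \<open>DY\<close>. If one of these is not positive, the trace bounds force every vector to be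
    null, so the divisors are positive as soon as some vector matters.\<close>
  have null_X: "v i \<star> y = 0" if "SX \<le> 0" "i < m" for i y
  proof -
    have "?T M1 \<le> 0" using DX(2) that(1) by linarith
    then have "(v i \<star> M1 (v i))\<^sup>2 \<le> 0" using diag2[OF that(2), of M1] by linarith
    then show ?thesis using null_vector[OF M1, of "v i"] by simp
  qed
  have null_Y: "v i \<star> y = 0" if "SY \<le> 0" "i < m" for i y
  proof -
    have "?T N \<le> 0" using DY(2) that(1) by linarith
    then have "(v i \<star> N (v i))\<^sup>2 \<le> 0" using diag2[OF that(2), of N] by linarith
    then show ?thesis using null_vector[OF N, of "v i"] by simp
  qed
  show ?sel if i: "i < m" and U0: "0 < U i" and UL: "U i \<le> L i"
  proof -
    let ?x = "v i \<star> M1 (v i)" and ?y = "v i \<star> N1 (v i)"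
    let ?x2 = "\<Sum>j<m. (v j \<star> M1 (v i))\<^sup>2" and ?y2 = "\<Sum>j<m. (v j \<star> N1 (v i))\<^sup>2"
    have "\<not> (\<forall>y. v i \<star> y = 0)"
    proof
      assume n: "\<forall>y. v i \<star> y = 0"
      then have "M1 (v i) \<star> y = 0" for y using symopD(4)[OF inverse_pairD(4)[OF M1]] by simp
      then have "v j \<star> M1 (v i) = 0" for j by (metis ip_commute)
      then show False using U0 n by (simp add: U_def)
    qed
    then have pos: "0 < SX" "0 < SY" using null_X null_Y i by (meson not_le)+
    then have D0: "0 < DX" "0 < DY" using DX DY \<delta> by auto
    have x20: "0 < ?x2"
    proof (rule ccontr)
      assume "\<not> 0 < ?x2"
      then have 1: "?x2 = 0" using sum_nonneg[of "{..<m}" "\<lambda>j. (v j \<star> M1 (v i))\<^sup>2"] by simp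
      then have "?x = 0" using diag[OF i, of M1] by simp
      with 1 U0 show False by (simp add: U_def)
    qed
    have Ux: "U i - ?x = ?x2 / DX" by (simp add: U_def)
    then have Ux0: "0 < U i - ?x" using x20 D0 by simp
    have Uy: "U i + ?y \<le> ?y2 / DY" using UL by (simp add: L_def)
    have Uy0: "0 < U i + ?y" using U0 nnN[of "v i"] by linarith
    have "0 < 1 + (- (1 / U i)) * ?x" using Ux0 U0 by (simp add: field_simps)
    note A = barrier_inverse_step[OF M1 i this]
    have "- (- (1 / U i) / (1 + - (1 / U i) * ?x)) = 1 / (U i - ?x)"
      using Ux0 U0 by (simp add: field_simps)
    moreover have "(\<lambda>j. u + \<delta> - g j)(i := u + \<delta> - g i + - (1 / U i)) = (\<lambda>j. u + \<delta> - (g(i := g i + 1 / U i)) j)"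
      by (auto simp: fun_eq_iff)
    ultimately have A: "inverse_pair (barrier m v Q \<beta> (\<lambda>j. u + \<delta> - (g(i := g i + 1 / U i)) j))
      (rank1 M1 (1 / (U i - ?x)) (M1 (v i)))" using A by simp
    have "0 < 1 + (1 / U i) * ?y" using Uy0 U0 by (simp add: field_simps)
    note B = barrier_inverse_step[OF N1 i this]
    have "- ((1 / U i) / (1 + (1 / U i) * ?y)) = - (1 / (U i + ?y))"
      using Uy0 U0 by (simp add: field_simps)
    moreover have "(\<lambda>j. g j - (l + 1))(i := g i - (l + 1) + 1 / U i) = (\<lambda>j. (g(i := g i + 1 / U i)) j - (l + 1))"
      by (auto simp: fun_eq_iff)
    ultimately have B: "inverse_pair (barrier m v Q \<gamma> (\<lambda>j. (g(i := g i + 1 / U i)) j - (l + 1)))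
      (rank1 N1 (- (1 / (U i + ?y))) (N1 (v i)))" using B by simp
    \<comment> \<open>With weight \<open>1 / U i\<close> the upper potential rises by exactly the
      amount \<open>DX\<close> that the shift gained. The condition \<open>U i \<le> L i\<close>
      says that the same weight lowers the lower potential by at least \<open>DY\<close>.\<close>
    have "1 / (U i - ?x) * ?x2 = DX" using Ux x20 D0 by simp
    then have C: "?tr (rank1 M1 (1 / (U i - ?x)) (M1 (v i))) \<le> E"
      using E unfolding trace_rank1 by (simp add: DX_def)
    have "DY \<le> ?y2 / (U i + ?y)" using Uy Uy0 D0 by (simp add: field_simps)
    then have D: "?tr (rank1 N1 (- (1 / (U i + ?y))) (N1 (v i))) \<le> F"
      using trF unfolding trace_rank1 by (simp add: DY_def)
    show ?thesis unfolding bss_inv_def using A B C D g0 U0 by auto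
  qed
  show "bss_inv m v Q \<beta> \<gamma> E F (u + \<delta>) (l + 1) M1 N1 g"
    if no: "\<And>i. i < m \<Longrightarrow> 0 < U i \<Longrightarrow> \<not> U i \<le> L i"
  proof -
    have null: "v i \<star> y = 0" if "i < m" for i y
    proof (rule ccontr)
      assume nz: "v i \<star> y \<noteq> 0"
      with null_X null_Y that have pos: "0 < SX" "0 < SY" by (meson not_le)+
      then have D0: "0 < DX" "0 < DY" using DX DY \<delta> by auto
      have "(\<Sum>i<m. U i) = ?T M1 / DX + ?tr M1"
        by (simp add: U_def sum.distrib sum_divide_distrib)
      also have "\<dots> = ?T M1 / DX + ?tr M - DX" by (simp add: DX_def)
      also have "?T M1 / DX \<le> 1 / \<delta>" using DX D0 \<delta> pos by (simp add: field_simps)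
      finally have sU: "(\<Sum>i<m. U i) \<le> 1 / \<delta> + E" using E D0 by simp
      have "(\<Sum>i<m. L i) = ?T N1 / DY - ?tr N1"
        by (simp add: L_def sum_subtractf sum_divide_distrib)
      also have "?tr N1 = ?tr N + DY" by (simp add: DY_def)
      finally have "(\<Sum>i<m. L i) = ?T N1 / DY - ?tr N - DY" by simp
      \<comment> \<open>The surplus \<open>DY\<close>, due to the quadratic term in
        \<open>resolvent_traces\<close>, cancels the rise of the lower trace.\<close>
      moreover have "1 + DY \<le> ?T N1 / DY" using DY D0 by (simp add: field_simps power2_eq_square)
      ultimately have sL: "1 - F \<le> (\<Sum>i<m. L i)" using trF by linarith
      have U_ge: "v j \<star> M1 (v j) \<le> U j" if "j < m" for j
        using D0 by (simp add: U_def sum_nonneg)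
      \<comment> \<open>A candidate excluded by \<open>U j \<le> 0\<close> is null, which makes
        \<open>L j = 0\<close>, so it cannot disturb the comparison of the sums. Strictness comes
        from one vector that is not null.\<close>
      have le: "L j \<le> U j \<and> (0 < U j \<longrightarrow> L j < U j)" if "j < m" for j
      proof (cases "0 < U j")
        case False
        then have "v j \<star> M1 (v j) = 0" using U_ge[OF that] nnM[of "v j"] by linarith
        then have nj: "v j \<star> y = 0" for y using null_vector[OF M1] by blast
        then have "N1 (v j) \<star> y = 0" for y using symopD(4)[OF inverse_pairD(4)[OF N1]] by simp
        then have "v k \<star> N1 (v j) = 0" for k by (metis ip_commute)
        then have "L j = 0" by (simp add: L_def)
        moreover have "0 \<le> U j" using U_ge[OF that] nnM[of "v j"] by linarith
        ultimately show ?thesis using False by simp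
      next
        case True
        then show ?thesis using no[OF that True] by simp
      qed
      have "v i \<star> M1 (v i) \<noteq> 0" using null_vector[OF M1] nz by blast
      then have "0 < U i" using U_ge[OF that] nnM[of "v i"] by linarith
      then have "(\<Sum>i<m. L i) < (\<Sum>i<m. U i)" using le that by (intro sum_strict_mono_ex1) auto
      with sU sL EF show False by linarith
    qed
    \<comment> \<open>All vectors are null, so both potentials are 0 and the shifted barriers can be
      kept with unchanged weights.\<close>
    then show ?thesis unfolding bss_inv_def using M1 N1 g0 EF F0 by simp
  qed
qed

lemma bss_inv_final:
  assumes inv: "bss_inv m v Q \<beta> \<gamma> E F u l M N g" and Q: "projector_off m v Q"
  shows "(\<Sum>j<m. g j * (v j \<star> x)\<^sup>2) \<le> u * (\<Sum>j<m. (v j \<star> x)\<^sup>2)"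
    and "l * (\<Sum>j<m. (v j \<star> x)\<^sup>2) \<le> (\<Sum>j<m. g j * (v j \<star> x)\<^sup>2)"
proof -
  have M: "inverse_pair (barrier m v Q \<beta> (\<lambda>j. u - g j)) M"
    and N: "inverse_pair (barrier m v Q \<gamma> (\<lambda>j. g j - l)) N" using inv by (auto simp: bss_inv_def)
  show "(\<Sum>j<m. g j * (v j \<star> x)\<^sup>2) \<le> u * (\<Sum>j<m. (v j \<star> x)\<^sup>2)"
    using barrier_psd_imp[OF inverse_pairD(1)[OF M] Q, of x] 
    by (simp add: left_diff_distrib sum_subtractf sum_distrib_left)
  show "l * (\<Sum>j<m. (v j \<star> x)\<^sup>2) \<le> (\<Sum>j<m. g j * (v j \<star> x)\<^sup>2)"
    using barrier_psd_imp[OF inverse_pairD(1)[OF N] Q, of x] 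
    by (simp add: left_diff_distrib sum_subtractf sum_distrib_left)
qed

lemma bss_inv_init:
  assumes H: "inverse_pair (barrier m v Q 1 (\<lambda>_. 1)) H" and tr: "(\<Sum>i<m. v i \<star> H (v i)) \<le> d"
    and u: "0 < u" and l: "0 < l"
  shows "bss_inv m v Q u l (d / u) (d / l) u (- l) (\<lambda>x. (1 / u) *\<^sub>R H x) (\<lambda>x. (1 / l) *\<^sub>R H x) (\<lambda>_. 0)"
proof -
  have "(\<Sum>j<m. v j \<star> (1 / c) *\<^sub>R H (v j)) \<le> d / c" if "0 < c" for c
    using tr that by (simp add: ip_simps sum_divide_distrib[symmetric] divide_right_mono)
  then show ?thesis using inverse_pair_scale[OF H u] inverse_pair_scale[OF H l] u l
    by (simp add: bss_inv_def)
qed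

end

section \<open>Running time of programs\<close>

text \<open>A total-correctness triple with a time bound. As runs are deterministic, exhibiting one
  halting run describes the only one.\<close>

definition exec :: "com \<Rightarrow> mem \<Rightarrow> nat \<Rightarrow> (mem \<Rightarrow> bool) \<Rightarrow> bool" where
  "exec c \<sigma> T P \<longleftrightarrow> (\<exists>t \<tau>. run c \<sigma> t \<tau> \<and> t \<le> T \<and> P \<tau>)"

lemma execI: "run c \<sigma> t \<tau> \<Longrightarrow> t \<le> T \<Longrightarrow> P \<tau> \<Longrightarrow> exec c \<sigma> T P"
  unfolding exec_def by blast

lemma exec_mono: "exec c \<sigma> T P \<Longrightarrow> T \<le> U \<Longrightarrow> (\<And>\<tau>. P \<tau> \<Longrightarrow> Q \<tau>) \<Longrightarrow> exec c \<sigma> U Q"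
  unfolding exec_def by (meson order_trans)

lemma exec_Seq:
  "exec c \<sigma> T P \<Longrightarrow> (\<And>\<rho>. P \<rho> \<Longrightarrow> exec d \<rho> U Q) \<Longrightarrow> exec (Seq c d) \<sigma> (T + U) Q"
  unfolding exec_def by (meson run.Seq add_mono)

lemma exec_Skip: "P \<sigma> \<Longrightarrow> exec Skip \<sigma> 1 P"
  by (rule execI[OF run.Skip]) auto

lemma exec_NStore:
  "P (\<sigma>\<lparr>nats := (nats \<sigma>)(a := (nats \<sigma> a)(nval i \<sigma> := nval e \<sigma>))\<rparr>) \<Longrightarrow> exec (NStore a i e) \<sigma> (1 + ncost i + ncost e) P"
  by (rule execI[OF run.NStore]) auto

lemma exec_RStore:
  "P (\<sigma>\<lparr>reals := (reals \<sigma>)(a := (reals \<sigma> a)(nval i \<sigma> := rval e \<sigma>))\<rparr>) \<Longrightarrow> exec (RStore a i e) \<sigma> (1 + ncost i + rcost e) P"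
  by (rule execI[OF run.RStore]) auto

lemma exec_Cond:
  "(bval b \<sigma> \<Longrightarrow> exec c \<sigma> T P) \<Longrightarrow> (\<not> bval b \<sigma> \<Longrightarrow> exec d \<sigma> T P) \<Longrightarrow> exec (Cond b c d) \<sigma> (1 + bcost b + T) P"
  unfolding exec_def by (cases "bval b \<sigma>") (fastforce intro: run.CondTrue run.CondFalse)+

abbreviation nvar :: "nat \<Rightarrow> nexp" where "nvar a \<equiv> NLoad a (NLit 0)"
abbreviation rvar :: "nat \<Rightarrow> rexp" where "rvar a \<equiv> RLoad a (NLit 0)"

text \<open>The counter is cell 0 of natural array \<open>a\<close>, the bound cell \<open>b\<close> of natural array 0.\<close>

definition For :: "nat \<Rightarrow> nat \<Rightarrow> com \<Rightarrow> com" where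
  "For a b c = Seq (NStore a (NLit 0) (NLit 0))
     (While (NLess (nvar a) (NLoad 0 (NLit b))) (Seq c (NStore a (NLit 0) (NAdd (nvar a) (NLit 1)))))"

definition set_nvar :: "nat \<Rightarrow> nat \<Rightarrow> mem \<Rightarrow> mem" where
  "set_nvar a x \<sigma> = \<sigma>\<lparr>nats := (nats \<sigma>)(a := (nats \<sigma> a)(0 := x))\<rparr>"

lemma set_nvar_simps [simp]:
  "reals (set_nvar a x \<sigma>) = reals \<sigma>"
  "nats (set_nvar a x \<sigma>) b = (if b = a then (nats \<sigma> a)(0 := x) else nats \<sigma> b)"
  by (auto simp: set_nvar_def)

text \<open>A turn costs 6 for the test and 6 for the increment besides the body; the 9 are 3 for
  resetting the counter and 6 for the failing test. \<open>T\<close> depends on the index so that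
  turns which skip their vector can be charged less.\<close>

lemma exec_For:
  assumes start: "I 0 (set_nvar a 0 \<sigma>)"
    and step: "\<And>k \<tau>. k < N \<Longrightarrow> I k \<tau> \<Longrightarrow> nats \<tau> a 0 = k \<Longrightarrow>
      exec c \<tau> (T k) (\<lambda>\<rho>. nats \<rho> a 0 = k \<and> I (Suc k) (set_nvar a (Suc k) \<rho>))"
    and bound: "\<And>k \<tau>. I k \<tau> \<Longrightarrow> nats \<tau> 0 b = N"
    and post: "\<And>\<tau>. I N \<tau> \<Longrightarrow> P \<tau>"
  shows "exec (For a b c) \<sigma> ((\<Sum>k<N. T k + 12) + 9) P"
proof -
  let ?w = "While (NLess (nvar a) (NLoad 0 (NLit b))) (Seq c (NStore a (NLit 0) (NAdd (nvar a) (NLit 1))))"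
  have loop: "exec ?w \<tau> ((\<Sum>k\<in>{j..<N}. T k + 12) + 6) P"
    if "j \<le> N" "I j \<tau>" "nats \<tau> a 0 = j" for j \<tau>
    using that
  proof (induction j arbitrary: \<tau> rule: inc_induct)
    case base
    have "run ?w \<tau> 6 \<tau>" using run.WhileFalse[of "NLess (nvar a) (NLoad 0 (NLit b))" \<tau> "Seq c (NStore a (NLit 0) (NAdd (nvar a) (NLit 1)))"]
        base bound by (simp add: eval_nat_numeral)
    then show ?case using base post by (intro execI) auto
  next
    case (step j)
    obtain t \<rho> where 1: "run c \<tau> t \<rho>" "t \<le> T j" "nats \<rho> a 0 = j" "I (Suc j) (set_nvar a (Suc j) \<rho>)"
      using assms(2)[OF step.hyps(2) step.prems] unfolding exec_def by blast
    have "run (NStore a (NLit 0) (NAdd (nvar a) (NLit 1))) \<rho> 6 (set_nvar a (Suc j) \<rho>)"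
      using run.NStore[of a "NLit 0" "NAdd (nvar a) (NLit 1)" \<rho>] 1(3)
      by (simp add: set_nvar_def eval_nat_numeral)
    note 2 = run.Seq[OF 1(1) this]
    obtain u \<rho>' where 3: "run ?w (set_nvar a (Suc j) \<rho>) u \<rho>'" "u \<le> (\<Sum>k\<in>{Suc j..<N}. T k + 12) + 6" "P \<rho>'"
      using step.IH[OF 1(4)] unfolding exec_def by auto
    have "bval (NLess (nvar a) (NLoad 0 (NLit b))) \<tau>" using step.hyps step.prems bound by simp
    note 4 = run.WhileTrue[OF this 2 3(1)]
    show ?case
      by (rule execI[OF 4]) (use 1 3 step.hyps in \<open>simp_all add: sum.atLeast_Suc_lessThan\<close>)
  qed
  have "run (NStore a (NLit 0) (NLit 0)) \<sigma> 3 (set_nvar a 0 \<sigma>)"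
    using run.NStore[of a "NLit 0" "NLit 0" \<sigma>] by (simp add: set_nvar_def eval_nat_numeral)
  moreover obtain t \<tau> where "run ?w (set_nvar a 0 \<sigma>) t \<tau>" "t \<le> (\<Sum>k\<in>{0..<N}. T k + 12) + 6" "P \<tau>"
    using loop[OF _ start] unfolding exec_def by auto
  ultimately show ?thesis unfolding For_def
    by (intro execI[OF run.Seq]) (auto simp: atLeast0LessThan)
qed

text \<open>With at least one turn, the fixed cost 9 is absorbed into the per-turn overhead
  12.\<close>

lemma exec_For_const:
  assumes start: "I 0 (set_nvar a 0 \<sigma>)"
    and step: "\<And>k \<tau>. k < N \<Longrightarrow> I k \<tau> \<Longrightarrow> nats \<tau> a 0 = k \<Longrightarrow>
      exec c \<tau> T (\<lambda>\<rho>. nats \<rho> a 0 = k \<and> I (Suc k) (set_nvar a (Suc k) \<rho>))"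
    and bound: "\<And>k \<tau>. I k \<tau> \<Longrightarrow> nats \<tau> 0 b = N"
    and post: "\<And>\<tau>. I N \<tau> \<Longrightarrow> P \<tau>"
    and N: "1 \<le> N"
  shows "exec (For a b c) \<sigma> (N * (T + 21)) P"
proof -
  have "(\<Sum>k<N. T + 12) + 9 \<le> N * (T + 21)" using N by (simp add: algebra_simps)
  with exec_For[of I a \<sigma> N c "\<lambda>_. T" b P, OF assms(1-4)] show ?thesis by (rule exec_mono) auto
qed

section \<open>Frame conditions, memory layout and loops over vectors and matrices\<close>

definition same :: "nat set \<Rightarrow> nat set \<Rightarrow> mem \<Rightarrow> mem \<Rightarrow> bool" where
  "same R S \<sigma> \<tau> \<longleftrightarrow> (\<forall>a. a \<notin> R \<longrightarrow> reals \<tau> a = reals \<sigma> a) \<and> (\<forall>a. a \<notin> S \<longrightarrow> nats \<tau> a = nats \<sigma> a)"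

lemma sameD:
  "same R S \<sigma> \<tau> \<Longrightarrow> a \<notin> R \<Longrightarrow> reals \<tau> a = reals \<sigma> a"
  "same R S \<sigma> \<tau> \<Longrightarrow> a \<notin> S \<Longrightarrow> nats \<tau> a = nats \<sigma> a"
  by (auto simp: same_def)

lemma same_refl [simp]: "same R S \<sigma> \<sigma>" by (simp add: same_def)

lemma same_trans: "same R S \<sigma> \<rho> \<Longrightarrow> same R' S' \<rho> \<tau> \<Longrightarrow> same (R \<union> R') (S \<union> S') \<sigma> \<tau>"
  by (auto simp: same_def)

lemma same_mono: "same R S \<sigma> \<tau> \<Longrightarrow> R \<subseteq> R' \<Longrightarrow> S \<subseteq> S' \<Longrightarrow> same R' S' \<sigma> \<tau>"
  by (auto simp: same_def)

abbreviation row_index :: "nat \<Rightarrow> nat \<Rightarrow> nexp" where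
  "row_index i k \<equiv> NAdd (NLoad 1 (nvar i)) (nvar k)"

text \<open>Multiplication is not available on natural numbers: row offsets come from a table
  in natural array 1.\<close>

definition layout :: "nat \<Rightarrow> nat \<Rightarrow> mem \<Rightarrow> bool" where
  "layout n m \<sigma> \<longleftrightarrow> 1 \<le> n \<and> n \<le> m \<and> nats \<sigma> 0 0 = n \<and> nats \<sigma> 0 1 = m \<and> (\<forall>j\<le>m. nats \<sigma> 1 j = j * n)"

lemma layout_same: "layout n m \<sigma> \<Longrightarrow> same R S \<sigma> \<tau> \<Longrightarrow> 0 \<notin> S \<Longrightarrow> 1 \<notin> S \<Longrightarrow> layout n m \<tau>"
  by (auto simp: layout_def same_def)

definition Sum :: "nat \<Rightarrow> rexp \<Rightarrow> com" where
  "Sum acc e = Seq (RStore acc (NLit 0) (RNat (NLit 0)))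
     (For 11 0 (RStore acc (NLit 0) (RAdd (rvar acc) e)))"

text \<open>The summand is evaluated while the loop runs, so its value is prescribed in every memory
  that differs from the initial one only in the accumulator and the counter. The other loops follow
  this pattern.\<close>

lemma exec_Sum:
  assumes n: "1 \<le> n" "nats \<sigma> 0 0 = n"
    and e: "\<And>k \<tau>. k < n \<Longrightarrow> same {acc} {11} \<sigma> \<tau> \<Longrightarrow> nats \<tau> 11 0 = k \<Longrightarrow> rval e \<tau> = f k"
  shows "exec (Sum acc e) \<sigma> ((rcost e + 30) * n) (\<lambda>\<tau>. same {acc} {11} \<sigma> \<tau> \<and> reals \<tau> acc 0 = (\<Sum>k<n. f k))"
proof -
  let ?I = "\<lambda>k \<tau>. same {acc} {11} \<sigma> \<tau> \<and> reals \<tau> acc 0 = (\<Sum>i<k. f i)"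
  have "exec (Sum acc e) \<sigma> (1 + ncost (NLit 0) + rcost (RNat (NLit 0)) + n * ((1 + ncost (NLit 0) + rcost (RAdd (rvar acc) e)) + 21)) (?I n)"
    unfolding Sum_def
  proof (rule exec_Seq[OF exec_RStore[where P = "\<lambda>\<tau>. same {acc} {11} \<sigma> \<tau> \<and> reals \<tau> acc 0 = 0"]])
    fix \<rho> assume \<rho>: "same {acc} {11} \<sigma> \<rho> \<and> reals \<rho> acc 0 = 0"
    show "exec (For 11 0 (RStore acc (NLit 0) (RAdd (rvar acc) e))) \<rho>
      (n * ((1 + ncost (NLit 0) + rcost (RAdd (rvar acc) e)) + 21)) (?I n)"
    proof (rule exec_For_const[where I = ?I])
      fix k \<tau> assume k: "k < n" "?I k \<tau>" "nats \<tau> 11 0 = k"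
      then have "rval e \<tau> = f k" using e by blast
      then show "exec (RStore acc (NLit 0) (RAdd (rvar acc) e)) \<tau>
        (1 + ncost (NLit 0) + rcost (RAdd (rvar acc) e))
        (\<lambda>\<rho>. nats \<rho> 11 0 = k \<and> ?I (Suc k) (set_nvar 11 (Suc k) \<rho>))"
        using k by (intro exec_RStore) (auto simp: same_def)
    qed (use \<rho> n in \<open>auto simp: same_def\<close>)
  qed (auto simp: same_def)
  then show ?thesis
    by (rule exec_mono) (use n in \<open>auto simp: algebra_simps\<close>)
qed

definition Sum2 :: "nat \<Rightarrow> rexp \<Rightarrow> com" where
  "Sum2 acc e = Seq (RStore acc (NLit 0) (RNat (NLit 0)))
     (For 10 0 (For 11 0 (RStore acc (NLit 0) (RAdd (rvar acc) e))))"

lemma exec_Sum2: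
  assumes n: "1 \<le> n" "nats \<sigma> 0 0 = n"
    and e: "\<And>j k \<tau>. j < n \<Longrightarrow> k < n \<Longrightarrow> same {acc} {10, 11} \<sigma> \<tau> \<Longrightarrow> nats \<tau> 10 0 = j \<Longrightarrow> nats \<tau> 11 0 = k \<Longrightarrow> rval e \<tau> = f j k"
  shows "exec (Sum2 acc e) \<sigma> ((rcost e + 60) * n\<^sup>2)
    (\<lambda>\<tau>. same {acc} {10, 11} \<sigma> \<tau> \<and> reals \<tau> acc 0 = (\<Sum>j<n. \<Sum>k<n. f j k))"
proof -
  let ?I = "\<lambda>j \<tau>. same {acc} {10, 11} \<sigma> \<tau> \<and> reals \<tau> acc 0 = (\<Sum>i<j. \<Sum>k<n. f i k)"
  let ?J = "\<lambda>j k \<tau>. same {acc} {10, 11} \<sigma> \<tau> \<and> nats \<tau> 10 0 = j \<and>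
      reals \<tau> acc 0 = (\<Sum>i<j. \<Sum>k<n. f i k) + (\<Sum>l<k. f j l)"
  let ?c = "1 + ncost (NLit 0) + rcost (RAdd (rvar acc) e)"
  have "exec (Sum2 acc e) \<sigma> (1 + ncost (NLit 0) + rcost (RNat (NLit 0)) + n * (n * (?c + 21) + 21)) (?I n)"
    unfolding Sum2_def
  proof (rule exec_Seq[OF exec_RStore[where P = "\<lambda>\<tau>. same {acc} {10, 11} \<sigma> \<tau> \<and> reals \<tau> acc 0 = 0"]])
    fix \<rho> assume \<rho>: "same {acc} {10, 11} \<sigma> \<rho> \<and> reals \<rho> acc 0 = 0"
    show "exec (For 10 0 (For 11 0 (RStore acc (NLit 0) (RAdd (rvar acc) e)))) \<rho> (n * (n * (?c + 21) + 21)) (?I n)"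
    proof (rule exec_For_const[where I = ?I])
      fix j \<tau> assume j: "j < n" "?I j \<tau>" "nats \<tau> 10 0 = j"
      show "exec (For 11 0 (RStore acc (NLit 0) (RAdd (rvar acc) e))) \<tau> (n * (?c + 21))
        (\<lambda>\<rho>. nats \<rho> 10 0 = j \<and> ?I (Suc j) (set_nvar 10 (Suc j) \<rho>))"
      proof (rule exec_For_const[where I = "?J j"])
        fix k \<tau> assume k: "k < n" "?J j k \<tau>" "nats \<tau> 11 0 = k"
        then have "rval e \<tau> = f j k" using e j by blast
        then show "exec (RStore acc (NLit 0) (RAdd (rvar acc) e)) \<tau> ?c
          (\<lambda>\<rho>. nats \<rho> 11 0 = k \<and> ?J j (Suc k) (set_nvar 11 (Suc k) \<rho>))"
          using k by (intro exec_RStore) (auto simp: same_def)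
      qed (use j n in \<open>auto simp: same_def\<close>)
    qed (use \<rho> n in \<open>auto simp: same_def\<close>)
  qed (auto simp: same_def)
  moreover have "1 + ncost (NLit 0) + rcost (RNat (NLit 0)) + n * (n * (?c + 21) + 21) \<le> (rcost e + 60) * n\<^sup>2"
  proof -
    obtain k where "n = Suc k" using n by (cases n) auto
    then show ?thesis by (simp add: power2_eq_square algebra_simps)
  qed
  ultimately show ?thesis by (rule exec_mono) auto
qed

definition Vec_sum :: "nat \<Rightarrow> nat \<Rightarrow> rexp \<Rightarrow> com" where
  "Vec_sum w acc e = For 10 0 (Seq (Sum acc e) (RStore w (nvar 10) (rvar acc)))"

lemma exec_Vec_sum:
  assumes n: "1 \<le> n" "nats \<sigma> 0 0 = n" and w: "w \<noteq> acc"
    and e: "\<And>j k \<tau>. j < n \<Longrightarrow> k < n \<Longrightarrow> same {w, acc} {10, 11} \<sigma> \<tau> \<Longrightarrow> nats \<tau> 10 0 = j \<Longrightarrow> nats \<tau> 11 0 = k \<Longrightarrow> rval e \<tau> = f j k"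
  shows "exec (Vec_sum w acc e) \<sigma> ((rcost e + 60) * n\<^sup>2)
    (\<lambda>\<tau>. same {w, acc} {10, 11} \<sigma> \<tau> \<and> (\<forall>j<n. reals \<tau> w j = (\<Sum>k<n. f j k)))"
proof -
  let ?I = "\<lambda>j \<tau>. same {w, acc} {10, 11} \<sigma> \<tau> \<and> (\<forall>i<j. reals \<tau> w i = (\<Sum>k<n. f i k))"
  have "exec (Vec_sum w acc e) \<sigma> (n * ((rcost e + 30) * n + 5 + 21)) (?I n)"
    unfolding Vec_sum_def
  proof (rule exec_For_const[where I = ?I])
    fix j \<tau> assume j: "j < n" "?I j \<tau>" "nats \<tau> 10 0 = j"
    have "exec (Sum acc e) \<tau> ((rcost e + 30) * n)
      (\<lambda>\<rho>. same {acc} {11} \<tau> \<rho> \<and> reals \<rho> acc 0 = (\<Sum>k<n. f j k))"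
    proof (rule exec_Sum)
      fix k \<rho> assume k: "k < n" "same {acc} {11} \<tau> \<rho>" "nats \<rho> 11 0 = k"
      have "same {w, acc} {10, 11} \<sigma> \<rho>"
        by (rule same_mono[OF same_trans[OF conjunct1[OF j(2)] k(2)]]) auto
      moreover have "nats \<rho> 10 0 = j" using k j by (simp add: sameD)
      ultimately show "rval e \<rho> = f j k" using e j k by blast
    qed (use n j in \<open>auto simp: same_def\<close>)
    then show "exec (Seq (Sum acc e) (RStore w (nvar 10) (rvar acc))) \<tau> ((rcost e + 30) * n + 5)
      (\<lambda>\<rho>. nats \<rho> 10 0 = j \<and> ?I (Suc j) (set_nvar 10 (Suc j) \<rho>))"
    proof (rule exec_Seq)
      fix \<rho> assume \<rho>: "same {acc} {11} \<tau> \<rho> \<and> reals \<rho> acc 0 = (\<Sum>k<n. f j k)"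
      have "exec (RStore w (nvar 10) (rvar acc)) \<rho> (1 + ncost (nvar 10) + rcost (rvar acc))
        (\<lambda>\<rho>. nats \<rho> 10 0 = j \<and> ?I (Suc j) (set_nvar 10 (Suc j) \<rho>))"
        using \<rho> j w by (intro exec_RStore) (auto simp: same_def less_Suc_eq)
      then show "exec (RStore w (nvar 10) (rvar acc)) \<rho> 5
        (\<lambda>\<rho>. nats \<rho> 10 0 = j \<and> ?I (Suc j) (set_nvar 10 (Suc j) \<rho>))" by (rule exec_mono) auto
    qed
  qed (use n in \<open>auto simp: same_def\<close>)
  moreover have "n * ((rcost e + 30) * n + 5 + 21) \<le> (rcost e + 60) * n\<^sup>2"
  proof -
    obtain k where "n = Suc k" using n by (cases n) auto
    then show ?thesis by (simp add: power2_eq_square algebra_simps)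
  qed
  ultimately show ?thesis by (rule exec_mono) auto
qed

lemma index_eq_iff:
  fixes n :: nat
  assumes "k < n" "k' < n"
  shows "j * n + k = j' * n + k' \<longleftrightarrow> j = j' \<and> k = k'"
  using assms by (metis div_mult_self3 div_less add_cancel_right_right add_left_cancel less_nat_zero_code mult.commute)

definition Mat_set :: "nat \<Rightarrow> nat \<Rightarrow> rexp \<Rightarrow> com" where
  "Mat_set b a e = For 10 b (For 11 0 (RStore a (row_index 10 11) e))"

text \<open>In-place updates are covered: \<open>e\<close> may read the cell about to be written,
  which still holds its old value. The invariant \<open>?G\<close> records the progress
  lexicographically in row and column, and \<open>index_eq_iff\<close> separates the cells.\<close>

lemma exec_Mat_set:
  assumes l: "layout n m \<sigma>" and N: "nats \<sigma> 0 b = N" "1 \<le> N" "N \<le> m"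
    and e: "\<And>j k \<tau>. j < N \<Longrightarrow> k < n \<Longrightarrow> same {a} {10, 11} \<sigma> \<tau> \<Longrightarrow> nats \<tau> 10 0 = j \<Longrightarrow> nats \<tau> 11 0 = k \<Longrightarrow>
      reals \<tau> a (j * n + k) = reals \<sigma> a (j * n + k) \<Longrightarrow> rval e \<tau> = f j k"
  shows "exec (Mat_set b a e) \<sigma> ((rcost e + 60) * (N * n))
    (\<lambda>\<tau>. same {a} {10, 11} \<sigma> \<tau> \<and> (\<forall>j<N. \<forall>k<n. reals \<tau> a (j * n + k) = f j k))"
proof -
  have n: "1 \<le> n" "nats \<sigma> 0 0 = n" using l by (auto simp: layout_def)
  let ?G = "\<lambda>j k \<tau>. same {a} {10, 11} \<sigma> \<tau> \<and>
    (\<forall>j'<N. \<forall>k'<n. reals \<tau> a (j' * n + k') = (if j' < j \<or> j' = j \<and> k' < k then f j' k' else reals \<sigma> a (j' * n + k')))"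
  let ?J = "\<lambda>j k \<tau>. ?G j k \<tau> \<and> nats \<tau> 10 0 = j"
  let ?c = "1 + ncost (row_index 10 11) + rcost e"
  have "exec (Mat_set b a e) \<sigma> (N * (n * (?c + 21) + 21)) (?G N 0)"
    unfolding Mat_set_def
  proof (rule exec_For_const[where I = "\<lambda>j. ?G j 0"])
    fix j \<tau> assume j: "j < N" "?G j 0 \<tau>" "nats \<tau> 10 0 = j"
    show "exec (For 11 0 (RStore a (row_index 10 11) e)) \<tau> (n * (?c + 21))
      (\<lambda>\<rho>. nats \<rho> 10 0 = j \<and> ?G (Suc j) 0 (set_nvar 10 (Suc j) \<rho>))"
    proof (rule exec_For_const[where I = "?J j"])
      fix k \<tau> assume k: "k < n" "?J j k \<tau>" "nats \<tau> 11 0 = k"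
      have "rval e \<tau> = f j k" using k j by (intro e) auto
      moreover have "nval (row_index 10 11) \<tau> = j * n + k"
        using k j l N by (auto simp: layout_def same_def)
      ultimately show "exec (RStore a (row_index 10 11) e) \<tau> ?c
          (\<lambda>\<rho>. nats \<rho> 11 0 = k \<and> ?J j (Suc k) (set_nvar 11 (Suc k) \<rho>))"
        using k j by (intro exec_RStore) (auto simp: same_def index_eq_iff less_Suc_eq)
    next
      show "?J j 0 (set_nvar 11 0 \<tau>)" using j by (auto simp: same_def)
      show "nats \<rho> 0 0 = n" if "?J j k \<rho>" for k \<rho> using that n by (auto simp: same_def)
      show "nats \<rho> 10 0 = j \<and> ?G (Suc j) 0 (set_nvar 10 (Suc j) \<rho>)" if "?J j n \<rho>" for \<rho>
        using that by (auto simp: same_def less_Suc_eq)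
    qed (use n in auto)
  qed (use N in \<open>auto simp: same_def\<close>)
  moreover have "N * (n * (?c + 21) + 21) \<le> (rcost e + 60) * (N * n)"
  proof -
    obtain k where "n = Suc k" using n by (cases n) auto
    then show ?thesis by (simp add: algebra_simps)
  qed
  ultimately show ?thesis by (rule exec_mono) auto
qed

section \<open>Row-major matrices as operators\<close>

instantiation "fun" :: (type, real_vector) real_vector
begin

definition scaleR_fun :: "real \<Rightarrow> ('a \<Rightarrow> 'b) \<Rightarrow> 'a \<Rightarrow> 'b" where
  "scaleR_fun r f = (\<lambda>x. r *\<^sub>R f x)"

instance
  by standard (auto simp: fun_eq_iff scaleR_fun_def algebra_simps)

end

definition dot :: "nat \<Rightarrow> (nat \<Rightarrow> real) \<Rightarrow> (nat \<Rightarrow> real) \<Rightarrow> real" where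
  "dot n x y = (\<Sum>k<n. x k * y k)"

definition std_basis :: "nat \<Rightarrow> nat \<Rightarrow> real" where
  "std_basis k = (\<lambda>j. if j = k then 1 else 0)"

lemma dot_std_basis: "dot n x (std_basis k) = (if k < n then x k else 0)"
  and dot_std_basis': "dot n (std_basis k) x = (if k < n then x k else 0)"
  by (auto simp: dot_def std_basis_def if_distrib[of "\<lambda>a. a * _"] if_distrib[of "\<lambda>a. _ * a"] cong: if_cong)

interpretation dot: psd_form_basis "dot n" n std_basis for n
proof
  fix x y z :: "nat \<Rightarrow> real" and r :: real
  show "dot n x y = dot n y x" by (simp add: dot_def mult.commute)
  show "dot n (x + y) z = dot n x z + dot n y z" by (simp add: dot_def algebra_simps sum.distrib)
  show "dot n (r *\<^sub>R x) y = r * dot n x y" by (simp add: dot_def scaleR_fun_def sum_distrib_left mult.assoc)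
  show "0 \<le> dot n x x" by (simp add: dot_def sum_nonneg)
  show "dot n (std_basis i) (std_basis i) = 1" if "i < n" for i
    using that by (simp only: dot_std_basis) (simp add: std_basis_def)
  show "dot n x y = (\<Sum>i<n. dot n x (std_basis i) * dot n (std_basis i) y)"
    unfolding dot_std_basis dot_std_basis' by (simp add: dot_def)
qed

definition supported :: "nat \<Rightarrow> (nat \<Rightarrow> real) \<Rightarrow> bool" where
  "supported n x \<longleftrightarrow> (\<forall>k\<ge>n. x k = 0)"

text \<open>Row-major array \<open>a\<close> holds the \<open>n \<times> n\<close> matrix of the operator \<open>f\<close>, which preserves
  the space of vectors supported on the first \<open>n\<close> coordinates.\<close>

definition represents :: "nat \<Rightarrow> (nat \<Rightarrow> real) \<Rightarrow> ((nat \<Rightarrow> real) \<Rightarrow> nat \<Rightarrow> real) \<Rightarrow> bool" where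
  "represents n a f \<longleftrightarrow> linear f \<and> (\<forall>x. supported n x \<longrightarrow> supported n (f x)) \<and>
     (\<forall>j<n. \<forall>k<n. a (j * n + k) = f (std_basis k) j)"

definition gram :: "nat \<Rightarrow> (nat \<Rightarrow> real) \<Rightarrow> nat set \<Rightarrow> (nat \<Rightarrow> nat \<Rightarrow> real) \<Rightarrow> bool" where
  "gram n a S v \<longleftrightarrow> (\<forall>j<n. \<forall>k<n. a (j * n + k) = (\<Sum>i\<in>S. v i j * v i k))"

lemma sum_fun_apply: "sum f S x = (\<Sum>i\<in>S. f i x)"
  by (induction S rule: infinite_finite_induct) auto

lemma supported_expand:
  assumes "supported n x"
  shows "x = (\<Sum>k<n. x k *\<^sub>R std_basis k)"
  using assms
  by (auto simp: fun_eq_iff sum_fun_apply scaleR_fun_def std_basis_def supported_def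
      if_distrib[of "\<lambda>a. _ * a"] cong: if_cong)

lemma represents_apply:
  assumes "represents n a f" "supported n x" "j < n"
  shows "(\<Sum>k<n. a (j * n + k) * x k) = f x j"
proof -
  have f: "linear f" using assms by (auto simp: represents_def)
  have "f x = f (\<Sum>k<n. x k *\<^sub>R std_basis k)" using supported_expand[OF assms(2)] by simp
  also have "\<dots> = (\<Sum>k<n. x k *\<^sub>R f (std_basis k))" using f by (simp add: linear_sum linear_scale)
  finally show ?thesis using assms by (auto simp: sum_fun_apply scaleR_fun_def represents_def intro!: sum.cong)
qed

lemma represents_rank1:
  assumes "represents n a f" "supported n w"
    and "\<And>j k. j < n \<Longrightarrow> k < n \<Longrightarrow> b (j * n + k) = a (j * n + k) + c * w j * w k"
  shows "represents n b (dot.rank1 n f c w)"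
proof -
  have "linear f" using assms by (auto simp: represents_def)
  then have "linear (dot.rank1 n f c w)"
    unfolding dot.rank1_def
    by (auto intro!: linearI simp: linear_add linear_scale dot.ip_simps algebra_simps scaleR_add_left scaleR_add_right)
  then show ?thesis using assms
    by (auto simp: represents_def dot.rank1_def supported_def scaleR_fun_def dot_std_basis)
qed

lemma represents_id:
  assumes "\<And>j k. j < n \<Longrightarrow> k < n \<Longrightarrow> b (j * n + k) = (if j = k then 1 else 0)"
  shows "represents n b (\<lambda>x. x)"
  using assms by (auto simp: represents_def linear_id[unfolded id_def] std_basis_def)

lemma represents_scale:
  assumes "represents n a f" "\<And>j k. j < n \<Longrightarrow> k < n \<Longrightarrow> b (j * n + k) = c * a (j * n + k)"
  shows "represents n b (\<lambda>x. c *\<^sub>R f x)"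
proof -
  have "linear (\<lambda>x. c *\<^sub>R f x)"
    using assms(1) by (auto simp: represents_def intro!: linearI simp: linear_add linear_scale algebra_simps)
  then show ?thesis using assms by (auto simp: represents_def supported_def scaleR_fun_def)
qed

text \<open>This and \<open>gram_trace\<close> are what keeps a step cheap: sums over up to
  \<open>m\<close> vectors are read off from one \<open>n \<times> n\<close> matrix with about
  \<open>n\<^sup>2\<close> operations.\<close>

lemma gram_quad:
  assumes "gram n a S v"
  shows "(\<Sum>j<n. \<Sum>k<n. w j * a (j * n + k) * w k) = (\<Sum>i\<in>S. (dot n (v i) w)\<^sup>2)"
proof -
  have "(\<Sum>j<n. \<Sum>k<n. w j * a (j * n + k) * w k) = (\<Sum>j<n. \<Sum>k<n. \<Sum>i\<in>S. (v i j * w j) * (v i k * w k))"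
    using assms by (intro sum.cong refl) (simp add: gram_def sum_distrib_left sum_distrib_right algebra_simps)
  also have "\<dots> = (\<Sum>j<n. \<Sum>i\<in>S. \<Sum>k<n. (v i j * w j) * (v i k * w k))"
    by (intro sum.cong refl sum.swap)
  also have "\<dots> = (\<Sum>i\<in>S. \<Sum>j<n. \<Sum>k<n. (v i j * w j) * (v i k * w k))" by (rule sum.swap)
  also have "\<dots> = (\<Sum>i\<in>S. (dot n (v i) w)\<^sup>2)"
    by (simp add: dot_def power2_eq_square sum_product)
  finally show ?thesis .
qed

lemma gram_trace:
  assumes "gram n a S v" "represents n b f" "\<And>i. i \<in> S \<Longrightarrow> supported n (v i)"
  shows "(\<Sum>j<n. \<Sum>k<n. a (j * n + k) * b (j * n + k)) = (\<Sum>i\<in>S. dot n (v i) (f (v i)))"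
proof -
  have "(\<Sum>j<n. \<Sum>k<n. a (j * n + k) * b (j * n + k)) = (\<Sum>j<n. \<Sum>k<n. \<Sum>i\<in>S. v i j * (b (j * n + k) * v i k))"
    using assms(1) by (intro sum.cong refl) (simp add: gram_def sum_distrib_left sum_distrib_right algebra_simps)
  also have "\<dots> = (\<Sum>j<n. \<Sum>i\<in>S. \<Sum>k<n. v i j * (b (j * n + k) * v i k))"
    by (intro sum.cong refl sum.swap)
  also have "\<dots> = (\<Sum>i\<in>S. \<Sum>j<n. \<Sum>k<n. v i j * (b (j * n + k) * v i k))" by (rule sum.swap)
  also have "\<dots> = (\<Sum>i\<in>S. \<Sum>j<n. v i j * f (v i) j)"
    using represents_apply[OF assms(2) assms(3)] by (simp add: sum_distrib_left[symmetric])
  finally show ?thesis by (simp add: dot_def)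
qed

lemma gram_insert:
  assumes "gram n a S v" "finite S" "i \<notin> S" "\<And>j k. j < n \<Longrightarrow> k < n \<Longrightarrow> b (j * n + k) = a (j * n + k) + v i j * v i k"
  shows "gram n b (insert i S) v"
  using assms by (simp add: gram_def)

lemma gram_remove:
  assumes "gram n a (insert i S) v" "finite S" "i \<notin> S" "\<And>j k. j < n \<Longrightarrow> k < n \<Longrightarrow> b (j * n + k) = a (j * n + k) - v i j * v i k"
  shows "gram n b S v"
  using assms by (simp add: gram_def)

section \<open>Linear algebra programs\<close>

text \<open>
  Real arrays: 0 \<open>\<epsilon>\<close>; 1 vectors (rescaled in place after sampling); 2 output weights; 3 and 4 inverses of the upper and the lower
  barrier (during initialisation \<open>(A + Q)\<^sup>-\<^sup>1\<close> and \<open>Q\<close>); 5 the Gram matrix \<open>A\<close>, or its part not yet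
  scanned; 6 and 7 products \<open>w\<close>, \<open>z\<close> of 3 and 4 with the current vector \<open>v\<close>; 8 weights of the sampling
  pass. Scalars: 10 and 11 \<open>v\<cdot>w\<close> and \<open>v\<cdot>z\<close>; 12 and 13 \<open>w\<cdot>Aw\<close> and \<open>z\<cdot>Az\<close>; 14 accumulator; 15 \<open>\<eta>\<close>; 16 the
  scale of the sampling rates; 17 the current weight; 18 the step of the upper barrier; 19 to 22 traces
  before and after the shift of the barriers; 23 and 24 the bounds \<open>U\<close> and \<open>L\<close> on the reciprocal weight.
  Natural arrays: 2 index of the current vector; 3 rounds; 4 whether a vector has been chosen in
  this round; 10 and 11 row and column.
\<close>

abbreviation lit :: "nat \<Rightarrow> rexp" where "lit k \<equiv> RNat (NLit k)"
abbreviation mat_at :: "nat \<Rightarrow> rexp" where "mat_at a \<equiv> RLoad a (row_index 10 11)"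
abbreviation vec_j :: "nat \<Rightarrow> rexp" where "vec_j a \<equiv> RLoad a (nvar 10)"
abbreviation vec_k :: "nat \<Rightarrow> rexp" where "vec_k a \<equiv> RLoad a (nvar 11)"
abbreviation in_j :: rexp where "in_j \<equiv> RLoad 1 (row_index 2 10)"
abbreviation in_k :: rexp where "in_k \<equiv> RLoad 1 (row_index 2 11)"

definition vectors :: "nat \<Rightarrow> nat \<Rightarrow> mem \<Rightarrow> (nat \<Rightarrow> nat \<Rightarrow> real) \<Rightarrow> bool" where
  "vectors n m \<sigma> V \<longleftrightarrow> (\<forall>i<m. supported n (V i) \<and> (\<forall>k<n. reals \<sigma> 1 (i * n + k) = V i k))"

lemma vectors_same: "vectors n m \<sigma> V \<Longrightarrow> same R S \<sigma> \<tau> \<Longrightarrow> 1 \<notin> R \<Longrightarrow> vectors n m \<tau> V"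
  by (auto simp: vectors_def same_def)

lemma supported_represents: "represents n a f \<Longrightarrow> supported n x \<Longrightarrow> supported n (f x)"
  by (simp add: represents_def)

section \<open>Products, quadratic forms and traces in quadratic time\<close>

definition products_prog :: com where
  "products_prog = Seq (Vec_sum 6 14 (RMul (mat_at 3) in_k)) (Seq (Vec_sum 7 14 (RMul (mat_at 4) in_k))
     (Seq (Sum 10 (RMul in_k (vec_k 6))) (Sum 11 (RMul in_k (vec_k 7)))))"

lemma n_le_square: "1 \<le> n \<Longrightarrow> n \<le> (n::nat)\<^sup>2"
  by (simp add: power2_eq_square)

lemma exec_mat_vec:
  assumes l: "layout n m \<sigma>" and V: "vectors n m \<sigma> V" and i: "nats \<sigma> 2 0 = i" "i < m"
    and M: "represents n (reals \<sigma> a) M" and d: "w \<noteq> 14" "w \<noteq> 1" "w \<noteq> a" "a \<noteq> 14"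
  shows "exec (Vec_sum w 14 (RMul (mat_at a) in_k)) \<sigma> (75 * n\<^sup>2)
    (\<lambda>\<tau>. same {w, 14} {10, 11} \<sigma> \<tau> \<and> (\<forall>j<n. reals \<tau> w j = M (V i) j))"
proof -
  have n: "1 \<le> n" "nats \<sigma> 0 0 = n" "n \<le> m" using l by (auto simp: layout_def)
  have "exec (Vec_sum w 14 (RMul (mat_at a) in_k)) \<sigma> ((rcost (RMul (mat_at a) in_k) + 60) * n\<^sup>2)
    (\<lambda>\<tau>. same {w, 14} {10, 11} \<sigma> \<tau> \<and> (\<forall>j<n. reals \<tau> w j = (\<Sum>k<n. reals \<sigma> a (j * n + k) * V i k)))"
    by (rule exec_Vec_sum) (use n l V i d in \<open>auto simp: layout_def same_def vectors_def\<close>)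
  then show ?thesis
    by (rule exec_mono) (use represents_apply[OF M] V i in \<open>auto simp: vectors_def\<close>)
qed

lemma exec_in_dot:
  assumes l: "layout n m \<sigma>" and V: "vectors n m \<sigma> V" and i: "nats \<sigma> 2 0 = i" "i < m"
    and w: "\<And>j. j < n \<Longrightarrow> reals \<sigma> a j = w j" and d: "b \<noteq> 1" "b \<noteq> a"
  shows "exec (Sum b (RMul in_k (vec_k a))) \<sigma> (41 * n)
    (\<lambda>\<tau>. same {b} {11} \<sigma> \<tau> \<and> reals \<tau> b 0 = dot n (V i) w)"
proof -
  have n: "1 \<le> n" "nats \<sigma> 0 0 = n" "n \<le> m" using l by (auto simp: layout_def)
  have "exec (Sum b (RMul in_k (vec_k a))) \<sigma> ((rcost (RMul in_k (vec_k a)) + 30) * n)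
    (\<lambda>\<tau>. same {b} {11} \<sigma> \<tau> \<and> reals \<tau> b 0 = (\<Sum>k<n. V i k * w k))"
    by (rule exec_Sum) (use n l V i d w in \<open>auto simp: layout_def same_def vectors_def\<close>)
  then show ?thesis by (rule exec_mono) (auto simp: dot_def)
qed

lemma exec_products:
  assumes l: "layout n m \<sigma>" and V: "vectors n m \<sigma> V" and i: "nats \<sigma> 2 0 = i" "i < m"
    and M: "represents n (reals \<sigma> 3) M" and N: "represents n (reals \<sigma> 4) N"
  shows "exec products_prog \<sigma> (232 * n\<^sup>2) (\<lambda>\<tau>. same {6, 7, 10, 11, 14} {10, 11} \<sigma> \<tau> \<and>
     (\<forall>j<n. reals \<tau> 6 j = M (V i) j) \<and> (\<forall>j<n. reals \<tau> 7 j = N (V i) j) \<and>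
     reals \<tau> 10 0 = dot n (V i) (M (V i)) \<and> reals \<tau> 11 0 = dot n (V i) (N (V i)))"
proof -
  have n: "1 \<le> n" using l by (auto simp: layout_def)
  obtain t1 \<rho>1 where r1: "run (Vec_sum 6 14 (RMul (mat_at 3) in_k)) \<sigma> t1 \<rho>1" "t1 \<le> 75 * n\<^sup>2"
    and s1: "same {6, 14} {10, 11} \<sigma> \<rho>1" and w1: "\<And>j. j < n \<Longrightarrow> reals \<rho>1 6 j = M (V i) j"
    using exec_mat_vec[OF l V i M, of 6] by (auto simp: exec_def)
  have l1: "layout n m \<rho>1" and V1: "vectors n m \<rho>1 V" and i1: "nats \<rho>1 2 0 = i" and N1: "represents n (reals \<rho>1 4) N"
    using layout_same[OF l s1] vectors_same[OF V s1] s1 i N by (auto simp: same_def)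
  obtain t2 \<rho>2 where r2: "run (Vec_sum 7 14 (RMul (mat_at 4) in_k)) \<rho>1 t2 \<rho>2" "t2 \<le> 75 * n\<^sup>2"
    and s2: "same {7, 14} {10, 11} \<rho>1 \<rho>2" and w2: "\<And>j. j < n \<Longrightarrow> reals \<rho>2 7 j = N (V i) j"
    using exec_mat_vec[OF l1 V1 i1 i(2) N1, of 7] by (auto simp: exec_def)
  have l2: "layout n m \<rho>2" and V2: "vectors n m \<rho>2 V" and i2: "nats \<rho>2 2 0 = i"
    and w2': "\<And>j. j < n \<Longrightarrow> reals \<rho>2 6 j = M (V i) j"
    using layout_same[OF l1 s2] vectors_same[OF V1 s2] s2 i1 w1 by (auto simp: same_def)
  obtain t3 \<rho>3 where r3: "run (Sum 10 (RMul in_k (vec_k 6))) \<rho>2 t3 \<rho>3" "t3 \<le> 41 * n"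
    and s3: "same {10} {11} \<rho>2 \<rho>3" and x3: "reals \<rho>3 10 0 = dot n (V i) (M (V i))"
    using exec_in_dot[OF l2 V2 i2 i(2) w2', of 10] by (auto simp: exec_def)
  have l3: "layout n m \<rho>3" and V3: "vectors n m \<rho>3 V" and i3: "nats \<rho>3 2 0 = i"
    and w3': "\<And>j. j < n \<Longrightarrow> reals \<rho>3 7 j = N (V i) j"
    using layout_same[OF l2 s3] vectors_same[OF V2 s3] s3 i2 w2 by (auto simp: same_def)
  obtain t4 \<rho>4 where r4: "run (Sum 11 (RMul in_k (vec_k 7))) \<rho>3 t4 \<rho>4" "t4 \<le> 41 * n"
    and s4: "same {11} {11} \<rho>3 \<rho>4" and x4: "reals \<rho>4 11 0 = dot n (V i) (N (V i))"
    using exec_in_dot[OF l3 V3 i3 i(2) w3', of 11] by (auto simp: exec_def)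
  show ?thesis unfolding products_prog_def
  proof (rule execI[OF run.Seq[OF r1(1) run.Seq[OF r2(1) run.Seq[OF r3(1) r4(1)]]]])
    show "t1 + (t2 + (t3 + t4)) \<le> 232 * n\<^sup>2"
      using r1(2) r2(2) r3(2) r4(2) n_le_square[OF n] by linarith
  qed (use s1 s2 s3 s4 x3 x4 w2' w3' in \<open>auto simp: same_def\<close>)
qed

definition forms_prog :: com where
  "forms_prog = Seq (Sum2 12 (RMul (RMul (vec_j 6) (mat_at 5)) (vec_k 6))) (Sum2 13 (RMul (RMul (vec_j 7) (mat_at 5)) (vec_k 7)))"

lemma exec_form:
  assumes l: "layout n m \<sigma>" and G: "gram n (reals \<sigma> 5) S V" and w: "\<And>j. j < n \<Longrightarrow> reals \<sigma> a j = w j"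
    and d: "b \<noteq> a" "b \<noteq> 5"
  shows "exec (Sum2 b (RMul (RMul (vec_j a) (mat_at 5)) (vec_k a))) \<sigma> (75 * n\<^sup>2)
    (\<lambda>\<tau>. same {b} {10, 11} \<sigma> \<tau> \<and> reals \<tau> b 0 = (\<Sum>i\<in>S. (dot n (V i) w)\<^sup>2))"
proof -
  have n: "1 \<le> n" "nats \<sigma> 0 0 = n" "n \<le> m" using l by (auto simp: layout_def)
  have "exec (Sum2 b (RMul (RMul (vec_j a) (mat_at 5)) (vec_k a))) \<sigma> ((rcost (RMul (RMul (vec_j a) (mat_at 5)) (vec_k a)) + 60) * n\<^sup>2)
    (\<lambda>\<tau>. same {b} {10, 11} \<sigma> \<tau> \<and> reals \<tau> b 0 = (\<Sum>j<n. \<Sum>k<n. w j * reals \<sigma> 5 (j * n + k) * w k))"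
    by (rule exec_Sum2) (use n l w d in \<open>auto simp: layout_def same_def\<close>)
  then show ?thesis by (rule exec_mono) (auto simp: gram_quad[OF G])
qed

lemma exec_forms:
  assumes l: "layout n m \<sigma>" and G: "gram n (reals \<sigma> 5) S V"
    and w: "\<And>j. j < n \<Longrightarrow> reals \<sigma> 6 j = w j" and z: "\<And>j. j < n \<Longrightarrow> reals \<sigma> 7 j = z j"
  shows "exec forms_prog \<sigma> (150 * n\<^sup>2)
    (\<lambda>\<tau>. same {12, 13} {10, 11} \<sigma> \<tau> \<and> reals \<tau> 12 0 = (\<Sum>i\<in>S. (dot n (V i) w)\<^sup>2)
       \<and> reals \<tau> 13 0 = (\<Sum>i\<in>S. (dot n (V i) z)\<^sup>2))"
proof -
  obtain t1 \<rho>1 where r1: "run (Sum2 12 (RMul (RMul (vec_j 6) (mat_at 5)) (vec_k 6))) \<sigma> t1 \<rho>1" "t1 \<le> 75 * n\<^sup>2"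
    and s1: "same {12} {10, 11} \<sigma> \<rho>1" and w1: "reals \<rho>1 12 0 = (\<Sum>i\<in>S. (dot n (V i) w)\<^sup>2)"
    using exec_form[OF l G w, of 12] by (auto simp: exec_def)
  have l1: "layout n m \<rho>1" and G1: "gram n (reals \<rho>1 5) S V" and z1: "\<And>j. j < n \<Longrightarrow> reals \<rho>1 7 j = z j"
    using layout_same[OF l s1] G z s1 by (auto simp: same_def)
  obtain t2 \<rho>2 where r2: "run (Sum2 13 (RMul (RMul (vec_j 7) (mat_at 5)) (vec_k 7))) \<rho>1 t2 \<rho>2" "t2 \<le> 75 * n\<^sup>2"
    and s2: "same {13} {10, 11} \<rho>1 \<rho>2" and w2: "reals \<rho>2 13 0 = (\<Sum>i\<in>S. (dot n (V i) z)\<^sup>2)"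
    using exec_form[OF l1 G1 z1, of 13] by (auto simp: exec_def)
  show ?thesis unfolding forms_prog_def
    by (rule execI[OF run.Seq[OF r1(1) r2(1)]])
      (use r1 r2 s1 s2 w1 w2 in \<open>auto simp: same_def\<close>)
qed

definition trace_prog :: "nat \<Rightarrow> nat \<Rightarrow> com" where
  "trace_prog b a = Sum2 b (RMul (mat_at 5) (mat_at a))"

lemma exec_trace:
  assumes l: "layout n m \<sigma>" and V: "vectors n m \<sigma> V" and G: "gram n (reals \<sigma> 5) {..<m} V"
    and M: "represents n (reals \<sigma> a) M" and d: "b \<noteq> a" "b \<noteq> 5"
  shows "exec (trace_prog b a) \<sigma> (75 * n\<^sup>2)
    (\<lambda>\<tau>. same {b} {10, 11} \<sigma> \<tau> \<and> reals \<tau> b 0 = (\<Sum>i<m. dot n (V i) (M (V i))))"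
proof -
  have n: "1 \<le> n" "nats \<sigma> 0 0 = n" "n \<le> m" using l by (auto simp: layout_def)
  have "exec (trace_prog b a) \<sigma> ((rcost (RMul (mat_at 5) (mat_at a)) + 60) * n\<^sup>2)
    (\<lambda>\<tau>. same {b} {10, 11} \<sigma> \<tau> \<and> reals \<tau> b 0 = (\<Sum>j<n. \<Sum>k<n. reals \<sigma> 5 (j * n + k) * reals \<sigma> a (j * n + k)))"
    unfolding trace_prog_def
    by (rule exec_Sum2) (use n l d in \<open>auto simp: layout_def same_def\<close>)
  then show ?thesis
    by (rule exec_mono) (use gram_trace[OF G M] V in \<open>auto simp: vectors_def\<close>)
qed

text \<open>The update is subtracted, matching the sign in the Sherman-Morrison formula; additions
  pass a negated coefficient. Row and column factors are separate expressions, so the vector may be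
  given by a formula instead of an array.\<close>

definition rank_upd :: "nat \<Rightarrow> rexp \<Rightarrow> rexp \<Rightarrow> rexp \<Rightarrow> com" where
  "rank_upd a c p q = Mat_set 0 a (RSub (mat_at a) (RMul (RMul c p) q))"

lemma exec_rank_upd:
  assumes l: "layout n m \<sigma>"
    and e: "\<And>j k \<tau>. j < n \<Longrightarrow> k < n \<Longrightarrow> same {a} {10, 11} \<sigma> \<tau> \<Longrightarrow> nats \<tau> 10 0 = j \<Longrightarrow> nats \<tau> 11 0 = k \<Longrightarrow>
      rval c \<tau> = \<gamma> \<and> rval p \<tau> = u j \<and> rval q \<tau> = u k"
  shows "exec (rank_upd a c p q) \<sigma> ((rcost c + rcost p + rcost q + 70) * n\<^sup>2)
    (\<lambda>\<tau>. same {a} {10, 11} \<sigma> \<tau> \<and>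
      (\<forall>j<n. \<forall>k<n. reals \<tau> a (j * n + k) = reals \<sigma> a (j * n + k) + (- \<gamma>) * u j * u k))"
proof -
  have n: "1 \<le> n" "nats \<sigma> 0 0 = n" "n \<le> m" using l by (auto simp: layout_def)
  have "exec (rank_upd a c p q) \<sigma> ((rcost (RSub (mat_at a) (RMul (RMul c p) q)) + 60) * (n * n))
    (\<lambda>\<tau>. same {a} {10, 11} \<sigma> \<tau> \<and>
      (\<forall>j<n. \<forall>k<n. reals \<tau> a (j * n + k) = reals \<sigma> a (j * n + k) - \<gamma> * u j * u k))"
    unfolding rank_upd_def
  proof (rule exec_Mat_set[OF l n(2,1,3)])
    fix j k \<tau> assume a: "j < n" "k < n" "same {a} {10, 11} \<sigma> \<tau>" "nats \<tau> 10 0 = j" "nats \<tau> 11 0 = k"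
      "reals \<tau> a (j * n + k) = reals \<sigma> a (j * n + k)"
    have "rval (mat_at a) \<tau> = reals \<tau> a (j * n + k)" using a l n by (auto simp: layout_def same_def)
    then show "rval (RSub (mat_at a) (RMul (RMul c p) q)) \<tau> = reals \<sigma> a (j * n + k) - \<gamma> * u j * u k"
      using e[OF a(1-5)] a(6) by simp
  qed
  then show ?thesis by (rule exec_mono) (auto simp: power2_eq_square)
qed

lemma exec_rank_upd_represents:
  assumes l: "layout n m \<sigma>" and f: "represents n (reals \<sigma> a) f" and u: "supported n u"
    and e: "\<And>j k \<tau>. j < n \<Longrightarrow> k < n \<Longrightarrow> same {a} {10, 11} \<sigma> \<tau> \<Longrightarrow> nats \<tau> 10 0 = j \<Longrightarrow> nats \<tau> 11 0 = k \<Longrightarrow>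
      rval c \<tau> = \<gamma> \<and> rval p \<tau> = u j \<and> rval q \<tau> = u k"
  shows "exec (rank_upd a c p q) \<sigma> ((rcost c + rcost p + rcost q + 70) * n\<^sup>2)
    (\<lambda>\<tau>. same {a} {10, 11} \<sigma> \<tau> \<and> represents n (reals \<tau> a) (dot.rank1 n f (- \<gamma>) u))"
  by (rule exec_mono[OF exec_rank_upd[OF l e]]) (auto intro!: represents_rank1[OF f u])

text \<open>The Kronecker delta: with truncated subtraction the inner sum is the distance of row and
  column, and 1 minus it is 1 on the diagonal and 0 elsewhere.\<close>

definition id_at :: rexp where
  "id_at = RNat (NSub (NLit 1) (NAdd (NSub (nvar 10) (nvar 11)) (NSub (nvar 11) (nvar 10))))"

text \<open>The inverse of \<open>A + Q\<close> follows the step from \<open>A + Q\<close> to \<open>A + v \<otimes> v + Q - z \<otimes> z / \<rho>\<close> by two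
  rank-one updates. If \<open>\<rho> = 0\<close>, the updates that divide by \<open>\<rho>\<close> vanish, as \<open>x / 0 = 0\<close>.\<close>

definition init_body :: com where
  "init_body = (let \<xi> = rvar 10; \<rho> = rvar 11; t = RDiv \<rho> (RAdd (lit 1) \<xi>) in
    Seq products_prog
    (Seq (rank_upd 3 (RDiv (lit 1) (RAdd (lit 1) \<xi>)) (vec_j 6) (vec_k 6))
    (Seq (rank_upd 3 (RSub (lit 0) (RDiv (RAdd (lit 1) \<xi>) (RMul \<rho> \<rho>)))
            (RSub (vec_j 7) (RMul t (vec_j 6))) (RSub (vec_k 7) (RMul t (vec_k 6))))
    (Seq (rank_upd 4 (RDiv (lit 1) \<rho>) (vec_j 7) (vec_k 7))
         (rank_upd 5 (RSub (lit 0) (lit 1)) in_j in_k)))))"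

definition init_prog :: com where
  "init_prog = Seq (Mat_set 0 3 id_at) (Seq (Mat_set 0 4 id_at) (Seq (Mat_set 0 5 (lit 0)) (For 2 1 init_body)))"

definition init_state :: "nat \<Rightarrow> (nat \<Rightarrow> nat \<Rightarrow> real) \<Rightarrow> nat \<Rightarrow> mem \<Rightarrow> bool" where
  "init_state n V i \<tau> \<longleftrightarrow> gram n (reals \<tau> 5) {..<i} V \<and>
     (\<exists>Q H. dot.projector_off n i V Q \<and> dot.inverse_pair n (dot.barrier n i V Q 1 (\<lambda>_. 1)) H \<and>
       represents n (reals \<tau> 3) H \<and> represents n (reals \<tau> 4) Q)"

lemma exec_init_body:
  assumes l: "layout n m \<sigma>" and V: "vectors n m \<sigma> V" and i: "nats \<sigma> 2 0 = i" "i < m"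
    and st: "init_state n V i \<sigma>"
  shows "exec init_body \<sigma> (700 * n\<^sup>2) (\<lambda>\<tau>. same {3, 4, 5, 6, 7, 10, 11, 14} {10, 11} \<sigma> \<tau> \<and> init_state n V (Suc i) \<tau>)"
proof -
  have Vi: "supported n (V i)" using V i by (auto simp: vectors_def)
  obtain Q H where G: "gram n (reals \<sigma> 5) {..<i} V" and Q: "dot.projector_off n i V Q"
    and H: "dot.inverse_pair n (dot.barrier n i V Q 1 (\<lambda>_. 1)) H"
    and rH: "represents n (reals \<sigma> 3) H" and rQ: "represents n (reals \<sigma> 4) Q"
    using st by (auto simp: init_state_def)
  define z where "z = Q (V i)"
  define w where "w = H (V i)"
  define \<rho> where "\<rho> = dot n (V i) z"
  define \<xi> where "\<xi> = dot n (V i) w"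
  define u where "u = z - (\<rho> / (1 + \<xi>)) *\<^sub>R w"
  have sw: "supported n w" "supported n z" "supported n u"
    using supported_represents[OF rH Vi] supported_represents[OF rQ Vi]
    by (auto simp: u_def w_def z_def supported_def scaleR_fun_def)
  let ?\<xi> = "rvar 10" and ?\<rho> = "rvar 11"
  let ?t = "RDiv ?\<rho> (RAdd (lit 1) ?\<xi>)"
  obtain t1 \<rho>1 where r1: "run products_prog \<sigma> t1 \<rho>1" "t1 \<le> 232 * n\<^sup>2"
    and s1: "same {6, 7, 10, 11, 14} {10, 11} \<sigma> \<rho>1"
    and d1: "\<forall>j<n. reals \<rho>1 6 j = w j" "\<forall>j<n. reals \<rho>1 7 j = z j" "reals \<rho>1 10 0 = \<xi>" "reals \<rho>1 11 0 = \<rho>"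
    using exec_products[OF l V i rH rQ] unfolding w_def z_def \<xi>_def \<rho>_def by (auto simp: exec_def)
  have l1: "layout n m \<rho>1" and rH1: "represents n (reals \<rho>1 3) H"
    using layout_same[OF l s1] s1 rH by (auto simp: same_def)
  obtain t2 \<rho>2 where r2: "run (rank_upd 3 (RDiv (lit 1) (RAdd (lit 1) ?\<xi>)) (vec_j 6) (vec_k 6)) \<rho>1 t2 \<rho>2" "t2 \<le> 84 * n\<^sup>2"
    and s2: "same {3} {10, 11} \<rho>1 \<rho>2" and rH2: "represents n (reals \<rho>2 3) (dot.rank1 n H (- (1 / (1 + \<xi>))) w)"
    using exec_rank_upd_represents[OF l1 rH1 sw(1), of "RDiv (lit 1) (RAdd (lit 1) ?\<xi>)" "1 / (1 + \<xi>)" "vec_j 6" "vec_k 6"] d1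
    by (auto simp: exec_def same_def)
  have l2: "layout n m \<rho>2" using layout_same[OF l1 s2] by auto
  obtain t3 \<rho>3 where r3: "run (rank_upd 3 (RSub (lit 0) (RDiv (RAdd (lit 1) ?\<xi>) (RMul ?\<rho> ?\<rho>)))
            (RSub (vec_j 7) (RMul ?t (vec_j 6))) (RSub (vec_k 7) (RMul ?t (vec_k 6)))) \<rho>2 t3 \<rho>3" "t3 \<le> 116 * n\<^sup>2"
    and s3: "same {3} {10, 11} \<rho>2 \<rho>3"
    and rH3: "represents n (reals \<rho>3 3) (dot.rank1 n (dot.rank1 n H (- (1 / (1 + \<xi>))) w) (- (0 - (1 + \<xi>) / (\<rho> * \<rho>))) u)"
    using exec_rank_upd_represents[OF l2 rH2 sw(3), of "RSub (lit 0) (RDiv (RAdd (lit 1) ?\<xi>) (RMul ?\<rho> ?\<rho>))"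
       "0 - (1 + \<xi>) / (\<rho> * \<rho>)" "RSub (vec_j 7) (RMul ?t (vec_j 6))" "RSub (vec_k 7) (RMul ?t (vec_k 6))"] d1 s2
    by (auto simp: exec_def same_def u_def scaleR_fun_def)
  have l3: "layout n m \<rho>3" and rQ3: "represents n (reals \<rho>3 4) Q" using layout_same[OF l2 s3] s1 s2 s3 rQ by (auto simp: same_def)
  obtain t4 \<rho>4 where r4: "run (rank_upd 4 (RDiv (lit 1) ?\<rho>) (vec_j 7) (vec_k 7)) \<rho>3 t4 \<rho>4" "t4 \<le> 81 * n\<^sup>2"
    and s4: "same {4} {10, 11} \<rho>3 \<rho>4" and rQ4: "represents n (reals \<rho>4 4) (dot.rank1 n Q (- (1 / \<rho>)) z)"
    using exec_rank_upd_represents[OF l3 rQ3 sw(2), of "RDiv (lit 1) ?\<rho>" "1 / \<rho>" "vec_j 7" "vec_k 7"] d1 s2 s3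
    by (auto simp: exec_def same_def)
  have l4: "layout n m \<rho>4" and V4: "vectors n m \<rho>4 V" and i4: "nats \<rho>4 2 0 = i"
    using layout_same[OF l3 s4] V s1 s2 s3 s4 i by (auto simp: same_def vectors_def)
  have "exec (rank_upd 5 (RSub (lit 0) (lit 1)) in_j in_k) \<rho>4
    ((rcost (RSub (lit 0) (lit 1)) + rcost in_j + rcost in_k + 70) * n\<^sup>2)
    (\<lambda>\<tau>. same {5} {10, 11} \<rho>4 \<tau> \<and>
      (\<forall>j<n. \<forall>k<n. reals \<tau> 5 (j * n + k) = reals \<rho>4 5 (j * n + k) + (- (0 - 1)) * V i j * V i k))"
    by (rule exec_rank_upd[OF l4]) (use l4 V4 i4 i in \<open>auto simp: layout_def vectors_def same_def\<close>)
  then obtain t5 \<rho>5 where r5: "run (rank_upd 5 (RSub (lit 0) (lit 1)) in_j in_k) \<rho>4 t5 \<rho>5" "t5 \<le> 89 * n\<^sup>2"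
    and s5: "same {5} {10, 11} \<rho>4 \<rho>5"
    and d5: "\<And>j k. j < n \<Longrightarrow> k < n \<Longrightarrow> reals \<rho>5 5 (j * n + k) = reals \<sigma> 5 (j * n + k) + V i j * V i k"
    using s1 s2 s3 s4 by (auto simp: exec_def same_def)
  have "gram n (reals \<rho>5 5) {..<Suc i} V"
    using gram_insert[OF G, of i "reals \<rho>5 5"] d5 by (simp add: lessThan_Suc)
  moreover have "dot.projector_off n (Suc i) V (dot.rank1 n Q (- 1 / \<rho>) z) \<and>
      dot.inverse_pair n (dot.barrier n (Suc i) V (dot.rank1 n Q (- 1 / \<rho>) z) 1 (\<lambda>_. 1))
       (dot.rank1 n (dot.rank1 n H (- 1 / (1 + \<xi>)) w) ((1 + \<xi>) / \<rho>\<^sup>2) (z - (\<rho> / (1 + \<xi>)) *\<^sub>R w))"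
    by (rule dot.projector_inverse_step[OF z_def w_def \<rho>_def \<xi>_def refl refl Q H])
  moreover have "represents n (reals \<rho>5 3) (dot.rank1 n (dot.rank1 n H (- 1 / (1 + \<xi>)) w) ((1 + \<xi>) / \<rho>\<^sup>2) (z - (\<rho> / (1 + \<xi>)) *\<^sub>R w))"
    using rH3 s4 s5 by (simp add: same_def u_def power2_eq_square)
  moreover have "represents n (reals \<rho>5 4) (dot.rank1 n Q (- 1 / \<rho>) z)"
    using rQ4 s5 by (simp add: same_def)
  ultimately have st': "init_state n V (Suc i) \<rho>5" unfolding init_state_def by blast
  show ?thesis unfolding init_body_def Let_def
  proof (rule execI[OF run.Seq[OF r1(1) run.Seq[OF r2(1) run.Seq[OF r3(1) run.Seq[OF r4(1) r5(1)]]]]])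
    show "t1 + (t2 + (t3 + (t4 + t5))) \<le> 700 * n\<^sup>2"
      using r1(2) r2(2) r3(2) r4(2) r5(2) by linarith
  qed (use s1 s2 s3 s4 s5 st' in \<open>auto simp: same_def\<close>)
qed

lemma exec_id_mat:
  assumes l: "layout n m \<sigma>"
  shows "exec (Mat_set 0 a id_at) \<sigma> (100 * n\<^sup>2) (\<lambda>\<tau>. same {a} {10, 11} \<sigma> \<tau> \<and> represents n (reals \<tau> a) (\<lambda>x. x))"
proof -
  have n: "1 \<le> n" "nats \<sigma> 0 0 = n" "n \<le> m" using l by (auto simp: layout_def)
  have "exec (Mat_set 0 a id_at) \<sigma> ((rcost id_at + 60) * (n * n))
     (\<lambda>\<tau>. same {a} {10, 11} \<sigma> \<tau> \<and> (\<forall>j<n. \<forall>k<n. reals \<tau> a (j * n + k) = (if j = k then 1 else 0)))"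
    by (rule exec_Mat_set[OF l n(2,1,3)]) (auto simp: id_at_def)
  then show ?thesis
    by (rule exec_mono) (auto simp: id_at_def power2_eq_square intro!: represents_id)
qed

lemma exec_init:
  assumes l: "layout n m \<sigma>" and V: "vectors n m \<sigma> V"
  shows "exec init_prog \<sigma> (1200 * (m * n\<^sup>2))
    (\<lambda>\<tau>. same {3, 4, 5, 6, 7, 10, 11, 14} {2, 10, 11} \<sigma> \<tau> \<and> init_state n V m \<tau>)"
proof -
  have n: "1 \<le> n" "nats \<sigma> 0 0 = n" "n \<le> m" using l by (auto simp: layout_def)
  obtain t1 \<rho>1 where r1: "run (Mat_set 0 3 id_at) \<sigma> t1 \<rho>1" "t1 \<le> 100 * n\<^sup>2"
    and s1: "same {3} {10, 11} \<sigma> \<rho>1" and h1: "represents n (reals \<rho>1 3) (\<lambda>x. x)"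
    using exec_id_mat[OF l, of 3] by (auto simp: exec_def)
  have l1: "layout n m \<rho>1" using layout_same[OF l s1] by auto
  obtain t2 \<rho>2 where r2: "run (Mat_set 0 4 id_at) \<rho>1 t2 \<rho>2" "t2 \<le> 100 * n\<^sup>2"
    and s2: "same {4} {10, 11} \<rho>1 \<rho>2" and h2: "represents n (reals \<rho>2 4) (\<lambda>x. x)"
    using exec_id_mat[OF l1, of 4] by (auto simp: exec_def)
  have l2: "layout n m \<rho>2" using layout_same[OF l1 s2] by auto
  have n2: "nats \<rho>2 0 0 = n" using l2 by (auto simp: layout_def)
  have "exec (Mat_set 0 5 (lit 0)) \<rho>2 ((rcost (lit 0) + 60) * (n * n))
     (\<lambda>\<tau>. same {5} {10, 11} \<rho>2 \<tau> \<and> (\<forall>j<n. \<forall>k<n. reals \<tau> 5 (j * n + k) = 0))"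
    by (rule exec_Mat_set[OF l2 n2 n(1,3)]) auto
  then obtain t3 \<rho>3 where r3: "run (Mat_set 0 5 (lit 0)) \<rho>2 t3 \<rho>3" "t3 \<le> 100 * n\<^sup>2"
    and s3: "same {5} {10, 11} \<rho>2 \<rho>3" and h3: "\<forall>j<n. \<forall>k<n. reals \<rho>3 5 (j * n + k) = 0"
    by (auto simp: exec_def power2_eq_square)
  let ?R = "{3, 4, 5, 6, 7, 10, 11, 14} :: nat set"
  have s03: "same ?R {2, 10, 11} \<sigma> \<rho>3" using s1 s2 s3 by (auto simp: same_def)
  have "init_state n V 0 \<rho>3"
    unfolding init_state_def
  proof (intro conjI exI)
    show "gram n (reals \<rho>3 5) {..<0} V" using h3 by (simp add: gram_def)
    show "dot.projector_off n 0 V (\<lambda>x. x)" "dot.inverse_pair n (dot.barrier n 0 V (\<lambda>x. x) 1 (\<lambda>_. 1)) (\<lambda>x. x)"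
      by (rule dot.projector_inverse_init)+
    show "represents n (reals \<rho>3 3) (\<lambda>x. x)" "represents n (reals \<rho>3 4) (\<lambda>x. x)"
      using h1 h2 s2 s3 by (auto simp: same_def)
  qed
  note st3 = this
  have "exec (For 2 1 init_body) \<rho>3 (m * (700 * n\<^sup>2 + 21))
     (\<lambda>\<tau>. same ?R {2, 10, 11} \<sigma> \<tau> \<and> init_state n V m \<tau>)"
  proof (rule exec_For_const[where I = "\<lambda>i \<tau>. same ?R {2, 10, 11} \<sigma> \<tau> \<and> init_state n V i \<tau>"])
    fix i \<tau> assume a: "i < m" "same ?R {2, 10, 11} \<sigma> \<tau> \<and> init_state n V i \<tau>" "nats \<tau> 2 0 = i"
    have "layout n m \<tau>" "vectors n m \<tau> V" using layout_same[OF l] vectors_same[OF V] a by auto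
    from exec_init_body[OF this a(3,1)] a(2)
    have "exec init_body \<tau> (700 * n\<^sup>2)
      (\<lambda>\<rho>. same {3, 4, 5, 6, 7, 10, 11, 14} {10, 11} \<tau> \<rho> \<and> init_state n V (Suc i) \<rho>)" by auto
    then show "exec init_body \<tau> (700 * n\<^sup>2)
      (\<lambda>\<rho>. nats \<rho> 2 0 = i \<and> same ?R {2, 10, 11} \<sigma> (set_nvar 2 (Suc i) \<rho>) \<and> init_state n V (Suc i) (set_nvar 2 (Suc i) \<rho>))"
      by (rule exec_mono) (use a in \<open>auto simp: same_def init_state_def\<close>)
  next
    show "nats \<tau> 0 1 = m" if "same ?R {2, 10, 11} \<sigma> \<tau> \<and> init_state n V i \<tau>" for i \<tau>
      using that l by (auto simp: same_def layout_def)
  qed (use s03 st3 n in \<open>auto simp: same_def init_state_def\<close>)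
  then obtain t4 \<rho>4 where r4: "run (For 2 1 init_body) \<rho>3 t4 \<rho>4" "t4 \<le> m * (700 * n\<^sup>2 + 21)"
    and s4: "same ?R {2, 10, 11} \<sigma> \<rho>4" and h4: "init_state n V m \<rho>4"
    by (auto simp: exec_def)
  show ?thesis unfolding init_prog_def
  proof (rule execI[OF run.Seq[OF r1(1) run.Seq[OF r2(1) run.Seq[OF r3(1) r4(1)]]]])
    have "1 * n\<^sup>2 \<le> m * n\<^sup>2" using n by (intro mult_right_mono) auto
    moreover have "m * 1 \<le> m * n\<^sup>2" using n by (intro mult_left_mono) auto
    moreover have "m * (700 * n\<^sup>2 + 21) = 700 * (m * n\<^sup>2) + 21 * m" by (simp add: algebra_simps)
    ultimately show "t1 + (t2 + (t3 + t4)) \<le> 1200 * (m * n\<^sup>2)"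
      using r1(2) r2(2) r3(2) r4(2) by linarith
  qed (use s4 h4 in auto)
qed

section \<open>Sampling program\<close>

definition scale_mat :: "nat \<Rightarrow> rexp \<Rightarrow> nat \<Rightarrow> com" where
  "scale_mat b c a = Mat_set 0 b (RMul c (mat_at a))"

text \<open>Source and target may coincide, because each cell is read before it is overwritten. This
  is used to turn one inverse into both initial barriers, the copy in array 4 being made before
  array 3 is scaled in place.\<close>

lemma exec_scale_mat:
  assumes l: "layout n m \<sigma>" and f: "represents n (reals \<sigma> a) f"
    and c: "\<And>\<tau>. same {b} {10, 11} \<sigma> \<tau> \<Longrightarrow> rval c \<tau> = \<gamma>"
  shows "exec (scale_mat b c a) \<sigma> ((rcost c + 70) * n\<^sup>2)
    (\<lambda>\<tau>. same {b} {10, 11} \<sigma> \<tau> \<and> represents n (reals \<tau> b) (\<lambda>x. \<gamma> *\<^sub>R f x))"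
proof -
  have n: "1 \<le> n" "nats \<sigma> 0 0 = n" "n \<le> m" using l by (auto simp: layout_def)
  have "exec (scale_mat b c a) \<sigma> ((rcost (RMul c (mat_at a)) + 60) * (n * n))
    (\<lambda>\<tau>. same {b} {10, 11} \<sigma> \<tau> \<and> (\<forall>j<n. \<forall>k<n. reals \<tau> b (j * n + k) = \<gamma> * reals \<sigma> a (j * n + k)))"
    unfolding scale_mat_def
  proof (rule exec_Mat_set[OF l n(2,1,3)])
    fix j k \<tau> assume a: "j < n" "k < n" "same {b} {10, 11} \<sigma> \<tau>" "nats \<tau> 10 0 = j" "nats \<tau> 11 0 = k"
      "reals \<tau> b (j * n + k) = reals \<sigma> b (j * n + k)"
    have "rval (mat_at a) \<tau> = reals \<tau> a (j * n + k)" using a l n by (auto simp: layout_def same_def)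
    also have "\<dots> = reals \<sigma> a (j * n + k)" using a by (cases "a = b") (auto simp: same_def)
    finally show "rval (RMul c (mat_at a)) \<tau> = \<gamma> * reals \<sigma> a (j * n + k)" using c[OF a(3)] by simp
  qed
  then show ?thesis by (rule exec_mono) (auto simp: power2_eq_square intro!: represents_scale[OF f])
qed

abbreviation r_eta :: rexp where "r_eta \<equiv> rvar 15"
abbreviation r_K :: rexp where "r_K \<equiv> rvar 16"
abbreviation r_c :: rexp where "r_c \<equiv> RSub (RAdd (lit 1) r_eta) (rvar 17)"
abbreviation r_d :: rexp where "r_d \<equiv> RAdd (RSub (rvar 17) (lit 1)) r_eta"
abbreviation r_fc :: rexp where "r_fc \<equiv> RDiv r_c (RAdd (lit 1) (RMul r_c (rvar 10)))"
abbreviation r_fd :: rexp where "r_fd \<equiv> RDiv r_d (RAdd (lit 1) (RMul r_d (rvar 11)))"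

text \<open>The tentative weight is stored in scalar 17 before the test, so that \<open>r_fc\<close>
  and \<open>r_fd\<close> serve both for the test and for the later updates with the final
  weight.\<close>

definition choose_weight :: com where
  "choose_weight = Cond (RLess (RAdd (rvar 10) (rvar 11)) r_K)
     (Seq (RStore 17 (NLit 0) (RDiv r_K (RAdd (rvar 10) (rvar 11))))
       (Cond (RLess (RAdd (rvar 10) (rvar 11)) (RSub (RSub r_K (RMul r_fc (rvar 12))) (RMul r_fd (rvar 13))))
         (RStore 17 (NLit 0) (lit 0)) Skip))
     (RStore 17 (NLit 0) (lit 1))"

lemma exec_choose_weight:
  assumes v: "reals \<sigma> 15 0 = \<eta>" "reals \<sigma> 16 0 = K" "reals \<sigma> 10 0 = x" "reals \<sigma> 11 0 = y"
    "reals \<sigma> 12 0 = a" "reals \<sigma> 13 0 = b"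
    and r: "r = (if K \<le> x + y then 1 else
       let t = K / (x + y) in
       if K - (1 + \<eta> - t) / (1 + (1 + \<eta> - t) * x) * a - (t - 1 + \<eta>) / (1 + (t - 1 + \<eta>) * y) * b \<le> x + y
       then t else 0)"
  shows "exec choose_weight \<sigma> 200 (\<lambda>\<tau>. same {17} {} \<sigma> \<tau> \<and> reals \<tau> 17 0 = r)"
proof -
  let ?P = "\<lambda>\<tau>. same {17} {} \<sigma> \<tau> \<and> reals \<tau> 17 0 = r"
  let ?e = "RDiv r_K (RAdd (rvar 10) (rvar 11))"
  let ?b = "RLess (RAdd (rvar 10) (rvar 11)) (RSub (RSub r_K (RMul r_fc (rvar 12))) (RMul r_fd (rvar 13)))"
  have 1: "exec (Seq (RStore 17 (NLit 0) ?e) (Cond ?b (RStore 17 (NLit 0) (lit 0)) Skip)) \<sigma> 150 ?P" if "x + y < K"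
  proof (rule exec_mono[OF exec_Seq[OF exec_RStore[where P = "\<lambda>\<tau>. same {17} {} \<sigma> \<tau> \<and> reals \<tau> 17 0 = K / (x + y)"]]])
    fix \<rho> assume \<rho>: "same {17} {} \<sigma> \<rho> \<and> reals \<rho> 17 0 = K / (x + y)"
    show "exec (Cond ?b (RStore 17 (NLit 0) (lit 0)) Skip) \<rho> (1 + bcost ?b + 10) ?P"
    proof (rule exec_Cond)
      assume "bval ?b \<rho>"
      with \<rho> v that show "exec (RStore 17 (NLit 0) (lit 0)) \<rho> 10 ?P"
        by (intro exec_mono[OF exec_RStore[where P = ?P]]) (auto simp: r same_def Let_def)
    next
      assume "\<not> bval ?b \<rho>"
      with \<rho> v that show "exec Skip \<rho> 10 ?P"
        by (intro exec_mono[OF exec_Skip[where P = ?P]]) (auto simp: r same_def Let_def)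
    qed
  qed (use v in \<open>auto simp: same_def\<close>)
  have "exec choose_weight \<sigma> (1 + bcost (RLess (RAdd (rvar 10) (rvar 11)) r_K) + 150) ?P"
    unfolding choose_weight_def
  proof (rule exec_Cond)
    assume "bval (RLess (RAdd (rvar 10) (rvar 11)) r_K) \<sigma>"
    with 1 v show "exec (Seq (RStore 17 (NLit 0) ?e) (Cond ?b (RStore 17 (NLit 0) (lit 0)) Skip)) \<sigma> 150 ?P" by simp
  next
    assume "\<not> bval (RLess (RAdd (rvar 10) (rvar 11)) r_K) \<sigma>"
    with v show "exec (RStore 17 (NLit 0) (lit 1)) \<sigma> 150 ?P"
      by (intro exec_mono[OF exec_RStore[where P = ?P]]) (auto simp: r same_def)
  qed
  then show ?thesis by (rule exec_mono) auto
qed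

text \<open>The current vector is removed from the Gram matrix before the quadratic forms are taken,
  since the potential counts only the vectors after it. Dropped vectors update the barriers too,
  with weight 0.\<close>

definition sample_body :: com where
  "sample_body = Seq products_prog (Seq (rank_upd 5 (lit 1) in_j in_k) (Seq forms_prog (Seq choose_weight
    (Seq (rank_upd 3 r_fc (vec_j 6) (vec_k 6)) (Seq (rank_upd 4 r_fd (vec_j 7) (vec_k 7))
      (RStore 8 (nvar 2) (rvar 17)))))))"

definition sample_state where
  "sample_state n m V Q \<eta> \<Psi> i \<tau> \<longleftrightarrow> gram n (reals \<tau> 5) {i..<m} V \<and>
     reals \<tau> 15 0 = \<eta> \<and> reals \<tau> 16 0 = \<eta> / (1 + \<eta>) \<and>
     (\<exists>M N s. dot.sampling_inv n m V Q \<eta> \<Psi> i M N s \<and> represents n (reals \<tau> 3) M \<and> represents n (reals \<tau> 4) N \<and>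
       (\<forall>j<i. reals \<tau> 8 j = s j))"

lemma exec_sample_body:
  assumes l: "layout n m \<sigma>" and V: "vectors n m \<sigma> V" and i: "nats \<sigma> 2 0 = i" "i < m"
    and st: "sample_state n m V Q \<eta> \<Psi> i \<sigma>" and \<eta>: "0 < \<eta>" "\<eta> < 1"
  shows "exec sample_body \<sigma> (1000 * n\<^sup>2)
    (\<lambda>\<tau>. same {3, 4, 5, 6, 7, 8, 10, 11, 12, 13, 14, 17} {10, 11} \<sigma> \<tau> \<and> sample_state n m V Q \<eta> \<Psi> (Suc i) \<tau>)"
proof -
  have Vi: "supported n (V i)" and n: "1 \<le> n" using V i l by (auto simp: vectors_def layout_def)
  obtain M N s where G: "gram n (reals \<sigma> 5) {i..<m} V" and inv: "dot.sampling_inv n m V Q \<eta> \<Psi> i M N s"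
    and rM: "represents n (reals \<sigma> 3) M" and rN: "represents n (reals \<sigma> 4) N"
    and s8: "\<And>j. j < i \<Longrightarrow> reals \<sigma> 8 j = s j" and e: "reals \<sigma> 15 0 = \<eta>" "reals \<sigma> 16 0 = \<eta> / (1 + \<eta>)"
    using st by (auto simp: sample_state_def)
  define K where "K = \<eta> / (1 + \<eta>)"
  define w where "w = M (V i)"
  define z where "z = N (V i)"
  define x where "x = dot n (V i) w"
  define y where "y = dot n (V i) z"
  define a where "a = (\<Sum>j\<in>{Suc i..<m}. (dot n (V j) w)\<^sup>2)"
  define b where "b = (\<Sum>j\<in>{Suc i..<m}. (dot n (V j) z)\<^sup>2)"
  define r where "r = (if K \<le> x + y then 1 else
       let t = K / (x + y) in
       if K - (1 + \<eta> - t) / (1 + (1 + \<eta> - t) * x) * a - (t - 1 + \<eta>) / (1 + (t - 1 + \<eta>) * y) * b \<le> x + y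
       then t else 0)"
  have sw: "supported n w" "supported n z"
    using supported_represents[OF rM Vi] supported_represents[OF rN Vi] by (auto simp: w_def z_def)
  obtain t1 \<rho>1 where r1: "run products_prog \<sigma> t1 \<rho>1" "t1 \<le> 232 * n\<^sup>2"
    and s1: "same {6, 7, 10, 11, 14} {10, 11} \<sigma> \<rho>1"
    and d1: "\<forall>j<n. reals \<rho>1 6 j = w j" "\<forall>j<n. reals \<rho>1 7 j = z j" "reals \<rho>1 10 0 = x" "reals \<rho>1 11 0 = y"
    using exec_products[OF l V i rM rN] unfolding w_def z_def x_def y_def by (auto simp: exec_def)
  have l1: "layout n m \<rho>1" and V1: "vectors n m \<rho>1 V" and i1: "nats \<rho>1 2 0 = i"
    using layout_same[OF l s1] V s1 i by (auto simp: same_def vectors_def)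
  have "exec (rank_upd 5 (lit 1) in_j in_k) \<rho>1
    ((rcost (lit 1) + rcost in_j + rcost in_k + 70) * n\<^sup>2)
    (\<lambda>\<tau>. same {5} {10, 11} \<rho>1 \<tau> \<and>
      (\<forall>j<n. \<forall>k<n. reals \<tau> 5 (j * n + k) = reals \<rho>1 5 (j * n + k) + (- 1) * V i j * V i k))"
    by (rule exec_rank_upd[OF l1]) (use l1 V1 i1 i in \<open>auto simp: layout_def vectors_def same_def\<close>)
  then obtain t2 \<rho>2 where r2: "run (rank_upd 5 (lit 1) in_j in_k) \<rho>1 t2 \<rho>2" "t2 \<le> 86 * n\<^sup>2"
    and s2: "same {5} {10, 11} \<rho>1 \<rho>2"
    and d2: "\<And>j k. j < n \<Longrightarrow> k < n \<Longrightarrow> reals \<rho>2 5 (j * n + k) = reals \<sigma> 5 (j * n + k) - V i j * V i k"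
    using s1 by (auto simp: exec_def same_def)
  have l2: "layout n m \<rho>2" using layout_same[OF l1 s2] by auto
  have "{i..<m} = insert i {Suc i..<m}" using i by auto
  then have G2: "gram n (reals \<rho>2 5) {Suc i..<m} V"
    using gram_remove[of n "reals \<sigma> 5" i "{Suc i..<m}" V "reals \<rho>2 5"] G d2 by simp
  obtain t3 \<rho>3 where r3: "run forms_prog \<rho>2 t3 \<rho>3" "t3 \<le> 150 * n\<^sup>2"
    and s3: "same {12, 13} {10, 11} \<rho>2 \<rho>3" and d3: "reals \<rho>3 12 0 = a" "reals \<rho>3 13 0 = b"
    using exec_forms[OF l2 G2, of w z] d1 s2 unfolding a_def b_def by (auto simp: exec_def same_def)
  have "exec choose_weight \<rho>3 200 (\<lambda>\<tau>. same {17} {} \<rho>3 \<tau> \<and> reals \<tau> 17 0 = r)"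
    by (rule exec_choose_weight[OF _ _ _ _ _ _ r_def]) (use d1 d3 e s1 s2 s3 in \<open>auto simp: same_def K_def\<close>)
  then obtain t4 \<rho>4 where r4: "run choose_weight \<rho>3 t4 \<rho>4" "t4 \<le> 200"
    and s4: "same {17} {} \<rho>3 \<rho>4" and d4: "reals \<rho>4 17 0 = r" by (auto simp: exec_def)
  have s04: "same {5, 6, 7, 10, 11, 12, 13, 14, 17} {10, 11} \<sigma> \<rho>4" using s1 s2 s3 s4 by (auto simp: same_def)
  have l4: "layout n m \<rho>4" and rM4: "represents n (reals \<rho>4 3) M"
    using layout_same[OF l s04] rM s04 by (auto simp: same_def)
  have w4: "\<forall>j<n. reals \<rho>4 6 j = w j" "\<forall>j<n. reals \<rho>4 7 j = z j" and
    x4: "reals \<rho>4 10 0 = x" "reals \<rho>4 11 0 = y" "reals \<rho>4 15 0 = \<eta>"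
    using d1 e s1 s2 s3 s4 by (auto simp: same_def)
  let ?c = "(1 + \<eta> - r) / (1 + (1 + \<eta> - r) * x)" and ?d = "(r - 1 + \<eta>) / (1 + (r - 1 + \<eta>) * y)"
  obtain t5 \<rho>5 where r5: "run (rank_upd 3 r_fc (vec_j 6) (vec_k 6)) \<rho>4 t5 \<rho>5" "t5 \<le> 99 * n\<^sup>2"
    and s5: "same {3} {10, 11} \<rho>4 \<rho>5" and rM5: "represents n (reals \<rho>5 3) (dot.rank1 n M (- ?c) w)"
    using exec_rank_upd_represents[OF l4 rM4 sw(1), of r_fc ?c "vec_j 6" "vec_k 6"] w4 x4 d4
    by (auto simp: exec_def same_def)
  have l5: "layout n m \<rho>5" and rN5: "represents n (reals \<rho>5 4) N"
    using layout_same[OF l4 s5] rN s04 s5 by (auto simp: same_def)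
  obtain t6 \<rho>6 where r6: "run (rank_upd 4 r_fd (vec_j 7) (vec_k 7)) \<rho>5 t6 \<rho>6" "t6 \<le> 99 * n\<^sup>2"
    and s6: "same {4} {10, 11} \<rho>5 \<rho>6" and rN6: "represents n (reals \<rho>6 4) (dot.rank1 n N (- ?d) z)"
    using exec_rank_upd_represents[OF l5 rN5 sw(2), of r_fd ?d "vec_j 7" "vec_k 7"] w4 x4 d4 s5
    by (auto simp: exec_def same_def)
  have "exec (RStore 8 (nvar 2) (rvar 17)) \<rho>6 (1 + ncost (nvar 2) + rcost (rvar 17))
    (\<lambda>\<tau>. same {8} {} \<rho>6 \<tau> \<and> reals \<tau> 8 = (reals \<sigma> 8)(i := r))"
    using i d4 s04 s5 s6 by (intro exec_RStore) (auto simp: same_def)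
  then obtain t7 \<rho>7 where r7: "run (RStore 8 (nvar 2) (rvar 17)) \<rho>6 t7 \<rho>7" "t7 \<le> 10"
    and s7: "same {8} {} \<rho>6 \<rho>7" and d7: "reals \<rho>7 8 = (reals \<sigma> 8)(i := r)" by (auto simp: exec_def)
  have inv': "dot.sampling_inv n m V Q \<eta> \<Psi> (Suc i) (dot.rank1 n M (- ?c) w) (dot.rank1 n N (- ?d) z) (s(i := r))"
    by (rule dot.sampling_step[OF inv i(2) \<eta> w_def z_def x_def y_def a_def b_def K_def r_def])
  have "sample_state n m V Q \<eta> \<Psi> (Suc i) \<rho>7"
    unfolding sample_state_def
  proof (intro conjI exI)
    show "gram n (reals \<rho>7 5) {Suc i..<m} V" using G2 s3 s4 s5 s6 s7 by (simp add: same_def)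
    show "reals \<rho>7 15 0 = \<eta>" "reals \<rho>7 16 0 = \<eta> / (1 + \<eta>)" using e s04 s5 s6 s7 by (simp_all add: same_def)
    show "dot.sampling_inv n m V Q \<eta> \<Psi> (Suc i) (dot.rank1 n M (- ?c) w) (dot.rank1 n N (- ?d) z) (s(i := r))"
      by (rule inv')
    show "represents n (reals \<rho>7 3) (dot.rank1 n M (- ?c) w)" "represents n (reals \<rho>7 4) (dot.rank1 n N (- ?d) z)"
      using rM5 rN6 s6 s7 by (simp_all add: same_def)
    show "\<forall>j<Suc i. reals \<rho>7 8 j = (s(i := r)) j" using s8 d7 by simp
  qed
  moreover have "same {3, 4, 5, 6, 7, 8, 10, 11, 12, 13, 14, 17} {10, 11} \<sigma> \<rho>7"
    using s04 s5 s6 s7 by (auto simp: same_def)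
  moreover have "t1 + (t2 + (t3 + (t4 + (t5 + (t6 + t7))))) \<le> 1000 * n\<^sup>2"
    using r1(2) r2(2) r3(2) r4(2) r5(2) r6(2) r7(2) n_le_square[OF n] n by linarith
  ultimately show ?thesis unfolding sample_body_def
    by (intro execI[OF run.Seq[OF r1(1) run.Seq[OF r2(1) run.Seq[OF r3(1) run.Seq[OF r4(1) run.Seq[OF r5(1) run.Seq[OF r6(1) r7(1)]]]]]]]) auto
qed

definition sample_prog :: com where
  "sample_prog = Seq init_prog
    (Seq (RStore 15 (NLit 0) (RDiv (rvar 0) (lit 2)))
    (Seq (RStore 16 (NLit 0) (RDiv r_eta (RAdd (lit 1) r_eta)))
    (Seq (scale_mat 4 (RDiv (lit 1) r_eta) 3)
    (Seq (scale_mat 3 (RDiv (lit 1) r_eta) 3) (For 2 1 sample_body)))))"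

lemma exec_sample:
  assumes l: "layout n m \<sigma>" and V: "vectors n m \<sigma> V" and \<epsilon>: "reals \<sigma> 0 0 = \<epsilon>" "0 < \<epsilon>" "\<epsilon> < 1"
  shows "exec sample_prog \<sigma> (3000 * (m * n\<^sup>2))
    (\<lambda>\<tau>. same {3, 4, 5, 6, 7, 8, 10, 11, 12, 13, 14, 15, 16, 17} {2, 10, 11} \<sigma> \<tau> \<and>
      (\<exists>s. (\<forall>j<m. reals \<tau> 8 j = s j) \<and> (\<forall>j. 0 \<le> s j) \<and> real (card {j. j < m \<and> s j \<noteq> 0}) \<le> 12 * real n / \<epsilon>\<^sup>2 \<and>
        (\<forall>x. (1 - \<epsilon>) * (\<Sum>j<m. (dot n (V j) x)\<^sup>2) \<le> (\<Sum>j<m. s j * (dot n (V j) x)\<^sup>2) \<and>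
             (\<Sum>j<m. s j * (dot n (V j) x)\<^sup>2) \<le> (1 + \<epsilon>) * (\<Sum>j<m. (dot n (V j) x)\<^sup>2))))"
proof -
  have n: "1 \<le> n" "n \<le> m" using l by (auto simp: layout_def)
  define \<eta> where "\<eta> = \<epsilon> / 2"
  have \<eta>: "0 < \<eta>" "\<eta> < 1" using \<epsilon> by (auto simp: \<eta>_def)
  obtain t1 \<rho>1 where r1: "run init_prog \<sigma> t1 \<rho>1" "t1 \<le> 1200 * (m * n\<^sup>2)"
    and s1: "same {3, 4, 5, 6, 7, 10, 11, 14} {2, 10, 11} \<sigma> \<rho>1" and st1: "init_state n V m \<rho>1"
    using exec_init[OF l V] by (auto simp: exec_def)
  obtain Q H where G: "gram n (reals \<rho>1 5) {..<m} V" and Q: "dot.projector_off n m V Q"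
    and H: "dot.inverse_pair n (dot.barrier n m V Q 1 (\<lambda>_. 1)) H"
    and rH: "represents n (reals \<rho>1 3) H" using st1 by (auto simp: init_state_def)
  have "exec (RStore 15 (NLit 0) (RDiv (rvar 0) (lit 2))) \<rho>1 (1 + ncost (NLit 0) + rcost (RDiv (rvar 0) (lit 2)))
      (\<lambda>\<tau>. same {15} {} \<rho>1 \<tau> \<and> reals \<tau> 15 0 = \<eta>)"
    using \<epsilon> s1 by (intro exec_RStore) (auto simp: same_def \<eta>_def)
  then obtain t2 \<rho>2 where r2: "run (RStore 15 (NLit 0) (RDiv (rvar 0) (lit 2))) \<rho>1 t2 \<rho>2" "t2 \<le> 10"
    and s2: "same {15} {} \<rho>1 \<rho>2" and d2: "reals \<rho>2 15 0 = \<eta>" by (auto simp: exec_def)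
  have "exec (RStore 16 (NLit 0) (RDiv r_eta (RAdd (lit 1) r_eta))) \<rho>2 (1 + ncost (NLit 0) + rcost (RDiv r_eta (RAdd (lit 1) r_eta)))
      (\<lambda>\<tau>. same {16} {} \<rho>2 \<tau> \<and> reals \<tau> 16 0 = \<eta> / (1 + \<eta>))"
    using d2 by (intro exec_RStore) (auto simp: same_def)
  then obtain t3 \<rho>3 where r3: "run (RStore 16 (NLit 0) (RDiv r_eta (RAdd (lit 1) r_eta))) \<rho>2 t3 \<rho>3" "t3 \<le> 10"
    and s3: "same {16} {} \<rho>2 \<rho>3" and d3: "reals \<rho>3 16 0 = \<eta> / (1 + \<eta>)" by (auto simp: exec_def)
  have s03: "same {3, 4, 5, 6, 7, 10, 11, 14, 15, 16} {2, 10, 11} \<sigma> \<rho>3" using s1 s2 s3 by (auto simp: same_def)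
  have l3: "layout n m \<rho>3" and rH3: "represents n (reals \<rho>3 3) H" and d3': "reals \<rho>3 15 0 = \<eta>"
    using layout_same[OF l s03] rH s2 s3 d2 by (auto simp: same_def)
  obtain t4 \<rho>4 where r4: "run (scale_mat 4 (RDiv (lit 1) r_eta) 3) \<rho>3 t4 \<rho>4" "t4 \<le> 100 * n\<^sup>2"
    and s4: "same {4} {10, 11} \<rho>3 \<rho>4" and rN4: "represents n (reals \<rho>4 4) (\<lambda>x. (1 / \<eta>) *\<^sub>R H x)"
    using exec_scale_mat[OF l3 rH3, of 4 "RDiv (lit 1) r_eta" "1 / \<eta>"] d3' by (auto simp: exec_def same_def)
  have l4: "layout n m \<rho>4" and rH4: "represents n (reals \<rho>4 3) H"
    using layout_same[OF l3 s4] rH3 s4 by (auto simp: same_def)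
  obtain t5 \<rho>5 where r5: "run (scale_mat 3 (RDiv (lit 1) r_eta) 3) \<rho>4 t5 \<rho>5" "t5 \<le> 100 * n\<^sup>2"
    and s5: "same {3} {10, 11} \<rho>4 \<rho>5" and rM5: "represents n (reals \<rho>5 3) (\<lambda>x. (1 / \<eta>) *\<^sub>R H x)"
    using exec_scale_mat[OF l4 rH4, of 3 "RDiv (lit 1) r_eta" "1 / \<eta>"] d3' s4 by (auto simp: exec_def same_def)
  let ?R = "{3, 4, 5, 6, 7, 8, 10, 11, 12, 13, 14, 15, 16, 17} :: nat set"
  have s05: "same ?R {2, 10, 11} \<sigma> \<rho>5" using s03 s4 s5 by (auto simp: same_def)
  define \<Psi> where "\<Psi> = 2 * real n / \<eta>"
  have inv: "dot.sampling_inv n m V Q \<eta> \<Psi> 0 (\<lambda>x. (1 / \<eta>) *\<^sub>R H x) (\<lambda>x. (1 / \<eta>) *\<^sub>R H x) (\<lambda>_. 0)"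
    unfolding \<Psi>_def by (rule dot.sampling_inv_init[OF H dot.trace_le_dim[OF Q H] \<eta>(1)])
  have st5: "sample_state n m V Q \<eta> \<Psi> 0 \<rho>5"
    unfolding sample_state_def
  proof (intro conjI exI)
    show "gram n (reals \<rho>5 5) {0..<m} V" using G s2 s3 s4 s5 by (simp add: same_def atLeast0LessThan)
    show "reals \<rho>5 15 0 = \<eta>" "reals \<rho>5 16 0 = \<eta> / (1 + \<eta>)" using d3 d3' s4 s5 by (simp_all add: same_def)
    show "represents n (reals \<rho>5 4) (\<lambda>x. (1 / \<eta>) *\<^sub>R H x)" using rN4 s5 by (simp add: same_def)
  qed (use inv rM5 in auto)
  have "exec (For 2 1 sample_body) \<rho>5 (m * (1000 * n\<^sup>2 + 21))
     (\<lambda>\<tau>. same ?R {2, 10, 11} \<sigma> \<tau> \<and> sample_state n m V Q \<eta> \<Psi> m \<tau>)"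
  proof (rule exec_For_const[where I = "\<lambda>i \<tau>. same ?R {2, 10, 11} \<sigma> \<tau> \<and> sample_state n m V Q \<eta> \<Psi> i \<tau>"])
    fix i \<tau> assume a: "i < m" "same ?R {2, 10, 11} \<sigma> \<tau> \<and> sample_state n m V Q \<eta> \<Psi> i \<tau>" "nats \<tau> 2 0 = i"
    have "layout n m \<tau>" "vectors n m \<tau> V" using layout_same[OF l] vectors_same[OF V] a by auto
    from exec_sample_body[OF this a(3,1) _ \<eta>] a(2,3)
    have "exec sample_body \<tau> (1000 * n\<^sup>2)
      (\<lambda>\<rho>. same {3, 4, 5, 6, 7, 8, 10, 11, 12, 13, 14, 17} {10, 11} \<tau> \<rho> \<and> sample_state n m V Q \<eta> \<Psi> (Suc i) \<rho>)"
      by auto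
    then show "exec sample_body \<tau> (1000 * n\<^sup>2)
      (\<lambda>\<rho>. nats \<rho> 2 0 = i \<and> same ?R {2, 10, 11} \<sigma> (set_nvar 2 (Suc i) \<rho>) \<and> sample_state n m V Q \<eta> \<Psi> (Suc i) (set_nvar 2 (Suc i) \<rho>))"
      by (rule exec_mono) (use a in \<open>auto simp: same_def sample_state_def\<close>)
  next
    show "nats \<tau> 0 1 = m" if "same ?R {2, 10, 11} \<sigma> \<tau> \<and> sample_state n m V Q \<eta> \<Psi> i \<tau>" for i \<tau>
      using that l by (auto simp: same_def layout_def)
  qed (use s05 st5 n in \<open>auto simp: same_def sample_state_def\<close>)
  then obtain t6 \<rho>6 where r6: "run (For 2 1 sample_body) \<rho>5 t6 \<rho>6" "t6 \<le> m * (1000 * n\<^sup>2 + 21)"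
    and s6: "same ?R {2, 10, 11} \<sigma> \<rho>6" and st6: "sample_state n m V Q \<eta> \<Psi> m \<rho>6"
    by (auto simp: exec_def)
  obtain M N s where fin: "dot.sampling_inv n m V Q \<eta> \<Psi> m M N s" and s8: "\<forall>j<m. reals \<rho>6 8 j = s j"
    using st6 by (auto simp: sample_state_def)
  have "\<eta> / (1 + \<eta>) * real (card {j. j < m \<and> s j \<noteq> 0}) \<le> 2 * real n / \<eta>"
    using dot.sampling_inv_final(3)[OF fin Q \<eta>(1)] by (simp add: \<Psi>_def)
  then have "real (card {j. j < m \<and> s j \<noteq> 0}) \<le> 2 * real n / \<eta> * ((1 + \<eta>) / \<eta>)"
    using \<eta> by (simp add: field_simps)
  \<comment> \<open>Substitution of \<open>\<eta> = \<epsilon> / 2\<close>, which turns the accuracy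
    \<open>1 \<plusminus> 2 * \<eta>\<close> into \<open>1 \<plusminus> \<epsilon>\<close>; the
    constant 12 then comes from \<epsilon> < 1.\<close>
  also have "\<dots> = (8 + 4 * \<epsilon>) * real n / \<epsilon>\<^sup>2" using \<epsilon> by (simp add: \<eta>_def field_simps power2_eq_square)
  also have "\<dots> \<le> 12 * real n / \<epsilon>\<^sup>2" using \<epsilon> by (intro divide_right_mono mult_right_mono) auto
  finally have card: "real (card {j. j < m \<and> s j \<noteq> 0}) \<le> 12 * real n / \<epsilon>\<^sup>2" .
  show ?thesis unfolding sample_prog_def
  proof (rule execI[OF run.Seq[OF r1(1) run.Seq[OF r2(1) run.Seq[OF r3(1) run.Seq[OF r4(1) run.Seq[OF r5(1) r6(1)]]]]]])
    have "1 * n\<^sup>2 \<le> m * n\<^sup>2" using n by (intro mult_right_mono) auto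
    moreover have "m * 1 \<le> m * n\<^sup>2" using n by (intro mult_left_mono) auto
    moreover have "m * (1000 * n\<^sup>2 + 21) = 1000 * (m * n\<^sup>2) + 21 * m" by (simp add: algebra_simps)
    ultimately show "t1 + (t2 + (t3 + (t4 + (t5 + t6)))) \<le> 3000 * (m * n\<^sup>2)"
      using r1(2) r2(2) r3(2) r4(2) r5(2) r6(2) n by linarith
    show "same ?R {2, 10, 11} \<sigma> \<rho>6 \<and>
      (\<exists>s. (\<forall>j<m. reals \<rho>6 8 j = s j) \<and> (\<forall>j. 0 \<le> s j) \<and> real (card {j. j < m \<and> s j \<noteq> 0}) \<le> 12 * real n / \<epsilon>\<^sup>2 \<and>
        (\<forall>x. (1 - \<epsilon>) * (\<Sum>j<m. (dot n (V j) x)\<^sup>2) \<le> (\<Sum>j<m. s j * (dot n (V j) x)\<^sup>2) \<and>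
             (\<Sum>j<m. s j * (dot n (V j) x)\<^sup>2) \<le> (1 + \<epsilon>) * (\<Sum>j<m. (dot n (V j) x)\<^sup>2)))"
    proof (intro conjI exI[of _ s] allI)
      fix x
      show "(1 - \<epsilon>) * (\<Sum>j<m. (dot n (V j) x)\<^sup>2) \<le> (\<Sum>j<m. s j * (dot n (V j) x)\<^sup>2)"
        "(\<Sum>j<m. s j * (dot n (V j) x)\<^sup>2) \<le> (1 + \<epsilon>) * (\<Sum>j<m. (dot n (V j) x)\<^sup>2)"
        using dot.sampling_inv_final(1,2)[OF fin Q \<eta>(1), of x] by (simp_all add: \<eta>_def)
      show "0 \<le> s j" for j using fin by (simp add: dot.sampling_inv_def)
    qed (use s6 s8 card in auto)
  qed
qed

section \<open>Barrier method program\<close>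

abbreviation r_eps :: rexp where "r_eps \<equiv> rvar 0"
abbreviation r_n :: rexp where "r_n \<equiv> RNat (NLoad 0 (NLit 0))"
abbreviation r_q :: rexp where "r_q \<equiv> RNat (nvar 3)"
abbreviation r_fshift :: rexp where "r_fshift \<equiv> RDiv (rvar 18) (RAdd (lit 1) (RMul (rvar 18) (rvar 10)))"
abbreviation r_gshift :: rexp where "r_gshift \<equiv> RSub (lit 0) (RDiv (lit 1) (RSub (lit 1) (rvar 11)))"
abbreviation active :: bexp where "active \<equiv> RLess (lit 0) (RLoad 8 (nvar 2))"

text \<open>A vector not taken by the sampling pass has been rescaled to 0 and its updates would be
  trivial. Skipping it leaves a constant cost, so a round pays \<open>n\<^sup>2\<close> only for the
  sampled vectors.\<close>

definition shift_body :: com where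
  "shift_body = Cond active
     (Seq products_prog (Seq (rank_upd 3 r_fshift (vec_j 6) (vec_k 6)) (rank_upd 4 r_gshift (vec_j 7) (vec_k 7)))) Skip"

lemma exec_shift_body:
  assumes l: "layout n m \<sigma>" and V: "vectors n m \<sigma> V" and i: "nats \<sigma> 2 0 = i" "i < m"
    and M: "represents n (reals \<sigma> 3) M" and N: "represents n (reals \<sigma> 4) N"
    and inv: "dot.shift_inv n m V Q \<beta> \<gamma> u l' \<delta> g i M N" and \<delta>: "0 \<le> \<delta>" "reals \<sigma> 18 0 = \<delta>"
    and s: "reals \<sigma> 8 i = s" "0 \<le> s" "s = 0 \<Longrightarrow> V i = 0"
  shows "exec shift_body \<sigma> ((if s \<noteq> 0 then 500 * n\<^sup>2 else 0) + 20)
    (\<lambda>\<tau>. same {3, 4, 6, 7, 10, 11, 14} {10, 11} \<sigma> \<tau> \<and>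
      (\<exists>M N. dot.shift_inv n m V Q \<beta> \<gamma> u l' \<delta> g (Suc i) M N \<and> represents n (reals \<tau> 3) M \<and> represents n (reals \<tau> 4) N))"
    (is "exec _ _ _ ?P")
proof -
  have Vi: "supported n (V i)" and n: "1 \<le> n" using V i l by (auto simp: vectors_def layout_def)
  have inv': "dot.shift_inv n m V Q \<beta> \<gamma> u l' \<delta> g (Suc i)
    (dot.rank1 n M (- (\<delta> / (1 + \<delta> * dot n (V i) (M (V i))))) (M (V i)))
    (dot.rank1 n N (1 / (1 - dot n (V i) (N (V i)))) (N (V i)))"
    by (rule dot.shift_inv_step[OF inv i(2) \<delta>(1) refl refl refl refl])
  show ?thesis
  proof (cases "s = 0")
    case True
    \<comment> \<open>For the zero vector both rank-one updates are the identity, so the invariant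
      advances with \<open>M\<close> and \<open>N\<close> unchanged.\<close>
    have "M 0 = 0" "N 0 = 0" using M N by (auto simp: represents_def linear_0)
    then have "dot.shift_inv n m V Q \<beta> \<gamma> u l' \<delta> g (Suc i) M N" using inv' s(3)[OF True] by simp
    then have "?P \<sigma>" using M N by auto
    moreover have "\<not> bval active \<sigma>" using True s i by simp
    ultimately have "exec shift_body \<sigma> (1 + bcost active + 1) ?P"
      unfolding shift_body_def by (intro exec_Cond exec_Skip) auto
    then show ?thesis by (rule exec_mono) auto
  next
    case False
    define w where "w = M (V i)"
    define z where "z = N (V i)"
    define x where "x = dot n (V i) w"
    define y where "y = dot n (V i) z"
    have sw: "supported n w" "supported n z"
      using supported_represents[OF M Vi] supported_represents[OF N Vi] by (auto simp: w_def z_def)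
    obtain t1 \<rho>1 where r1: "run products_prog \<sigma> t1 \<rho>1" "t1 \<le> 232 * n\<^sup>2"
      and s1: "same {6, 7, 10, 11, 14} {10, 11} \<sigma> \<rho>1"
      and d1: "\<forall>j<n. reals \<rho>1 6 j = w j" "\<forall>j<n. reals \<rho>1 7 j = z j" "reals \<rho>1 10 0 = x" "reals \<rho>1 11 0 = y"
      using exec_products[OF l V i M N] unfolding w_def z_def x_def y_def by (auto simp: exec_def)
    have l1: "layout n m \<rho>1" and M1: "represents n (reals \<rho>1 3) M" and \<delta>1: "reals \<rho>1 18 0 = \<delta>"
      using layout_same[OF l s1] M \<delta> s1 by (auto simp: same_def)
    obtain t2 \<rho>2 where r2: "run (rank_upd 3 r_fshift (vec_j 6) (vec_k 6)) \<rho>1 t2 \<rho>2" "t2 \<le> 87 * n\<^sup>2"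
      and s2: "same {3} {10, 11} \<rho>1 \<rho>2" and M2: "represents n (reals \<rho>2 3) (dot.rank1 n M (- (\<delta> / (1 + \<delta> * x))) w)"
      using exec_rank_upd_represents[OF l1 M1 sw(1), of r_fshift "\<delta> / (1 + \<delta> * x)" "vec_j 6" "vec_k 6"] d1 \<delta>1
      by (auto simp: exec_def same_def)
    have l2: "layout n m \<rho>2" and N2: "represents n (reals \<rho>2 4) N"
      using layout_same[OF l1 s2] N s1 s2 by (auto simp: same_def)
    obtain t3 \<rho>3 where r3: "run (rank_upd 4 r_gshift (vec_j 7) (vec_k 7)) \<rho>2 t3 \<rho>3" "t3 \<le> 87 * n\<^sup>2"
      and s3: "same {4} {10, 11} \<rho>2 \<rho>3" and N3: "represents n (reals \<rho>3 4) (dot.rank1 n N (- (0 - 1 / (1 - y))) z)"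
      using exec_rank_upd_represents[OF l2 N2 sw(2), of r_gshift "0 - 1 / (1 - y)" "vec_j 7" "vec_k 7"] d1 s2
      by (auto simp: exec_def same_def)
    have "?P \<rho>3" using inv' M2 N3 s1 s2 s3 unfolding w_def[symmetric] z_def[symmetric] x_def[symmetric] y_def[symmetric]
      by (auto simp: same_def intro!: exI)
    then have "exec (Seq products_prog (Seq (rank_upd 3 r_fshift (vec_j 6) (vec_k 6)) (rank_upd 4 r_gshift (vec_j 7) (vec_k 7)))) \<sigma> (500 * n\<^sup>2) ?P"
      by (intro execI[OF run.Seq[OF r1(1) run.Seq[OF r2(1) r3(1)]]]) (use r1(2) r2(2) r3(2) in auto)
    then have "exec shift_body \<sigma> (1 + bcost active + 500 * n\<^sup>2) ?P"
      unfolding shift_body_def using False s i by (intro exec_Cond) auto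
    then show ?thesis by (rule exec_mono) (use False in auto)
  qed
qed

abbreviation r_U :: rexp where "r_U \<equiv> RAdd (RDiv (rvar 12) (RSub (rvar 19) (rvar 21))) (rvar 10)"
abbreviation r_L :: rexp where "r_L \<equiv> RSub (RDiv (rvar 13) (RSub (rvar 22) (rvar 20))) (rvar 11)"
abbreviation r_fsel :: rexp where "r_fsel \<equiv> RSub (lit 0) (RDiv (lit 1) (RSub (rvar 23) (rvar 10)))"
abbreviation r_gsel :: rexp where "r_gsel \<equiv> RDiv (lit 1) (RAdd (rvar 23) (rvar 11))"
abbreviation accept :: bexp where "accept \<equiv> BAnd (RLess (lit 0) (rvar 23)) (BNot (RLess (rvar 24) (rvar 23)))"
abbreviation r_acc :: rexp where "r_acc \<equiv> RAdd (RLoad 2 (nvar 2)) (RDiv (lit 1) (rvar 23))"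

definition select_upd :: com where
  "select_upd = Seq (rank_upd 3 r_fsel (vec_j 6) (vec_k 6)) (Seq (rank_upd 4 r_gsel (vec_j 7) (vec_k 7))
     (Seq (RStore 2 (nvar 2) r_acc) (NStore 4 (NLit 0) (NLit 1))))"

definition select_body :: com where
  "select_body = Cond (BAnd (NLess (nvar 4) (NLit 1)) active)
     (Seq products_prog (Seq forms_prog (Seq (RStore 23 (NLit 0) r_U) (Seq (RStore 24 (NLit 0) r_L) (Cond accept select_upd Skip)))))
     Skip"

definition cols_state where
  "cols_state n m \<tau> M N g \<longleftrightarrow>
    represents n (reals \<tau> 3) M \<and> represents n (reals \<tau> 4) N \<and> (\<forall>j<m. reals \<tau> 2 j = g j)"

lemma cols_state_same: "cols_state n m \<sigma> M N g \<Longrightarrow> same R S \<sigma> \<tau> \<Longrightarrow> R \<inter> {2, 3, 4} = {} \<Longrightarrow> cols_state n m \<tau> M N g"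
  unfolding cols_state_def same_def by (metis disjoint_iff insertCI)

text \<open>\<open>Done\<close> is what has to hold for the operators and weights once an index has been accepted.\<close>

lemma exec_select_body:
  fixes M N g V i
  defines "w \<equiv> M (V i)" and "z \<equiv> N (V i)"
  assumes l: "layout n m \<sigma>" and V: "vectors n m \<sigma> V" and i: "nats \<sigma> 2 0 = i" "i < m"
    and G: "gram n (reals \<sigma> 5) {..<m} V" and C: "cols_state n m \<sigma> M N g" and f0: "nats \<sigma> 4 0 = 0"
    and D: "reals \<sigma> 19 0 - reals \<sigma> 21 0 = DX" "reals \<sigma> 22 0 - reals \<sigma> 20 0 = DY"
    and U: "U = (\<Sum>j<m. (dot n (V j) w)\<^sup>2) / DX + dot n (V i) w"
    and L: "L = (\<Sum>j<m. (dot n (V j) z)\<^sup>2) / DY - dot n (V i) z"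
    and s: "reals \<sigma> 8 i = s" "0 \<le> s" "s = 0 \<Longrightarrow> V i = 0"
    and dn: "0 < U \<Longrightarrow> U \<le> L \<Longrightarrow> Done (dot.rank1 n M (1 / (U - dot n (V i) w)) w)
      (dot.rank1 n N (- (1 / (U + dot n (V i) z))) z) (g(i := g i + 1 / U))"
  shows "exec select_body \<sigma> ((if s \<noteq> 0 then 1000 * n\<^sup>2 else 0) + 20)
    (\<lambda>\<tau>. same {2, 3, 4, 6, 7, 10, 11, 12, 13, 14, 23, 24} {4, 10, 11} \<sigma> \<tau> \<and>
      (nats \<tau> 4 0 = 0 \<and> cols_state n m \<tau> M N g \<and> (0 < U \<longrightarrow> \<not> U \<le> L) \<or>
       nats \<tau> 4 0 = 1 \<and> (\<exists>M N g. cols_state n m \<tau> M N g \<and> Done M N g)))"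
    (is "exec _ _ _ ?P")
proof -
  have Vi: "supported n (V i)" and n: "1 \<le> n" using V i l by (auto simp: vectors_def layout_def)
  have M: "represents n (reals \<sigma> 3) M" and N: "represents n (reals \<sigma> 4) N" using C by (auto simp: cols_state_def)
  show ?thesis
  proof (cases "s = 0")
    case True
    have "M 0 = 0" "N 0 = 0" using M N by (auto simp: represents_def linear_0)
    \<comment> \<open>The zero vector never satisfies \<open>0 < U\<close>, so skipping it agrees
      with the record of rejected candidates.\<close>
    then have "U = 0" using s(3)[OF True] by (simp add: U w_def)
    then have "?P \<sigma>" using C f0 by auto
    moreover have "\<not> bval active \<sigma>" using True s i by simp
    ultimately have "exec select_body \<sigma> (1 + bcost (BAnd (NLess (nvar 4) (NLit 1)) active) + 1) ?P"
      unfolding select_body_def by (intro exec_Cond exec_Skip) auto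
    then show ?thesis by (rule exec_mono) auto
  next
    case False
    define x where "x = dot n (V i) w"
    define y where "y = dot n (V i) z"
    define a where "a = (\<Sum>j<m. (dot n (V j) w)\<^sup>2)"
    define b where "b = (\<Sum>j<m. (dot n (V j) z)\<^sup>2)"
    have sw: "supported n w" "supported n z"
      using supported_represents[OF M Vi] supported_represents[OF N Vi] by (auto simp: w_def z_def)
    obtain t1 \<rho>1 where r1: "run products_prog \<sigma> t1 \<rho>1" "t1 \<le> 232 * n\<^sup>2"
      and s1: "same {6, 7, 10, 11, 14} {10, 11} \<sigma> \<rho>1"
      and d1: "\<forall>j<n. reals \<rho>1 6 j = w j" "\<forall>j<n. reals \<rho>1 7 j = z j" "reals \<rho>1 10 0 = x" "reals \<rho>1 11 0 = y"
      using exec_products[OF l V i M N] unfolding w_def z_def x_def y_def by (auto simp: exec_def)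
    have l1: "layout n m \<rho>1" and G1: "gram n (reals \<rho>1 5) {..<m} V"
      using layout_same[OF l s1] G s1 by (auto simp: same_def)
    obtain t2 \<rho>2 where r2: "run forms_prog \<rho>1 t2 \<rho>2" "t2 \<le> 150 * n\<^sup>2"
      and s2: "same {12, 13} {10, 11} \<rho>1 \<rho>2" and d2: "reals \<rho>2 12 0 = a" "reals \<rho>2 13 0 = b"
      using exec_forms[OF l1 G1, of w z] d1 unfolding a_def b_def by (auto simp: exec_def)
    have "exec (RStore 23 (NLit 0) r_U) \<rho>2 (1 + ncost (NLit 0) + rcost r_U) (\<lambda>\<tau>. same {23} {} \<rho>2 \<tau> \<and> reals \<tau> 23 0 = U)"
      using d1 d2 D s1 s2 by (intro exec_RStore) (auto simp: same_def U a_def x_def)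
    then obtain t3 \<rho>3 where r3: "run (RStore 23 (NLit 0) r_U) \<rho>2 t3 \<rho>3" "t3 \<le> 20"
      and s3: "same {23} {} \<rho>2 \<rho>3" and d3: "reals \<rho>3 23 0 = U" by (auto simp: exec_def)
    have "exec (RStore 24 (NLit 0) r_L) \<rho>3 (1 + ncost (NLit 0) + rcost r_L) (\<lambda>\<tau>. same {24} {} \<rho>3 \<tau> \<and> reals \<tau> 24 0 = L)"
      using d1 d2 D s1 s2 s3 by (intro exec_RStore) (auto simp: same_def L b_def y_def)
    then obtain t4 \<rho>4 where r4: "run (RStore 24 (NLit 0) r_L) \<rho>3 t4 \<rho>4" "t4 \<le> 20"
      and s4: "same {24} {} \<rho>3 \<rho>4" and d4: "reals \<rho>4 24 0 = L" by (auto simp: exec_def)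
    have s04: "same {6, 7, 10, 11, 12, 13, 14, 23, 24} {10, 11} \<sigma> \<rho>4" using s1 s2 s3 s4 by (auto simp: same_def)
    have l4: "layout n m \<rho>4" and C4: "cols_state n m \<rho>4 M N g" and i4: "nats \<rho>4 2 0 = i" and f4: "nats \<rho>4 4 0 = 0"
      using layout_same[OF l s04] cols_state_same[OF C s04] s04 i f0 by (auto simp: same_def)
    have w4: "\<forall>j<n. reals \<rho>4 6 j = w j" "\<forall>j<n. reals \<rho>4 7 j = z j" and
      x4: "reals \<rho>4 10 0 = x" "reals \<rho>4 11 0 = y" "reals \<rho>4 23 0 = U"
      using d1 d3 s2 s3 s4 by (auto simp: same_def)
    have "exec (Cond accept select_upd Skip) \<rho>4 (1 + bcost accept + 250 * n\<^sup>2) ?P"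
    proof (rule exec_Cond)
      assume "bval accept \<rho>4"
      then have acc: "0 < U" "U \<le> L" using x4 d4 by auto
      have M4: "represents n (reals \<rho>4 3) M" using C4 by (simp add: cols_state_def)
      obtain t5 \<rho>5 where r5: "run (rank_upd 3 r_fsel (vec_j 6) (vec_k 6)) \<rho>4 t5 \<rho>5" "t5 \<le> 87 * n\<^sup>2"
        and s5: "same {3} {10, 11} \<rho>4 \<rho>5" and M5: "represents n (reals \<rho>5 3) (dot.rank1 n M (- (0 - 1 / (U - x))) w)"
        using exec_rank_upd_represents[OF l4 M4 sw(1), of r_fsel "0 - 1 / (U - x)" "vec_j 6" "vec_k 6"] w4 x4
        by (auto simp: exec_def same_def)
      have l5: "layout n m \<rho>5" and N5: "represents n (reals \<rho>5 4) N"
        using layout_same[OF l4 s5] C4 s5 by (auto simp: same_def cols_state_def)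
      obtain t6 \<rho>6 where r6: "run (rank_upd 4 r_gsel (vec_j 7) (vec_k 7)) \<rho>5 t6 \<rho>6" "t6 \<le> 87 * n\<^sup>2"
        and s6: "same {4} {10, 11} \<rho>5 \<rho>6" and N6: "represents n (reals \<rho>6 4) (dot.rank1 n N (- (1 / (U + y))) z)"
        using exec_rank_upd_represents[OF l5 N5 sw(2), of r_gsel "1 / (U + y)" "vec_j 7" "vec_k 7"] w4 x4 s5
        by (auto simp: exec_def same_def)
      have "exec (RStore 2 (nvar 2) r_acc) \<rho>6 (1 + ncost (nvar 2) + rcost r_acc)
        (\<lambda>\<tau>. same {2} {} \<rho>6 \<tau> \<and> (\<forall>j<m. reals \<tau> 2 j = (g(i := g i + 1 / U)) j))"
        using i(2) i4 x4 C4 s5 s6 by (intro exec_RStore) (auto simp: same_def cols_state_def)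
      then obtain t7 \<rho>7 where r7: "run (RStore 2 (nvar 2) r_acc) \<rho>6 t7 \<rho>7" "t7 \<le> 20"
        and s7: "same {2} {} \<rho>6 \<rho>7" and d7: "\<forall>j<m. reals \<rho>7 2 j = (g(i := g i + 1 / U)) j"
        by (auto simp: exec_def)
      have "exec (NStore 4 (NLit 0) (NLit 1)) \<rho>7 (1 + ncost (NLit 0) + ncost (NLit 1))
        (\<lambda>\<tau>. same {} {4} \<rho>7 \<tau> \<and> nats \<tau> 4 0 = 1)" by (intro exec_NStore) (auto simp: same_def)
      then obtain t8 \<rho>8 where r8: "run (NStore 4 (NLit 0) (NLit 1)) \<rho>7 t8 \<rho>8" "t8 \<le> 20"
        and s8: "same {} {4} \<rho>7 \<rho>8" and d8: "nats \<rho>8 4 0 = 1"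
        by (auto simp: exec_def)
      have "cols_state n m \<rho>8 (dot.rank1 n M (1 / (U - dot n (V i) w)) w)
        (dot.rank1 n N (- (1 / (U + dot n (V i) z))) z) (g(i := g i + 1 / U))"
        using M5 N6 d7 s6 s7 s8 by (auto simp: cols_state_def same_def x_def y_def)
      with dn[OF acc] d8 have "?P \<rho>8" using s04 s5 s6 s7 s8 by (auto simp: same_def)
      moreover have "t5 + (t6 + (t7 + t8)) \<le> 250 * n\<^sup>2"
        using r5(2) r6(2) r7(2) r8(2) n n_le_square[OF n] by linarith
      ultimately show "exec select_upd \<rho>4 (250 * n\<^sup>2) ?P" unfolding select_upd_def
        by (intro execI[OF run.Seq[OF r5(1) run.Seq[OF r6(1) run.Seq[OF r7(1) r8(1)]]]])
    next
      assume "\<not> bval accept \<rho>4"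
      then have "?P \<rho>4" using x4 d4 f4 C4 s04 by (auto simp: same_def)
      then show "exec Skip \<rho>4 (250 * n\<^sup>2) ?P"
        using n by (intro exec_mono[OF exec_Skip[where P = ?P]]) auto
    qed
    then obtain t5 \<rho>5 where r5: "run (Cond accept select_upd Skip) \<rho>4 t5 \<rho>5" "t5 \<le> 20 + 250 * n\<^sup>2" "?P \<rho>5"
      unfolding exec_def by fastforce
    have "t1 + (t2 + (t3 + (t4 + t5))) \<le> 1000 * n\<^sup>2"
      using r1(2) r2(2) r3(2) r4(2) r5(2) n n_le_square[OF n] by linarith
    with r5(3) have "exec (Seq products_prog (Seq forms_prog (Seq (RStore 23 (NLit 0) r_U) (Seq (RStore 24 (NLit 0) r_L) (Cond accept select_upd Skip)))))
      \<sigma> (1000 * n\<^sup>2) ?P"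
      by (intro execI[OF run.Seq[OF r1(1) run.Seq[OF r2(1) run.Seq[OF r3(1) run.Seq[OF r4(1) r5(1)]]]]])
    then have "exec select_body \<sigma> (1 + bcost (BAnd (NLess (nvar 4) (NLit 1)) active) + 1000 * n\<^sup>2) ?P"
      unfolding select_body_def using False s i f0 by (intro exec_Cond) auto
    then show ?thesis by (rule exec_mono) (use False in auto)
  qed
qed

lemma exec_select_body_skip:
  assumes "nats \<sigma> 4 0 = 1"
  shows "exec select_body \<sigma> 20 (\<lambda>\<tau>. \<tau> = \<sigma>)"
proof -
  have "exec select_body \<sigma> (1 + bcost (BAnd (NLess (nvar 4) (NLit 1)) active) + 1) (\<lambda>\<tau>. \<tau> = \<sigma>)"
    unfolding select_body_def using assms by (intro exec_Cond exec_Skip) auto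
  then show ?thesis by (rule exec_mono) auto
qed

text \<open>The number of turns is bounded by what the guard implies about the counter, not by a
  computed limit: the program cannot round real numbers to integers. The additional turn in
  \<open>Suc N - j\<close> pays for the failing test.\<close>

lemma exec_While:
  assumes "I j \<sigma>" "j \<le> N"
    and step: "\<And>k \<tau>. I k \<tau> \<Longrightarrow> bval b \<tau> \<Longrightarrow> exec c \<tau> T (I (Suc k))"
    and bound: "\<And>k \<tau>. I k \<tau> \<Longrightarrow> bval b \<tau> \<Longrightarrow> k < N"
  shows "exec (While b c) \<sigma> ((Suc N - j) * (T + 1 + bcost b)) (\<lambda>\<tau>. \<exists>k\<le>N. I k \<tau> \<and> \<not> bval b \<tau>)"
  using assms(2,1)
proof (induction j arbitrary: \<sigma> rule: inc_induct)
  case base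
  then have "\<not> bval b \<sigma>" using bound by blast
  then show ?case using base by (intro execI[OF run.WhileFalse]) auto
next
  case (step j)
  show ?case
  proof (cases "bval b \<sigma>")
    case True
    obtain t \<rho> where 1: "run c \<sigma> t \<rho>" "t \<le> T" "I (Suc j) \<rho>"
      using assms(3)[OF step.prems True] by (auto simp: exec_def)
    obtain u \<tau> where 2: "run (While b c) \<rho> u \<tau>" "u \<le> (Suc N - Suc j) * (T + 1 + bcost b)" "\<exists>k\<le>N. I k \<tau> \<and> \<not> bval b \<tau>"
      using step.IH[OF 1(3)] by (auto simp: exec_def)
    have "Suc N - j = Suc (Suc N - Suc j)" using step.hyps by simp
    then show ?thesis using 1(2) 2(2,3) by (intro execI[OF run.WhileTrue[OF True 1(1) 2(1)]]) auto
  next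
    case False
    have "1 + bcost b \<le> (Suc N - j) * (T + 1 + bcost b)" using step.hyps by (simp add: Suc_diff_le)
    moreover have "\<exists>k\<le>N. I k \<sigma> \<and> \<not> bval b \<sigma>"
      using False step.prems step.hyps by (auto intro!: exI[of _ j])
    ultimately show ?thesis by (rule execI[OF run.WhileFalse[OF False]])
  qed
qed

section \<open>Rounds of the barrier method: shift loop and selection loop\<close>

definition bss_mem where
  "bss_mem n m W s \<delta> \<sigma> \<longleftrightarrow> layout n m \<sigma> \<and> vectors n m \<sigma> W \<and> gram n (reals \<sigma> 5) {..<m} W \<and>
     (\<forall>j<m. reals \<sigma> 8 j = s j) \<and> reals \<sigma> 18 0 = \<delta>"

lemma bss_mem_same:
  "bss_mem n m W s \<delta> \<sigma> \<Longrightarrow> same R S \<sigma> \<tau> \<Longrightarrow> R \<inter> {1, 5, 8, 18} = {} \<Longrightarrow> S \<inter> {0, 1} = {} \<Longrightarrow> bss_mem n m W s \<delta> \<tau>"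
  unfolding bss_mem_def using layout_same[of n m \<sigma> R S \<tau>] vectors_same[of n m \<sigma> W R S \<tau>] sameD(1)[of R S \<sigma> \<tau>] by auto

definition support_size :: "nat \<Rightarrow> (nat \<Rightarrow> real) \<Rightarrow> nat" where
  "support_size m s = card {j. j < m \<and> s j \<noteq> 0}"

text \<open>Here 20 is the allowance for the activity test of a turn and 12 the loop overhead; the
  cost \<open>A\<close> falls on vectors of nonzero weight only.\<close>

lemma sum_active:
  "(\<Sum>k<m. (if s k \<noteq> 0 then A else 0) + 20 + 12) = A * support_size m s + 32 * m"
proof -
  have "{..<m} \<inter> {k. s k \<noteq> 0} = {j. j < m \<and> s j \<noteq> 0}" by auto
  then show ?thesis by (simp add: sum.distrib support_size_def sum.If_cases)
qed

lemma exec_shift_loop: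
  assumes B: "bss_mem n m W s \<delta> \<sigma>" and s: "\<And>j. 0 \<le> s j" "\<And>j. s j = 0 \<Longrightarrow> W j = 0" and \<delta>: "0 \<le> \<delta>"
    and C: "cols_state n m \<sigma> M N g" and inv: "dot.bss_inv n m W Q \<beta> \<gamma> E F u l M N g" and F: "F < 1"
  shows "exec (For 2 1 shift_body) \<sigma> (500 * n\<^sup>2 * support_size m s + 32 * m + 9)
    (\<lambda>\<tau>. same {3, 4, 6, 7, 10, 11, 14} {2, 10, 11} \<sigma> \<tau> \<and>
      (\<exists>M1 N1. dot.shift_inv n m W Q \<beta> \<gamma> u l \<delta> g m M1 N1 \<and> cols_state n m \<tau> M1 N1 g))"
proof -
  let ?I = "\<lambda>i \<tau>. same {3, 4, 6, 7, 10, 11, 14} {2, 10, 11} \<sigma> \<tau> \<and>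
      (\<exists>M1 N1. dot.shift_inv n m W Q \<beta> \<gamma> u l \<delta> g i M1 N1 \<and> cols_state n m \<tau> M1 N1 g)"
  have "exec (For 2 1 shift_body) \<sigma> ((\<Sum>k<m. (if s k \<noteq> 0 then 500 * n\<^sup>2 else 0) + 20 + 12) + 9) (?I m)"
  proof (rule exec_For[where I = ?I])
    have "cols_state n m (set_nvar 2 0 \<sigma>) M N g" using C by (simp add: cols_state_def)
    then show "?I 0 (set_nvar 2 0 \<sigma>)" using dot.shift_inv_init[OF inv F] by (auto simp: same_def)
  next
    fix i \<tau> assume i: "i < m" "nats \<tau> 2 0 = i" and I: "?I i \<tau>"
    then obtain M1 N1 where S1: "dot.shift_inv n m W Q \<beta> \<gamma> u l \<delta> g i M1 N1" and C1: "cols_state n m \<tau> M1 N1 g" by auto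
    have B1: "bss_mem n m W s \<delta> \<tau>" using bss_mem_same[OF B] I by auto
    have "exec shift_body \<tau> ((if s i \<noteq> 0 then 500 * n\<^sup>2 else 0) + 20)
      (\<lambda>\<rho>. same {3, 4, 6, 7, 10, 11, 14} {10, 11} \<tau> \<rho> \<and>
      (\<exists>M N. dot.shift_inv n m W Q \<beta> \<gamma> u l \<delta> g (Suc i) M N \<and> represents n (reals \<rho> 3) M \<and> represents n (reals \<rho> 4) N))"
      by (rule exec_shift_body[OF _ _ i(2,1) _ _ S1 \<delta> _ _ s(1) s(2)])
        (use B1 C1 i in \<open>auto simp: bss_mem_def cols_state_def\<close>)
    then show "exec shift_body \<tau> ((if s i \<noteq> 0 then 500 * n\<^sup>2 else 0) + 20)
      (\<lambda>\<rho>. nats \<rho> 2 0 = i \<and> ?I (Suc i) (set_nvar 2 (Suc i) \<rho>))"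
    proof (rule exec_mono)
      fix \<rho> assume "same {3, 4, 6, 7, 10, 11, 14} {10, 11} \<tau> \<rho> \<and>
        (\<exists>M N. dot.shift_inv n m W Q \<beta> \<gamma> u l \<delta> g (Suc i) M N \<and> represents n (reals \<rho> 3) M \<and> represents n (reals \<rho> 4) N)"
      then obtain M2 N2 where s\<rho>: "same {3, 4, 6, 7, 10, 11, 14} {10, 11} \<tau> \<rho>"
        and S2: "dot.shift_inv n m W Q \<beta> \<gamma> u l \<delta> g (Suc i) M2 N2"
        and R2: "represents n (reals \<rho> 3) M2" "represents n (reals \<rho> 4) N2" by auto
      have "cols_state n m (set_nvar 2 (Suc i) \<rho>) M2 N2 g" using R2 C1 s\<rho> by (auto simp: cols_state_def same_def)
      with S2 s\<rho> I i show "nats \<rho> 2 0 = i \<and> ?I (Suc i) (set_nvar 2 (Suc i) \<rho>)"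
        by (auto simp: same_def)
    qed simp
  next
    show "nats \<tau> 0 1 = m" if "?I k \<tau>" for k \<tau>
      using that B by (auto simp: same_def bss_mem_def layout_def)
  qed auto
  then show ?thesis unfolding sum_active by (rule exec_mono) auto
qed

text \<open>While the flag is 0, nothing has been changed and all earlier candidates have failed;
  once it is 1, later turns do nothing. If the flag is still 0 at the end, every candidate has
  failed, which is the hypothesis of \<open>fail\<close>.\<close>

lemma exec_select_loop:
  fixes W :: "nat \<Rightarrow> nat \<Rightarrow> real" and n m M N DX DY
  defines "U \<equiv> \<lambda>i. (\<Sum>j<m. (dot n (W j) (M (W i)))\<^sup>2) / DX + dot n (W i) (M (W i))"
    and "L \<equiv> \<lambda>i. (\<Sum>j<m. (dot n (W j) (N (W i)))\<^sup>2) / DY - dot n (W i) (N (W i))"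
  assumes B: "bss_mem n m W s \<delta> \<sigma>" and s: "\<And>j. 0 \<le> s j" "\<And>j. s j = 0 \<Longrightarrow> W j = 0"
    and C: "cols_state n m \<sigma> M N g" and f0: "nats \<sigma> 4 0 = 0"
    and D: "reals \<sigma> 19 0 - reals \<sigma> 21 0 = DX" "reals \<sigma> 22 0 - reals \<sigma> 20 0 = DY"
    and dn: "\<And>i. i < m \<Longrightarrow> 0 < U i \<Longrightarrow> U i \<le> L i \<Longrightarrow> Done (dot.rank1 n M (1 / (U i - dot n (W i) (M (W i)))) (M (W i)))
      (dot.rank1 n N (- (1 / (U i + dot n (W i) (N (W i))))) (N (W i))) (g(i := g i + 1 / U i))"
    and fail: "(\<And>i. i < m \<Longrightarrow> 0 < U i \<Longrightarrow> \<not> U i \<le> L i) \<Longrightarrow> Done M N g"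
  shows "exec (For 2 1 select_body) \<sigma> (1000 * n\<^sup>2 * support_size m s + 32 * m + 9)
    (\<lambda>\<tau>. same {2, 3, 4, 6, 7, 10, 11, 12, 13, 14, 23, 24} {2, 4, 10, 11} \<sigma> \<tau> \<and> (\<exists>M N g. cols_state n m \<tau> M N g \<and> Done M N g))"
proof -
  let ?R = "{2, 3, 4, 6, 7, 10, 11, 12, 13, 14, 23, 24} :: nat set"
  let ?I = "\<lambda>i \<tau>. same ?R {2, 4, 10, 11} \<sigma> \<tau> \<and>
      (nats \<tau> 4 0 = 0 \<and> cols_state n m \<tau> M N g \<and> (\<forall>j<i. 0 < U j \<longrightarrow> \<not> U j \<le> L j) \<or>
       nats \<tau> 4 0 = 1 \<and> (\<exists>M N g. cols_state n m \<tau> M N g \<and> Done M N g))"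
  have cs: "cols_state n m (set_nvar 2 i \<tau>) M N g = cols_state n m \<tau> M N g" for i \<tau> M N g
    by (simp add: cols_state_def)
  have "exec (For 2 1 select_body) \<sigma> ((\<Sum>k<m. (if s k \<noteq> 0 then 1000 * n\<^sup>2 else 0) + 20 + 12) + 9) (?I m)"
  proof (rule exec_For[where I = ?I])
    show "?I 0 (set_nvar 2 0 \<sigma>)" using C f0 by (auto simp: same_def cs)
  next
    fix i \<tau> assume i: "i < m" "nats \<tau> 2 0 = i" and I: "?I i \<tau>"
    then have I1: "same ?R {2, 4, 10, 11} \<sigma> \<tau>" by blast
    show "exec select_body \<tau> ((if s i \<noteq> 0 then 1000 * n\<^sup>2 else 0) + 20)
      (\<lambda>\<rho>. nats \<rho> 2 0 = i \<and> ?I (Suc i) (set_nvar 2 (Suc i) \<rho>))"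
    proof (cases "nats \<tau> 4 0 = 1")
      case True
      from exec_select_body_skip[OF this] show ?thesis
        by (rule exec_mono) (use I i True in \<open>auto simp: same_def cs\<close>)
    next
      case False
      then have f: "nats \<tau> 4 0 = 0" and C1: "cols_state n m \<tau> M N g" and no: "\<forall>j<i. 0 < U j \<longrightarrow> \<not> U j \<le> L j"
        using I by auto
      have B1: "bss_mem n m W s \<delta> \<tau>" using bss_mem_same[OF B I1] by auto
      have D1: "reals \<tau> 19 0 - reals \<tau> 21 0 = DX" "reals \<tau> 22 0 - reals \<tau> 20 0 = DY"
        using D I1 by (auto simp: same_def)
      have "exec select_body \<tau> ((if s i \<noteq> 0 then 1000 * n\<^sup>2 else 0) + 20)
        (\<lambda>\<rho>. same ?R {4, 10, 11} \<tau> \<rho> \<and>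
          (nats \<rho> 4 0 = 0 \<and> cols_state n m \<rho> M N g \<and> (0 < U i \<longrightarrow> \<not> U i \<le> L i) \<or>
           nats \<rho> 4 0 = 1 \<and> (\<exists>M N g. cols_state n m \<rho> M N g \<and> Done M N g)))"
        by (rule exec_select_body[OF _ _ i(2,1) _ C1 f D1 _ _ _ s(1) s(2)])
          (use B1 i dn in \<open>auto simp: bss_mem_def U_def L_def\<close>)
      then show ?thesis
        by (rule exec_mono) (use I1 no i in \<open>auto simp: same_def cs less_Suc_eq\<close>)
    qed
  next
    show "nats \<tau> 0 1 = m" if "?I k \<tau>" for k \<tau>
    proof -
      have "same ?R {2, 4, 10, 11} \<sigma> \<tau>" using that by blast
      with B show ?thesis by (auto simp: same_def bss_mem_def layout_def)
    qed
  qed auto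
  then show ?thesis unfolding sum_active by (rule exec_mono) (use fail in auto)
qed

definition bss_body :: com where
  "bss_body = Seq (trace_prog 19 3) (Seq (trace_prog 20 4) (Seq (For 2 1 shift_body)
    (Seq (trace_prog 21 3) (Seq (trace_prog 22 4) (Seq (NStore 4 (NLit 0) (NLit 0))
    (Seq (For 2 1 select_body) (NStore 3 (NLit 0) (NAdd (nvar 3) (NLit 1)))))))))"

lemma exec_bss_body:
  assumes B: "bss_mem n m W s \<delta> \<sigma>" and s: "\<And>j. 0 \<le> s j" "\<And>j. s j = 0 \<Longrightarrow> W j = 0"
    and C: "cols_state n m \<sigma> M N g" and inv: "dot.bss_inv n m W Q \<beta> \<gamma> E F u l M N g"
    and F: "F < 1" and \<delta>: "0 < \<delta>" and EF: "0 \<le> E" "1 / \<delta> + E \<le> 1 - F"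
    and q: "nats \<sigma> 3 0 = q" and g: "support_size m g \<le> q"
  shows "exec bss_body \<sigma> (1500 * n\<^sup>2 * support_size m s + 100 * m + 400 * n\<^sup>2)
    (\<lambda>\<tau>. same {2, 3, 4, 6, 7, 10, 11, 12, 13, 14, 19, 20, 21, 22, 23, 24} {2, 3, 4, 10, 11} \<sigma> \<tau> \<and>
      nats \<tau> 3 0 = Suc q \<and> (\<exists>M N g. cols_state n m \<tau> M N g \<and>
        dot.bss_inv n m W Q \<beta> \<gamma> E F (u + \<delta>) (l + 1) M N g \<and> support_size m g \<le> Suc q))"
proof -
  have n: "1 \<le> n" "n \<le> m" using B by (auto simp: bss_mem_def layout_def)
  have tr: "\<exists>t \<rho>. run (trace_prog b a) \<tau> t \<rho> \<and> t \<le> 75 * n\<^sup>2 \<and> same {b} {10, 11} \<tau> \<rho> \<and>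
      reals \<rho> b 0 = (\<Sum>i<m. dot n (W i) (P (W i)))"
    if "bss_mem n m W s \<delta> \<tau>" "represents n (reals \<tau> a) P" "b \<noteq> a" "b \<noteq> 5" for \<tau> a b P
    using exec_trace[of n m \<tau> W a P b] that by (auto simp: bss_mem_def exec_def)
  have rM: "represents n (reals \<sigma> 3) M" using C by (simp add: cols_state_def)
  from tr[OF B rM, of 19]
  obtain t1 \<rho>1 where r1: "run (trace_prog 19 3) \<sigma> t1 \<rho>1" "t1 \<le> 75 * n\<^sup>2" and s1: "same {19} {10, 11} \<sigma> \<rho>1"
    and d1: "reals \<rho>1 19 0 = (\<Sum>i<m. dot n (W i) (M (W i)))" by auto
  have B1: "bss_mem n m W s \<delta> \<rho>1" and C1: "cols_state n m \<rho>1 M N g"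
    using bss_mem_same[OF B s1] cols_state_same[OF C s1] by auto
  have rN: "represents n (reals \<rho>1 4) N" using C1 by (simp add: cols_state_def)
  from tr[OF B1 rN, of 20]
  obtain t2 \<rho>2 where r2: "run (trace_prog 20 4) \<rho>1 t2 \<rho>2" "t2 \<le> 75 * n\<^sup>2" and s2: "same {20} {10, 11} \<rho>1 \<rho>2"
    and d2: "reals \<rho>2 20 0 = (\<Sum>i<m. dot n (W i) (N (W i)))" by auto
  have B2: "bss_mem n m W s \<delta> \<rho>2" and C2: "cols_state n m \<rho>2 M N g"
    using bss_mem_same[OF B1 s2] cols_state_same[OF C1 s2] by auto
  from exec_shift_loop[OF B2 s less_imp_le[OF \<delta>] C2 inv F]
  obtain t3 \<rho>3 M1 N1 where r3: "run (For 2 1 shift_body) \<rho>2 t3 \<rho>3" "t3 \<le> 500 * n\<^sup>2 * support_size m s + 32 * m + 9"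
    and s3: "same {3, 4, 6, 7, 10, 11, 14} {2, 10, 11} \<rho>2 \<rho>3"
    and sh: "dot.shift_inv n m W Q \<beta> \<gamma> u l \<delta> g m M1 N1" and C3: "cols_state n m \<rho>3 M1 N1 g"
    by (auto simp: exec_def)
  have B3: "bss_mem n m W s \<delta> \<rho>3" using bss_mem_same[OF B2 s3] by auto
  have rM3: "represents n (reals \<rho>3 3) M1" using C3 by (simp add: cols_state_def)
  from tr[OF B3 rM3, of 21]
  obtain t4 \<rho>4 where r4: "run (trace_prog 21 3) \<rho>3 t4 \<rho>4" "t4 \<le> 75 * n\<^sup>2" and s4: "same {21} {10, 11} \<rho>3 \<rho>4"
    and d4: "reals \<rho>4 21 0 = (\<Sum>i<m. dot n (W i) (M1 (W i)))" by auto
  have B4: "bss_mem n m W s \<delta> \<rho>4" and C4: "cols_state n m \<rho>4 M1 N1 g"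
    using bss_mem_same[OF B3 s4] cols_state_same[OF C3 s4] by auto
  have rN4: "represents n (reals \<rho>4 4) N1" using C4 by (simp add: cols_state_def)
  from tr[OF B4 rN4, of 22]
  obtain t5 \<rho>5 where r5: "run (trace_prog 22 4) \<rho>4 t5 \<rho>5" "t5 \<le> 75 * n\<^sup>2" and s5: "same {22} {10, 11} \<rho>4 \<rho>5"
    and d5: "reals \<rho>5 22 0 = (\<Sum>i<m. dot n (W i) (N1 (W i)))" by auto
  have "exec (NStore 4 (NLit 0) (NLit 0)) \<rho>5 (1 + ncost (NLit 0) + ncost (NLit 0))
        (\<lambda>\<tau>. same {} {4} \<rho>5 \<tau> \<and> nats \<tau> 4 0 = 0)" by (intro exec_NStore) (auto simp: same_def)
  then obtain t6 \<rho>6 where r6: "run (NStore 4 (NLit 0) (NLit 0)) \<rho>5 t6 \<rho>6" "t6 \<le> 3"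
    and s6: "same {} {4} \<rho>5 \<rho>6" and d6: "nats \<rho>6 4 0 = 0"
    by (auto simp: exec_def)
  have s46: "same {21, 22} {4, 10, 11} \<rho>3 \<rho>6" using s4 s5 s6 by (auto simp: same_def)
  have B6: "bss_mem n m W s \<delta> \<rho>6" and C6: "cols_state n m \<rho>6 M1 N1 g"
    using bss_mem_same[OF B3 s46] cols_state_same[OF C3 s46] by auto
  define DX where "DX = (\<Sum>j<m. dot n (W j) (M (W j))) - (\<Sum>j<m. dot n (W j) (M1 (W j)))"
  define DY where "DY = (\<Sum>j<m. dot n (W j) (N1 (W j))) - (\<Sum>j<m. dot n (W j) (N (W j)))"
  have D6: "reals \<rho>6 19 0 - reals \<rho>6 21 0 = DX" "reals \<rho>6 22 0 - reals \<rho>6 20 0 = DY"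
    using d1 d2 d4 d5 s1 s2 s3 s4 s5 s6 by (simp_all add: same_def DX_def DY_def)
  let ?Done = "\<lambda>M N g. dot.bss_inv n m W Q \<beta> \<gamma> E F (u + \<delta>) (l + 1) M N g \<and> support_size m g \<le> Suc q"
  have supp: "support_size m (g(i := a)) \<le> Suc q" for i a
  proof -
    have "{j. j < m \<and> (g(i := a)) j \<noteq> 0} \<subseteq> insert i {j. j < m \<and> g j \<noteq> 0}" by auto
    from card_mono[OF _ this] have "support_size m (g(i := a)) \<le> card (insert i {j. j < m \<and> g j \<noteq> 0})"
      by (simp add: support_size_def)
    also have "\<dots> \<le> Suc (support_size m g)" unfolding support_size_def by (rule card_insert_le_m1) auto
    finally show ?thesis using g by simp
  qed
  note sel = dot.bss_select[OF inv sh F \<delta> EF, folded DX_def DY_def]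
  have "exec (For 2 1 select_body) \<rho>6 (1000 * n\<^sup>2 * support_size m s + 32 * m + 9)
    (\<lambda>\<tau>. same {2, 3, 4, 6, 7, 10, 11, 12, 13, 14, 23, 24} {2, 4, 10, 11} \<rho>6 \<tau> \<and> (\<exists>M N g. cols_state n m \<tau> M N g \<and> ?Done M N g))"
    by (rule exec_select_loop[OF B6 s C6 d6 D6]) (use sel supp g in auto)
  then obtain t7 \<rho>7 M' N' g' where r7: "run (For 2 1 select_body) \<rho>6 t7 \<rho>7" "t7 \<le> 1000 * n\<^sup>2 * support_size m s + 32 * m + 9"
    and s7: "same {2, 3, 4, 6, 7, 10, 11, 12, 13, 14, 23, 24} {2, 4, 10, 11} \<rho>6 \<rho>7"
    and C7: "cols_state n m \<rho>7 M' N' g'" and dn: "?Done M' N' g'"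
    by (auto simp: exec_def)
  have "exec (NStore 3 (NLit 0) (NAdd (nvar 3) (NLit 1))) \<rho>7 (1 + ncost (NLit 0) + ncost (NAdd (nvar 3) (NLit 1)))
        (\<lambda>\<tau>. same {} {3} \<rho>7 \<tau> \<and> nats \<tau> 3 0 = Suc q)"
    using q s1 s2 s3 s46 s7 by (intro exec_NStore) (auto simp: same_def)
  then obtain t8 \<rho>8 where r8: "run (NStore 3 (NLit 0) (NAdd (nvar 3) (NLit 1))) \<rho>7 t8 \<rho>8" "t8 \<le> 6"
    and s8: "same {} {3} \<rho>7 \<rho>8" and d8: "nats \<rho>8 3 0 = Suc q"
    by (auto simp: exec_def)
  have C8: "cols_state n m \<rho>8 M' N' g'" using cols_state_same[OF C7 s8] by auto
  show ?thesis unfolding bss_body_def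
  proof (rule execI[OF run.Seq[OF r1(1) run.Seq[OF r2(1) run.Seq[OF r3(1) run.Seq[OF r4(1) run.Seq[OF r5(1)
        run.Seq[OF r6(1) run.Seq[OF r7(1) r8(1)]]]]]]]])
    have "1500 * n\<^sup>2 * support_size m s = 500 * n\<^sup>2 * support_size m s + 1000 * n\<^sup>2 * support_size m s"
      by (simp add: algebra_simps)
    then show "t1 + (t2 + (t3 + (t4 + (t5 + (t6 + (t7 + t8)))))) \<le> 1500 * n\<^sup>2 * support_size m s + 100 * m + 400 * n\<^sup>2"
      using r1(2) r2(2) r3(2) r4(2) r5(2) r6(2) r7(2) r8(2) n by linarith
    have "same {2, 3, 4, 6, 7, 10, 11, 12, 13, 14, 19, 20, 21, 22, 23, 24} {2, 3, 4, 10, 11} \<sigma> \<rho>8"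
      using s1 s2 s3 s46 s7 s8 by (auto simp: same_def)
    then show "same {2, 3, 4, 6, 7, 10, 11, 12, 13, 14, 19, 20, 21, 22, 23, 24} {2, 3, 4, 10, 11} \<sigma> \<rho>8 \<and>
      nats \<rho>8 3 0 = Suc q \<and> (\<exists>M N g. cols_state n m \<rho>8 M N g \<and>
        dot.bss_inv n m W Q \<beta> \<gamma> E F (u + \<delta>) (l + 1) M N g \<and> support_size m g \<le> Suc q)"
      using d8 C8 dn by blast
  qed
qed

text \<open>Multiplying \<open>v i\<close> by the square root of its sampling weight turns the
  weighted sum into a plain one, the form on which the barrier method works. This is the only square
  root in the program.\<close>

definition rescale_prog :: com where
  "rescale_prog = Mat_set 1 1 (RMul (mat_at 1) (RSqrt (RLoad 8 (nvar 10))))"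

lemma exec_rescale:
  assumes l: "layout n m \<sigma>" and V: "vectors n m \<sigma> V" and s: "\<forall>j<m. reals \<sigma> 8 j = s j"
  shows "exec rescale_prog \<sigma> (72 * (m * n)) (\<lambda>\<tau>. same {1} {10, 11} \<sigma> \<tau> \<and> vectors n m \<tau> (\<lambda>i. sqrt (s i) *\<^sub>R V i))"
proof -
  have n: "1 \<le> n" "n \<le> m" "nats \<sigma> 0 1 = m" using l by (auto simp: layout_def)
  have m: "1 \<le> m" using n by simp
  have "exec rescale_prog \<sigma> ((rcost (RMul (mat_at 1) (RSqrt (RLoad 8 (nvar 10)))) + 60) * (m * n))
    (\<lambda>\<tau>. same {1} {10, 11} \<sigma> \<tau> \<and> (\<forall>j<m. \<forall>k<n. reals \<tau> 1 (j * n + k) = V j k * sqrt (s j)))"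
    unfolding rescale_prog_def
  proof (rule exec_Mat_set[OF l n(3) m order_refl])
    fix j k \<tau> assume a: "j < m" "k < n" "same {1} {10, 11} \<sigma> \<tau>" "nats \<tau> 10 0 = j" "nats \<tau> 11 0 = k"
      "reals \<tau> 1 (j * n + k) = reals \<sigma> 1 (j * n + k)"
    have "rval (mat_at 1) \<tau> = reals \<tau> 1 (j * n + k)" using a l by (auto simp: layout_def same_def)
    then show "rval (RMul (mat_at 1) (RSqrt (RLoad 8 (nvar 10)))) \<tau> = V j k * sqrt (s j)"
      using a V s by (auto simp: vectors_def same_def)
  qed
  then show ?thesis
    by (rule exec_mono) (use V in \<open>auto simp: vectors_def scaleR_fun_def supported_def\<close>)
qed

text \<open>Stops at the least \<open>q\<close> with \<open>q * \<epsilon>\<^sup>2 \<ge> n\<close>,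
  which is the ceiling of \<open>n / \<epsilon>\<^sup>2\<close>, obtained without rounding.\<close>

abbreviation more_rounds :: bexp where
  "more_rounds \<equiv> RLess (RMul r_q (RMul r_eps r_eps)) r_n"
abbreviation r_ratio :: rexp where "r_ratio \<equiv> RDiv (RAdd (lit 1) r_eps) (RSub (lit 1) r_eps)"

text \<open>The inverse and the Gram matrix are computed anew for the rescaled vectors, as the
  sampling pass has overwritten the former and emptied the latter. Both initial barriers are
  multiples of \<open>A + Q\<close>, so their inverses are multiples of one matrix.\<close>

definition bss_prog :: com where
  "bss_prog = Seq init_prog (Seq (RStore 18 (NLit 0) r_ratio)
    (Seq (scale_mat 4 (RDiv (lit 1) (RDiv r_n r_eps)) 3)
    (Seq (scale_mat 3 (RDiv (lit 1) (RMul (RDiv r_n r_eps) r_ratio)) 3)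
    (Seq (NStore 3 (NLit 0) (NLit 0)) (While more_rounds bss_body)))))"

lemma exec_bss:
  assumes l: "layout n m \<sigma>" and W: "vectors n m \<sigma> W" and \<epsilon>: "reals \<sigma> 0 0 = \<epsilon>" "0 < \<epsilon>" "\<epsilon> < 1"
    and s8: "\<forall>j<m. reals \<sigma> 8 j = s j" and s: "\<And>j. 0 \<le> s j" "\<And>j. s j = 0 \<Longrightarrow> W j = 0"
    and z: "\<forall>j<m. reals \<sigma> 2 j = 0"
  defines "N \<equiv> nat \<lceil>real n / \<epsilon>\<^sup>2\<rceil>" and "\<delta> \<equiv> (1 + \<epsilon>) / (1 - \<epsilon>)"
  shows "exec bss_prog \<sigma> (1500 * (m * n\<^sup>2) + (Suc N) * (1500 * n\<^sup>2 * support_size m s + 100 * m + 414 * n\<^sup>2))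
    (\<lambda>\<tau>. same {2, 3, 4, 5, 6, 7, 10, 11, 12, 13, 14, 18, 19, 20, 21, 22, 23, 24} {2, 3, 4, 10, 11} \<sigma> \<tau> \<and>
      (\<exists>q g. nats \<tau> 3 0 = q \<and> q \<le> N \<and> real n \<le> real q * \<epsilon>\<^sup>2 \<and> support_size m g \<le> q \<and> (\<forall>j. 0 \<le> g j) \<and>
        (\<forall>j<m. reals \<tau> 2 j = g j) \<and>
        (\<forall>x. (\<Sum>j<m. g j * (dot n (W j) x)\<^sup>2) \<le> (real n / \<epsilon> + real q) * \<delta> * (\<Sum>j<m. (dot n (W j) x)\<^sup>2) \<and>
           (real q - real n / \<epsilon>) * (\<Sum>j<m. (dot n (W j) x)\<^sup>2) \<le> (\<Sum>j<m. g j * (dot n (W j) x)\<^sup>2))))"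
proof -
  have n: "1 \<le> n" "n \<le> m" using l by (auto simp: layout_def)
  have \<delta>: "0 < \<delta>" using \<epsilon> by (simp add: \<delta>_def)
  define b where "b = real n / \<epsilon>"
  define a where "a = b * \<delta>"
  have ab: "0 < a" "0 < b" using \<epsilon> n \<delta> by (auto simp: a_def b_def)
  obtain t1 \<rho>1 where r1: "run init_prog \<sigma> t1 \<rho>1" "t1 \<le> 1200 * (m * n\<^sup>2)"
    and s1: "same {3, 4, 5, 6, 7, 10, 11, 14} {2, 10, 11} \<sigma> \<rho>1" and st1: "init_state n W m \<rho>1"
    using exec_init[OF l W] by (auto simp: exec_def)
  obtain Q H where G: "gram n (reals \<rho>1 5) {..<m} W" and Q: "dot.projector_off n m W Q"
    and H: "dot.inverse_pair n (dot.barrier n m W Q 1 (\<lambda>_. 1)) H"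
    and rH: "represents n (reals \<rho>1 3) H" using st1 by (auto simp: init_state_def)
  have "exec (RStore 18 (NLit 0) r_ratio) \<rho>1 (1 + ncost (NLit 0) + rcost r_ratio)
      (\<lambda>\<tau>. same {18} {} \<rho>1 \<tau> \<and> reals \<tau> 18 0 = \<delta>)"
    using \<epsilon> s1 by (intro exec_RStore) (auto simp: same_def \<delta>_def)
  then obtain t2 \<rho>2 where r2: "run (RStore 18 (NLit 0) r_ratio) \<rho>1 t2 \<rho>2" "t2 \<le> 20"
    and s2: "same {18} {} \<rho>1 \<rho>2" and d2: "reals \<rho>2 18 0 = \<delta>" by (auto simp: exec_def)
  have s02: "same {3, 4, 5, 6, 7, 10, 11, 14, 18} {2, 10, 11} \<sigma> \<rho>2" using s1 s2 by (auto simp: same_def)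
  have l2: "layout n m \<rho>2" and rH2: "represents n (reals \<rho>2 3) H" and e2: "reals \<rho>2 0 0 = \<epsilon>" and n2: "nats \<rho>2 0 0 = n"
    using layout_same[OF l s02] rH s02 s2 \<epsilon> l by (auto simp: same_def layout_def)
  obtain t3 \<rho>3 where r3: "run (scale_mat 4 (RDiv (lit 1) (RDiv r_n r_eps)) 3) \<rho>2 t3 \<rho>3" "t3 \<le> 100 * n\<^sup>2"
    and s3: "same {4} {10, 11} \<rho>2 \<rho>3" and rN3: "represents n (reals \<rho>3 4) (\<lambda>x. (1 / b) *\<^sub>R H x)"
    using exec_scale_mat[OF l2 rH2, of 4 "RDiv (lit 1) (RDiv r_n r_eps)" "1 / b"] e2 n2 unfolding b_def
    by (auto simp: exec_def same_def)
  have l3: "layout n m \<rho>3" and rH3: "represents n (reals \<rho>3 3) H" and e3: "reals \<rho>3 0 0 = \<epsilon>" and n3: "nats \<rho>3 0 0 = n"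
    using layout_same[OF l2 s3] rH2 s3 e2 n2 by (auto simp: same_def)
  obtain t4 \<rho>4 where r4: "run (scale_mat 3 (RDiv (lit 1) (RMul (RDiv r_n r_eps) r_ratio)) 3) \<rho>3 t4 \<rho>4" "t4 \<le> 100 * n\<^sup>2"
    and s4: "same {3} {10, 11} \<rho>3 \<rho>4" and rM4: "represents n (reals \<rho>4 3) (\<lambda>x. (1 / a) *\<^sub>R H x)"
    using exec_scale_mat[OF l3 rH3, of 3 "RDiv (lit 1) (RMul (RDiv r_n r_eps) r_ratio)" "1 / a"] e3 n3 unfolding a_def b_def \<delta>_def
    by (auto simp: exec_def same_def)
  have "exec (NStore 3 (NLit 0) (NLit 0)) \<rho>4 (1 + ncost (NLit 0) + ncost (NLit 0))
        (\<lambda>\<tau>. same {} {3} \<rho>4 \<tau> \<and> nats \<tau> 3 0 = 0)" by (intro exec_NStore) (auto simp: same_def)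
  then obtain t5 \<rho>5 where r5: "run (NStore 3 (NLit 0) (NLit 0)) \<rho>4 t5 \<rho>5" "t5 \<le> 3"
    and s5: "same {} {3} \<rho>4 \<rho>5" and d5: "nats \<rho>5 3 0 = 0"
    by (auto simp: exec_def)
  let ?R = "{2, 3, 4, 5, 6, 7, 10, 11, 12, 13, 14, 18, 19, 20, 21, 22, 23, 24} :: nat set"
  let ?S = "{2, 3, 4, 10, 11} :: nat set"
  have s05: "same ?R ?S \<sigma> \<rho>5" using s02 s3 s4 s5 by (auto simp: same_def)
  have B5: "bss_mem n m W s \<delta> \<rho>5"
    using layout_same[OF l s05] vectors_same[OF W s05] G s8 d2 s1 s2 s3 s4 s5 by (auto simp: bss_mem_def same_def)
  have C5: "cols_state n m \<rho>5 (\<lambda>x. (1 / a) *\<^sub>R H x) (\<lambda>x. (1 / b) *\<^sub>R H x) (\<lambda>_. 0)"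
    using rM4 rN3 z s1 s2 s3 s4 s5 by (auto simp: cols_state_def same_def)
  have E: "real n / a = \<epsilon> * (1 - \<epsilon>) / (1 + \<epsilon>)" and F: "real n / b = \<epsilon>"
    using \<epsilon> n by (simp_all add: a_def b_def \<delta>_def)
  define E where "E = \<epsilon> * (1 - \<epsilon>) / (1 + \<epsilon>)"
  have inv0: "dot.bss_inv n m W Q a b E \<epsilon> a (- b) (\<lambda>x. (1 / a) *\<^sub>R H x) (\<lambda>x. (1 / b) *\<^sub>R H x) (\<lambda>_. 0)"
    using dot.bss_inv_init[OF H dot.trace_le_dim[OF Q H] ab] unfolding E F E_def .
  have E0: "0 \<le> E" using \<epsilon> by (simp add: E_def)
  \<comment> \<open>The barriers start at \<open>- n / \<epsilon>\<close> and
    \<open>(n / \<epsilon>) * \<delta>\<close>, giving potential bounds \<epsilon> and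
    \<open>E\<close>. With \<open>\<delta> = (1 + \<epsilon>) / (1 - \<epsilon>)\<close> the
    condition for a good candidate holds with equality.\<close>
  have "1 / \<delta> + E = (1 - \<epsilon>) * (1 + \<epsilon>) / (1 + \<epsilon>)"
    by (simp add: E_def \<delta>_def add_divide_distrib[symmetric] algebra_simps)
  also have "\<dots> = 1 - \<epsilon>" using \<epsilon> by simp
  finally have EF: "1 / \<delta> + E \<le> 1 - \<epsilon>" by simp
  let ?I = "\<lambda>q \<tau>. same ?R ?S \<sigma> \<tau> \<and> bss_mem n m W s \<delta> \<tau> \<and> nats \<tau> 3 0 = q \<and>
    (\<exists>M N g. cols_state n m \<tau> M N g \<and> dot.bss_inv n m W Q a b E \<epsilon> (a + real q * \<delta>) (- b + real q) M N g \<and> support_size m g \<le> q)"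
  have "exec (While more_rounds bss_body) \<rho>5
    ((Suc N - 0) * ((1500 * n\<^sup>2 * support_size m s + 100 * m + 400 * n\<^sup>2) + 1 + bcost more_rounds))
    (\<lambda>\<tau>. \<exists>q\<le>N. ?I q \<tau> \<and> \<not> bval more_rounds \<tau>)"
  proof (rule exec_While[where I = ?I])
    show "?I 0 \<rho>5" using s05 B5 d5 C5 inv0 by (auto simp: support_size_def)
  next
    fix q \<tau> assume I: "?I q \<tau>"
    then obtain M N' g where C: "cols_state n m \<tau> M N' g"
      and inv: "dot.bss_inv n m W Q a b E \<epsilon> (a + real q * \<delta>) (- b + real q) M N' g" and g: "support_size m g \<le> q"
      by auto
    have B: "bss_mem n m W s \<delta> \<tau>" and q: "nats \<tau> 3 0 = q" and st: "same ?R ?S \<sigma> \<tau>" using I by blast+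
    have "exec bss_body \<tau> (1500 * n\<^sup>2 * support_size m s + 100 * m + 400 * n\<^sup>2)
      (\<lambda>\<rho>. same {2, 3, 4, 6, 7, 10, 11, 12, 13, 14, 19, 20, 21, 22, 23, 24} ?S \<tau> \<rho> \<and>
      nats \<rho> 3 0 = Suc q \<and> (\<exists>M N g. cols_state n m \<rho> M N g \<and>
        dot.bss_inv n m W Q a b E \<epsilon> (a + real q * \<delta> + \<delta>) (- b + real q + 1) M N g \<and> support_size m g \<le> Suc q))"
      by (rule exec_bss_body[OF B s C inv \<epsilon>(3) \<delta> E0 EF q g])
    then show "exec bss_body \<tau> (1500 * n\<^sup>2 * support_size m s + 100 * m + 400 * n\<^sup>2) (?I (Suc q))"
    proof (rule exec_mono)
      fix \<rho> assume A: "same {2, 3, 4, 6, 7, 10, 11, 12, 13, 14, 19, 20, 21, 22, 23, 24} ?S \<tau> \<rho> \<and>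
        nats \<rho> 3 0 = Suc q \<and> (\<exists>M N g. cols_state n m \<rho> M N g \<and>
        dot.bss_inv n m W Q a b E \<epsilon> (a + real q * \<delta> + \<delta>) (- b + real q + 1) M N g \<and> support_size m g \<le> Suc q)"
      then have sr: "same {2, 3, 4, 6, 7, 10, 11, 12, 13, 14, 19, 20, 21, 22, 23, 24} ?S \<tau> \<rho>" by blast
      have "bss_mem n m W s \<delta> \<rho>" using bss_mem_same[OF B sr] by auto
      moreover have "same ?R ?S \<sigma> \<rho>" using same_trans[OF st sr] by (rule same_mono) auto
      moreover have "a + real q * \<delta> + \<delta> = a + real (Suc q) * \<delta>" "- b + real q + 1 = - b + real (Suc q)"
        by (simp_all add: algebra_simps)
      note A[unfolded this]
      ultimately show "?I (Suc q) \<rho>" by blast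
    qed simp
  next
    fix q \<tau> assume I: "?I q \<tau>" and b: "bval more_rounds \<tau>"
    then have st: "same ?R ?S \<sigma> \<tau>" by blast
    have "real q * \<epsilon>\<^sup>2 < real n" using b I st \<epsilon> l by (auto simp: same_def layout_def power2_eq_square)
    then have "real q < real n / \<epsilon>\<^sup>2" using \<epsilon> by (simp add: field_simps)
    also have "\<dots> \<le> real N" unfolding N_def by (simp add: real_nat_ceiling_ge)
    finally show "q < N" by simp
  qed simp
  then obtain t6 \<rho>6 q where r6: "run (While more_rounds bss_body) \<rho>5 t6 \<rho>6"
      "t6 \<le> Suc N * ((1500 * n\<^sup>2 * support_size m s + 100 * m + 400 * n\<^sup>2) + 1 + bcost more_rounds)"
    and q: "q \<le> N" and I6: "?I q \<rho>6" and nb: "\<not> bval more_rounds \<rho>6"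
    unfolding exec_def diff_zero by blast
  have s06: "same ?R ?S \<sigma> \<rho>6" using I6 by blast
  obtain M N' g where C6: "cols_state n m \<rho>6 M N' g" and q6: "nats \<rho>6 3 0 = q"
      and inv6: "dot.bss_inv n m W Q a b E \<epsilon> (a + real q * \<delta>) (- b + real q) M N' g" and g6: "support_size m g \<le> q"
    using I6 by blast
  have qn: "real n \<le> real q * \<epsilon>\<^sup>2" using nb q6 s06 \<epsilon> l by (auto simp: same_def layout_def power2_eq_square)
  show ?thesis unfolding bss_prog_def
  proof (rule execI[OF run.Seq[OF r1(1) run.Seq[OF r2(1) run.Seq[OF r3(1) run.Seq[OF r4(1) run.Seq[OF r5(1) r6(1)]]]]]])
    have "1 * n\<^sup>2 \<le> m * n\<^sup>2" using n by (intro mult_right_mono) auto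
    moreover have "1 \<le> n\<^sup>2" using n by simp
    \<comment> \<open>The guard costs 13 and the branch 1, which turns 400 into 414.\<close>
    moreover have "Suc N * ((1500 * n\<^sup>2 * support_size m s + 100 * m + 400 * n\<^sup>2) + 1 + bcost more_rounds)
      \<le> Suc N * (1500 * n\<^sup>2 * support_size m s + 100 * m + 414 * n\<^sup>2)"
      using \<open>1 \<le> n\<^sup>2\<close> by (intro mult_left_mono) (simp_all del: mult_Suc)
    ultimately show "t1 + (t2 + (t3 + (t4 + (t5 + t6))))
      \<le> 1500 * (m * n\<^sup>2) + (Suc N) * (1500 * n\<^sup>2 * support_size m s + 100 * m + 414 * n\<^sup>2)"
      using r1(2) r2(2) r3(2) r4(2) r5(2) r6(2) by linarith
    have u: "a + real q * \<delta> = (real n / \<epsilon> + real q) * \<delta>" and l': "- b + real q = real q - real n / \<epsilon>"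
      by (simp_all add: a_def b_def algebra_simps)
    show "same ?R ?S \<sigma> \<rho>6 \<and> (\<exists>q g. nats \<rho>6 3 0 = q \<and> q \<le> N \<and> real n \<le> real q * \<epsilon>\<^sup>2 \<and> support_size m g \<le> q \<and> (\<forall>j. 0 \<le> g j) \<and>
        (\<forall>j<m. reals \<rho>6 2 j = g j) \<and>
        (\<forall>x. (\<Sum>j<m. g j * (dot n (W j) x)\<^sup>2) \<le> (real n / \<epsilon> + real q) * \<delta> * (\<Sum>j<m. (dot n (W j) x)\<^sup>2) \<and>
           (real q - real n / \<epsilon>) * (\<Sum>j<m. (dot n (W j) x)\<^sup>2) \<le> (\<Sum>j<m. g j * (dot n (W j) x)\<^sup>2)))"
    proof (intro conjI exI[of _ q] exI[of _ g] allI)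
      show "0 \<le> g j" for j using inv6 by (simp add: dot.bss_inv_def)
    qed (use s06 q6 q qn g6 C6 dot.bss_inv_final[OF inv6 Q, unfolded u l'] in \<open>auto simp: cols_state_def\<close>)
  qed
qed

section \<open>Sparsification\<close>

text \<open>After \<open>q\<close> rounds the barriers are
  \<open>(n / \<epsilon> + q) * (1 + \<epsilon>) / (1 - \<epsilon>)\<close> and
  \<open>q - n / \<epsilon>\<close>. The factor
  \<open>(1 - \<epsilon>\<^sup>2) / (q + n / \<epsilon>)\<close> moves them to
  \<open>(1 + \<epsilon>)\<^sup>2\<close> and, as \<open>n \<le> q * \<epsilon>\<^sup>2\<close>, to
  at least \<open>(1 - \<epsilon>)\<^sup>2\<close>. The sampling weight undoes the rescaling of the
  vectors.\<close>

abbreviation r_final :: rexp where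
  "r_final \<equiv> RDiv (RMul (RMul (RLoad 2 (nvar 10)) (RLoad 8 (nvar 10))) (RSub (lit 1) (RMul r_eps r_eps)))
     (RAdd r_q (RDiv r_n r_eps))"

definition finish_prog :: com where
  "finish_prog = For 10 1 (RStore 2 (nvar 10) r_final)"

lemma exec_finish:
  assumes l: "layout n m \<sigma>" and g: "\<forall>j<m. reals \<sigma> 2 j = g j" and s: "\<forall>j<m. reals \<sigma> 8 j = s j"
    and q: "nats \<sigma> 3 0 = q" and \<epsilon>: "reals \<sigma> 0 0 = \<epsilon>"
  shows "exec finish_prog \<sigma> (60 * m) (\<lambda>\<tau>. \<forall>j<m. reals \<tau> 2 j = g j * s j * (1 - \<epsilon>\<^sup>2) / (real q + real n / \<epsilon>))"
proof -
  let ?h = "\<lambda>j. g j * s j * (1 - \<epsilon>\<^sup>2) / (real q + real n / \<epsilon>)"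
  let ?I = "\<lambda>i \<tau>. same {2} {10} \<sigma> \<tau> \<and> (\<forall>j<m. reals \<tau> 2 j = (if j < i then ?h j else g j))"
  have "exec finish_prog \<sigma> (m * ((1 + ncost (nvar 10) + rcost r_final) + 21)) (\<lambda>\<tau>. \<forall>j<m. reals \<tau> 2 j = ?h j)"
    unfolding finish_prog_def
  proof (rule exec_For_const[where I = ?I])
    fix i \<tau> assume a: "i < m" "?I i \<tau>" "nats \<tau> 10 0 = i"
    have "rval r_final \<tau> = ?h i" using a g s q \<epsilon> l by (auto simp: same_def layout_def power2_eq_square)
    then show "exec (RStore 2 (nvar 10) r_final) \<tau> (1 + ncost (nvar 10) + rcost r_final)
        (\<lambda>\<rho>. nats \<rho> 10 0 = i \<and> ?I (Suc i) (set_nvar 10 (Suc i) \<rho>))"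
      using a by (intro exec_RStore) (auto simp: same_def less_Suc_eq)
  qed (use l g in \<open>auto simp: same_def layout_def\<close>)
  then show ?thesis by (rule exec_mono) auto
qed

text \<open>Row offsets by repeated addition. Entry 0 is already correct in the input memory and
  turn \<open>i\<close> writes entry \<open>i + 1\<close>, so the table extends to \<open>m\<close>
  inclusive.\<close>

definition table_prog :: com where
  "table_prog = For 2 1 (NStore 1 (NAdd (nvar 2) (NLit 1)) (NAdd (NLoad 1 (nvar 2)) (NLoad 0 (NLit 0))))"

lemma exec_table:
  assumes n: "1 \<le> n" "n \<le> m" "nats \<sigma> 0 0 = n" "nats \<sigma> 0 1 = m" "nats \<sigma> 1 0 = 0"
  shows "exec table_prog \<sigma> (60 * m) (\<lambda>\<tau>. reals \<tau> = reals \<sigma> \<and> layout n m \<tau>)"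
proof -
  let ?I = "\<lambda>i \<tau>. same {} {1, 2} \<sigma> \<tau> \<and> (\<forall>j\<le>i. nats \<tau> 1 j = j * n)"
  let ?i = "NAdd (nvar 2) (NLit 1)" and ?e = "NAdd (NLoad 1 (nvar 2)) (NLoad 0 (NLit 0))"
  have "exec table_prog \<sigma> (m * ((1 + ncost ?i + ncost ?e) + 21)) (?I m)"
    unfolding table_prog_def
  proof (rule exec_For_const[where I = ?I])
    fix i \<tau> assume "i < m" "?I i \<tau>" "nats \<tau> 2 0 = i"
    then show "exec (NStore 1 ?i ?e) \<tau> (1 + ncost ?i + ncost ?e)
      (\<lambda>\<rho>. nats \<rho> 2 0 = i \<and> ?I (Suc i) (set_nvar 2 (Suc i) \<rho>))"
      using n by (intro exec_NStore) (auto simp: same_def le_Suc_eq)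
  qed (use n in \<open>auto simp: same_def\<close>)
  then show ?thesis
    by (rule exec_mono) (use n in \<open>auto simp: same_def layout_def\<close>)
qed

definition sparsify_prog :: com where
  "sparsify_prog = Seq table_prog (Seq sample_prog (Seq rescale_prog (Seq bss_prog finish_prog)))"

lemma exec_sparsify:
  fixes v :: "nat \<Rightarrow> nat \<Rightarrow> real"
  assumes n: "1 \<le> n" "n \<le> m" "nats \<sigma> 0 0 = n" "nats \<sigma> 0 1 = m" "nats \<sigma> 1 0 = 0"
    and V: "vectors n m \<sigma> V" and \<epsilon>: "reals \<sigma> 0 0 = \<epsilon>" "0 < \<epsilon>" "\<epsilon> < 1" and z: "\<forall>j<m. reals \<sigma> 2 j = 0"
  shows "\<exists>t \<tau>. run sparsify_prog \<sigma> t \<tau> \<and>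
    real t \<le> 100000 * (real m * real n ^ 2 / \<epsilon>\<^sup>2 + real n ^ 4 / \<epsilon> ^ 4) \<and>
    (\<forall>j<m. 0 \<le> reals \<tau> 2 j) \<and> int (support_size m (reals \<tau> 2)) \<le> \<lceil>real n / \<epsilon>\<^sup>2\<rceil> \<and>
    (\<forall>x. (1 - \<epsilon>) ^ 3 * (\<Sum>j<m. (dot n (V j) x)\<^sup>2) \<le> (\<Sum>j<m. reals \<tau> 2 j * (dot n (V j) x)\<^sup>2) \<and>
         (\<Sum>j<m. reals \<tau> 2 j * (dot n (V j) x)\<^sup>2) \<le> (1 + \<epsilon>) ^ 3 * (\<Sum>j<m. (dot n (V j) x)\<^sup>2))"
proof -
  obtain t1 \<rho>1 where r1: "run table_prog \<sigma> t1 \<rho>1" "t1 \<le> 60 * m" and d1: "reals \<rho>1 = reals \<sigma>" and l1: "layout n m \<rho>1"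
    using exec_table[OF n] by (auto simp: exec_def)
  have V1: "vectors n m \<rho>1 V" and e1: "reals \<rho>1 0 0 = \<epsilon>" using V \<epsilon> by (simp_all add: vectors_def d1)
  obtain t2 \<rho>2 s where r2: "run sample_prog \<rho>1 t2 \<rho>2" "t2 \<le> 3000 * (m * n\<^sup>2)"
    and s2: "same {3, 4, 5, 6, 7, 8, 10, 11, 12, 13, 14, 15, 16, 17} {2, 10, 11} \<rho>1 \<rho>2"
    and d2: "\<forall>j<m. reals \<rho>2 8 j = s j" and s0: "\<And>j. 0 \<le> s j"
    and c2: "real (support_size m s) \<le> 12 * real n / \<epsilon>\<^sup>2"
    and lo: "\<And>x. (1 - \<epsilon>) * (\<Sum>j<m. (dot n (V j) x)\<^sup>2) \<le> (\<Sum>j<m. s j * (dot n (V j) x)\<^sup>2)"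
    and up: "\<And>x. (\<Sum>j<m. s j * (dot n (V j) x)\<^sup>2) \<le> (1 + \<epsilon>) * (\<Sum>j<m. (dot n (V j) x)\<^sup>2)"
    using exec_sample[OF l1 V1 e1 \<epsilon>(2,3)] unfolding exec_def support_size_def by blast
  have l2: "layout n m \<rho>2" and V2: "vectors n m \<rho>2 V"
    using layout_same[OF l1 s2] vectors_same[OF V1 s2] by auto
  define W where "W = (\<lambda>i. sqrt (s i) *\<^sub>R V i)"
  obtain t3 \<rho>3 where r3: "run rescale_prog \<rho>2 t3 \<rho>3" "t3 \<le> 72 * (m * n)"
    and s3: "same {1} {10, 11} \<rho>2 \<rho>3" and W3: "vectors n m \<rho>3 W"
    using exec_rescale[OF l2 V2 d2] by (auto simp: exec_def W_def)
  have l3: "layout n m \<rho>3" using layout_same[OF l2 s3] by auto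
  have e3: "reals \<rho>3 0 0 = \<epsilon>" and d3: "\<forall>j<m. reals \<rho>3 8 j = s j" and z3: "\<forall>j<m. reals \<rho>3 2 j = 0"
    using e1 d2 d1 z s2 s3 by (auto simp: same_def)
  define N where "N = nat \<lceil>real n / \<epsilon>\<^sup>2\<rceil>"
  have W0: "W j = 0" if "s j = 0" for j using that by (simp add: W_def)
  obtain t4 \<rho>4 q g where r4: "run bss_prog \<rho>3 t4 \<rho>4"
      "t4 \<le> 1500 * (m * n\<^sup>2) + (Suc N) * (1500 * n\<^sup>2 * support_size m s + 100 * m + 414 * n\<^sup>2)"
    and s4: "same {2, 3, 4, 5, 6, 7, 10, 11, 12, 13, 14, 18, 19, 20, 21, 22, 23, 24} {2, 3, 4, 10, 11} \<rho>3 \<rho>4"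
    and q4: "nats \<rho>4 3 0 = q" "q \<le> N" "real n \<le> real q * \<epsilon>\<^sup>2" and g4: "support_size m g \<le> q" "\<And>j. 0 \<le> g j"
      "\<forall>j<m. reals \<rho>4 2 j = g j"
    and gup: "\<And>x. (\<Sum>j<m. g j * (dot n (W j) x)\<^sup>2) \<le> (real n / \<epsilon> + real q) * ((1 + \<epsilon>) / (1 - \<epsilon>)) * (\<Sum>j<m. (dot n (W j) x)\<^sup>2)"
    and glo: "\<And>x. (real q - real n / \<epsilon>) * (\<Sum>j<m. (dot n (W j) x)\<^sup>2) \<le> (\<Sum>j<m. g j * (dot n (W j) x)\<^sup>2)"
    using exec_bss[OF l3 W3 e3 \<epsilon>(2,3) d3 s0 W0 z3] unfolding exec_def N_def by blast
  have l4: "layout n m \<rho>4" using layout_same[OF l3 s4] by auto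
  have e4: "reals \<rho>4 0 0 = \<epsilon>" and d4: "\<forall>j<m. reals \<rho>4 8 j = s j" using e3 d3 s4 by (auto simp: same_def)
  obtain t5 \<rho>5 where r5: "run finish_prog \<rho>4 t5 \<rho>5" "t5 \<le> 60 * m"
    and d5: "\<forall>j<m. reals \<rho>5 2 j = g j * s j * (1 - \<epsilon>\<^sup>2) / (real q + real n / \<epsilon>)"
    using exec_finish[OF l4 g4(3) d4 q4(1) e4] by (auto simp: exec_def)
  define D where "D = real q + real n / \<epsilon>"
  have D0: "0 < D" using n \<epsilon> by (simp add: D_def add_nonneg_pos)
  have e2: "0 < 1 - \<epsilon>\<^sup>2" "1 - \<epsilon>\<^sup>2 = (1 - \<epsilon>) * (1 + \<epsilon>)"
  proof -
    show "1 - \<epsilon>\<^sup>2 = (1 - \<epsilon>) * (1 + \<epsilon>)" by (simp add: power2_eq_square algebra_simps)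
    with \<epsilon> show "0 < 1 - \<epsilon>\<^sup>2" by simp
  qed
  have h: "reals \<rho>5 2 j = g j * s j * ((1 - \<epsilon>\<^sup>2) / D)" if "j < m" for j
    using d5 that by (simp add: D_def)
  have Wx: "(dot n (W j) x)\<^sup>2 = s j * (dot n (V j) x)\<^sup>2" for j x
    using s0[of j] by (simp add: W_def dot.ip_scale_left power_mult_distrib)
  have fin: "(\<Sum>j<m. reals \<rho>5 2 j * (dot n (V j) x)\<^sup>2) = (1 - \<epsilon>\<^sup>2) / D * (\<Sum>j<m. g j * (dot n (W j) x)\<^sup>2)" for x
    by (simp add: sum_distrib_left h Wx algebra_simps)
  have nonneg: "\<forall>j<m. 0 \<le> reals \<rho>5 2 j" using h g4(2) s0 e2 D0 by auto
  have "{j. j < m \<and> reals \<rho>5 2 j \<noteq> 0} \<subseteq> {j. j < m \<and> g j \<noteq> 0}" using h by auto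
  then have "support_size m (reals \<rho>5 2) \<le> support_size m g"
    unfolding support_size_def by (intro card_mono) auto
  also have "\<dots> \<le> N" using g4(1) q4(2) by simp
  finally have "support_size m (reals \<rho>5 2) \<le> N" .
  moreover have "0 \<le> real n / \<epsilon>\<^sup>2" by simp
  ultimately have supp: "int (support_size m (reals \<rho>5 2)) \<le> \<lceil>real n / \<epsilon>\<^sup>2\<rceil>"
    unfolding N_def by linarith
  have upper: "(\<Sum>j<m. reals \<rho>5 2 j * (dot n (V j) x)\<^sup>2) \<le> (1 + \<epsilon>) ^ 3 * (\<Sum>j<m. (dot n (V j) x)\<^sup>2)" for x
  proof -
    have "(\<Sum>j<m. reals \<rho>5 2 j * (dot n (V j) x)\<^sup>2)
      \<le> (1 - \<epsilon>\<^sup>2) / D * ((real n / \<epsilon> + real q) * ((1 + \<epsilon>) / (1 - \<epsilon>)) * (\<Sum>j<m. (dot n (W j) x)\<^sup>2))"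
      unfolding fin using gup[of x] e2(1) D0 by (intro mult_left_mono) auto
    also have "\<dots> = (1 - \<epsilon>\<^sup>2) * ((1 + \<epsilon>) / (1 - \<epsilon>)) * (\<Sum>j<m. (dot n (W j) x)\<^sup>2) * (D / D)"
      by (simp add: D_def add.commute)
    also have "(1 - \<epsilon>\<^sup>2) * ((1 + \<epsilon>) / (1 - \<epsilon>)) = (1 + \<epsilon>) ^ 2"
      unfolding e2(2) using \<epsilon> by (simp add: power2_eq_square)
    also have "(1 + \<epsilon>) ^ 2 * (\<Sum>j<m. (dot n (W j) x)\<^sup>2) * (D / D) = (1 + \<epsilon>) ^ 2 * (\<Sum>j<m. s j * (dot n (V j) x)\<^sup>2)"
      unfolding Wx using D0 by simp
    also have "\<dots> \<le> (1 + \<epsilon>) ^ 2 * ((1 + \<epsilon>) * (\<Sum>j<m. (dot n (V j) x)\<^sup>2))"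
      using up[of x] by (intro mult_left_mono) auto
    finally show ?thesis by (simp add: power3_eq_cube power2_eq_square mult.assoc)
  qed
  have lower: "(1 - \<epsilon>) ^ 3 * (\<Sum>j<m. (dot n (V j) x)\<^sup>2) \<le> (\<Sum>j<m. reals \<rho>5 2 j * (dot n (V j) x)\<^sup>2)" for x
  proof -
    \<comment> \<open>The exit condition of the rounds, in the form that bounds the ratio of
      \<open>q - n / \<epsilon>\<close> to \<open>q + n / \<epsilon>\<close> below by
      \<open>(1 - \<epsilon>) / (1 + \<epsilon>)\<close>.\<close>
    have "real n / \<epsilon> \<le> real q * \<epsilon>" using q4(3) \<epsilon> by (simp add: field_simps power2_eq_square)
    moreover have "(1 - \<epsilon>) * (real q + t) \<le> (real q - t) * (1 + \<epsilon>)" if "t \<le> real q * \<epsilon>" for t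
      using that by (simp add: algebra_simps)
    ultimately have "(1 - \<epsilon>) * D \<le> (real q - real n / \<epsilon>) * (1 + \<epsilon>)"
      unfolding D_def by blast
    then have "(1 - \<epsilon>) * ((1 - \<epsilon>) * D) \<le> (1 - \<epsilon>) * ((real q - real n / \<epsilon>) * (1 + \<epsilon>))"
      using \<epsilon> by (intro mult_left_mono) auto
    then have r: "(1 - \<epsilon>)\<^sup>2 \<le> (1 - \<epsilon>\<^sup>2) / D * (real q - real n / \<epsilon>)"
      using D0 by (simp add: e2(2) field_simps power2_eq_square)
    have W0: "0 \<le> (\<Sum>j<m. (dot n (W j) x)\<^sup>2)" by (intro sum_nonneg) auto
    have "(1 - \<epsilon>) ^ 3 * (\<Sum>j<m. (dot n (V j) x)\<^sup>2) = (1 - \<epsilon>)\<^sup>2 * ((1 - \<epsilon>) * (\<Sum>j<m. (dot n (V j) x)\<^sup>2))"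
      by (simp add: power3_eq_cube power2_eq_square mult.assoc)
    also have "\<dots> \<le> (1 - \<epsilon>)\<^sup>2 * (\<Sum>j<m. (dot n (W j) x)\<^sup>2)"
      unfolding Wx using lo[of x] by (intro mult_left_mono) auto
    also have "\<dots> \<le> (1 - \<epsilon>\<^sup>2) / D * (real q - real n / \<epsilon>) * (\<Sum>j<m. (dot n (W j) x)\<^sup>2)"
      using r W0 by (rule mult_right_mono)
    also have "\<dots> \<le> (1 - \<epsilon>\<^sup>2) / D * (\<Sum>j<m. g j * (dot n (W j) x)\<^sup>2)"
      using mult_left_mono[OF glo[of x], of "(1 - \<epsilon>\<^sup>2) / D"] e2(1) D0 by (simp add: mult.assoc)
    finally show ?thesis unfolding fin .
  qed
  have time: "real (t1 + (t2 + (t3 + (t4 + t5)))) \<le> 100000 * (real m * real n ^ 2 / \<epsilon>\<^sup>2 + real n ^ 4 / \<epsilon> ^ 4)"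
  proof -
    define r where "r = real n"
    define \<mu> where "\<mu> = real m"
    define i where "i = 1 / \<epsilon>\<^sup>2"
    have r1': "1 \<le> r" and \<mu>0: "0 \<le> \<mu>" using n by (auto simp: r_def \<mu>_def)
    have i1: "1 \<le> i" using \<epsilon> by (simp add: i_def power_le_one)
    have ri: "1 \<le> r * i" using mult_mono[OF r1' i1] r1' by simp
    have N: "real (Suc N) \<le> 3 * (r * i)"
    proof -
      have "0 \<le> real n / \<epsilon>\<^sup>2" by simp
      then have "real N = real_of_int \<lceil>real n / \<epsilon>\<^sup>2\<rceil>" unfolding N_def by linarith
      then have "real N \<le> real n / \<epsilon>\<^sup>2 + 1" by linarith
      then have "real (Suc N) \<le> r * i + 2" by (simp add: r_def i_def)
      then show ?thesis using ri by simp
    qed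
    have "real (t1 + (t2 + (t3 + (t4 + t5)))) \<le> real (60 * m + (3000 * (m * n\<^sup>2) + (72 * (m * n) +
       (1500 * (m * n\<^sup>2) + (Suc N) * (1500 * n\<^sup>2 * support_size m s + 100 * m + 414 * n\<^sup>2) + 60 * m))))"
      using r1(2) r2(2) r3(2) r4(2) r5(2) by (intro of_nat_mono) linarith
    also have "\<dots> = 120 * \<mu> + 72 * (\<mu> * r) + 4500 * (\<mu> * r\<^sup>2) +
        real (Suc N) * (1500 * r\<^sup>2 * real (support_size m s) + 100 * \<mu> + 414 * r\<^sup>2)"
      by (simp add: r_def \<mu>_def algebra_simps)
    also have "\<dots> \<le> 120 * (\<mu> * r\<^sup>2 * i) + 72 * (\<mu> * r\<^sup>2 * i) + 4500 * (\<mu> * r\<^sup>2 * i) +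
        (300 * (\<mu> * r\<^sup>2 * i) + 55242 * (r ^ 4 * i\<^sup>2))"
    proof (intro add_mono)
      have r2': "r \<le> r\<^sup>2" "1 \<le> r\<^sup>2"
        using r1' mult_left_mono[OF r1', of r] by (simp add: power2_eq_square, simp)
      have r2i: "r\<^sup>2 \<le> r\<^sup>2 * i" using i1 r2' by (simp add: mult_le_cancel_left1)
      have m: "\<mu> * x \<le> \<mu> * r\<^sup>2 * i" if "x \<le> r\<^sup>2 * i" for x
        using mult_left_mono[OF that \<mu>0] by (simp add: mult.assoc)
      show "120 * \<mu> \<le> 120 * (\<mu> * r\<^sup>2 * i)" using m[of 1] r2' r2i by simp
      show "72 * (\<mu> * r) \<le> 72 * (\<mu> * r\<^sup>2 * i)" using m[of r] r2' r2i by simp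
      show "4500 * (\<mu> * r\<^sup>2) \<le> 4500 * (\<mu> * r\<^sup>2 * i)" using m[of "r\<^sup>2"] r2i by simp
      \<comment> \<open>At most \<open>12 * (r * i)\<close> sampled vectors make a round cost
        \<open>18000 + 414 = 18414\<close> times \<open>r\<^sup>2 * (r * i)\<close>, plus
        \<open>100 * \<mu>\<close> for scanning all vectors; the factor
        \<open>Suc N \<le> 3 * (r * i)\<close> gives 55242 and 300.\<close>
      have c: "real (support_size m s) \<le> 12 * (r * i)" using c2 by (simp add: r_def i_def)
      have "r\<^sup>2 * 1 \<le> r\<^sup>2 * (r * i)" using ri r2' by (intro mult_left_mono) auto
      moreover have "1500 * r\<^sup>2 * real (support_size m s) \<le> 1500 * r\<^sup>2 * (12 * (r * i))"
        using c by (intro mult_left_mono) auto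
      moreover have "1500 * r\<^sup>2 * (12 * (r * i)) = 18000 * (r\<^sup>2 * (r * i))" by simp
      ultimately have "1500 * r\<^sup>2 * real (support_size m s) + 100 * \<mu> + 414 * r\<^sup>2 \<le> 18414 * (r\<^sup>2 * (r * i)) + 100 * \<mu>"
        by linarith
      then have "real (Suc N) * (1500 * r\<^sup>2 * real (support_size m s) + 100 * \<mu> + 414 * r\<^sup>2)
        \<le> 3 * (r * i) * (18414 * (r\<^sup>2 * (r * i)) + 100 * \<mu>)"
        using N ri \<mu>0 by (intro mult_mono) auto
      also have "\<dots> = 55242 * (r ^ 4 * i\<^sup>2) + 300 * (\<mu> * (r * i))"
        by (simp add: algebra_simps power2_eq_square power4_eq_xxxx)
      also have "\<mu> * (r * i) \<le> \<mu> * r\<^sup>2 * i"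
        using m[of "r * i"] r2' i1 by (simp add: mult_right_mono)
      finally show "real (Suc N) * (1500 * r\<^sup>2 * real (support_size m s) + 100 * \<mu> + 414 * r\<^sup>2)
        \<le> 300 * (\<mu> * r\<^sup>2 * i) + 55242 * (r ^ 4 * i\<^sup>2)" by simp
    qed
    also have "\<dots> \<le> 100000 * (\<mu> * r\<^sup>2 * i + r ^ 4 * i\<^sup>2)"
    proof -
      have "0 \<le> \<mu> * r\<^sup>2 * i" "0 \<le> r ^ 4 * i\<^sup>2" using \<mu>0 i1 r1' by auto
      moreover have "120 * x + 72 * x + 4500 * x + (300 * x + 55242 * y) \<le> 100000 * (x + y)"
        if "0 \<le> x" "0 \<le> y" for x y :: real using that by simp
      ultimately show ?thesis by blast
    qed
    also have "\<mu> * r\<^sup>2 * i + r ^ 4 * i\<^sup>2 = real m * real n ^ 2 / \<epsilon>\<^sup>2 + real n ^ 4 / \<epsilon> ^ 4"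
      by (simp add: \<mu>_def r_def i_def power_divide power_mult[symmetric])
    finally show ?thesis .
  qed
  have "run sparsify_prog \<sigma> (t1 + (t2 + (t3 + (t4 + t5)))) \<rho>5"
    unfolding sparsify_prog_def by (rule run.Seq[OF r1(1) run.Seq[OF r2(1) run.Seq[OF r3(1) run.Seq[OF r4(1) r5(1)]]]])
  with time nonneg supp upper lower show ?thesis by blast
qed

text \<open>The difference of two weighted sums of the same rank-one matrices is again such a sum,
  so both Loewner bounds reduce to the sign of a weighted sum of the squares
  \<open>(dot n (V i) x)\<^sup>2\<close>.\<close>

lemma pos_semidef_weighted:
  assumes X: "X \<in> carrier_mat n n" "\<And>j k. j < n \<Longrightarrow> k < n \<Longrightarrow> X $$ (j, k) = (\<Sum>i<m. h i * (V i j * V i k))"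
    and nn: "\<And>x. 0 \<le> (\<Sum>i<m. h i * (dot n (V i) x)\<^sup>2)"
  shows "pos_semidef X"
  unfolding pos_semidef_def
proof (intro conjI ballI)
  show "square_mat X" using X by auto
  show "transpose_mat X = X"
    by (rule eq_matI) (use X in \<open>auto intro!: sum.cong\<close>)
  fix x :: "real vec" assume "x \<in> carrier_vec (dim_row X)"
  then have x: "dim_vec x = n" using X by auto
  have "x \<bullet> (X *\<^sub>v x) = (\<Sum>j<n. x $ j * (\<Sum>k<n. X $$ (j, k) * x $ k))"
    using X x by (simp add: scalar_prod_def atLeast0LessThan)
  also have "\<dots> = (\<Sum>j<n. \<Sum>k<n. \<Sum>i<m. h i * ((V i j * x $ j) * (V i k * x $ k)))"
    by (simp add: X(2) sum_distrib_left sum_distrib_right algebra_simps)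
  also have "\<dots> = (\<Sum>j<n. \<Sum>i<m. \<Sum>k<n. h i * ((V i j * x $ j) * (V i k * x $ k)))"
    by (intro sum.cong refl sum.swap)
  also have "\<dots> = (\<Sum>i<m. \<Sum>j<n. \<Sum>k<n. h i * ((V i j * x $ j) * (V i k * x $ k)))" by (rule sum.swap)
  also have "\<dots> = (\<Sum>i<m. h i * (\<Sum>j<n. \<Sum>k<n. (V i j * x $ j) * (V i k * x $ k)))"
    by (simp add: sum_distrib_left)
  also have "\<dots> = (\<Sum>i<m. h i * (dot n (V i) (\<lambda>k. x $ k))\<^sup>2)"
    by (simp add: dot_def power2_eq_square sum_product)
  finally show "0 \<le> x \<bullet> (X *\<^sub>v x)" using nn by simp
qed

lemma sparsifier_weightsI:
  assumes v: "\<forall>i<m. v i \<in> carrier_vec n"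
  defines "V \<equiv> \<lambda>i k. if k < n then v i $ k else 0"
  assumes s: "\<forall>j<m. 0 \<le> s j" "int (support_size m s) \<le> \<lceil>real n / \<epsilon>\<^sup>2\<rceil>"
    and lo: "\<And>x. (1 - \<epsilon>) ^ 3 * (\<Sum>j<m. (dot n (V j) x)\<^sup>2) \<le> (\<Sum>j<m. s j * (dot n (V j) x)\<^sup>2)"
    and up: "\<And>x. (\<Sum>j<m. s j * (dot n (V j) x)\<^sup>2) \<le> (1 + \<epsilon>) ^ 3 * (\<Sum>j<m. (dot n (V j) x)\<^sup>2)"
  shows "sparsifier_weights n m \<epsilon> v s"
proof -
  have entry: "weighted_sum n m v h $$ (j, k) = (\<Sum>i<m. h i * (V i j * V i k))" if "j < n" "k < n" for h j k
    using v that by (auto simp: weighted_sum_def outer_def V_def intro!: sum.cong)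
  have car: "weighted_sum n m v h \<in> carrier_mat n n" for h by (simp add: weighted_sum_def)
  have 1: "pos_semidef (weighted_sum n m v s - (1 - \<epsilon>) ^ 3 \<cdot>\<^sub>m weighted_sum n m v (\<lambda>_. 1))"
  proof (rule pos_semidef_weighted[where n = n and m = m and h = "\<lambda>i. s i - (1 - \<epsilon>) ^ 3" and V = V])
    show "0 \<le> (\<Sum>i<m. (s i - (1 - \<epsilon>) ^ 3) * (dot n (V i) x)\<^sup>2)" for x
      using lo[of x] by (simp add: left_diff_distrib sum_subtractf sum_distrib_left)
  qed (use car[of s] car[of "\<lambda>_. 1"] in \<open>auto simp: entry left_diff_distrib sum_subtractf sum_distrib_left\<close>)
  have 2: "pos_semidef ((1 + \<epsilon>) ^ 3 \<cdot>\<^sub>m weighted_sum n m v (\<lambda>_. 1) - weighted_sum n m v s)"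
  proof (rule pos_semidef_weighted[where n = n and m = m and h = "\<lambda>i. (1 + \<epsilon>) ^ 3 - s i" and V = V])
    show "0 \<le> (\<Sum>i<m. ((1 + \<epsilon>) ^ 3 - s i) * (dot n (V i) x)\<^sup>2)" for x
      using up[of x] by (simp add: left_diff_distrib sum_subtractf sum_distrib_left)
  qed (use car[of s] car[of "\<lambda>_. 1"] in \<open>auto simp: entry left_diff_distrib sum_subtractf sum_distrib_left\<close>)
  show ?thesis unfolding sparsifier_weights_def Let_def loewner_le_def
    using s 1 2 by (simp add: support_size_def)
qed

lemma sparsify_correct:
  assumes "1 \<le> n" "n \<le> m" "0 < \<epsilon>" "\<epsilon> < 1" "\<forall>i<m. v i \<in> carrier_vec n"
  shows "\<exists>t \<tau>. run sparsify_prog (input_mem n m \<epsilon> v) t \<tau> \<and> sparsifier_weights n m \<epsilon> v (output_weights \<tau>) \<and>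
    real t \<le> 100000 * (real m * real n ^ 2 / \<epsilon>\<^sup>2 + real n ^ 4 / \<epsilon> ^ 4)"
proof -
  \<comment> \<open>Padding with zeros makes the vectors \<open>supported\<close>, as needed for
    row-major arrays to compute the action of operators on functions.\<close>
  let ?V = "\<lambda>i k. if k < n then v i $ k else 0" and ?\<sigma> = "input_mem n m \<epsilon> v"
  have "i * n + k < m * n" if "i < m" "k < n" for i k
  proof -
    have "i * n + k < Suc i * n" using that by simp
    also have "\<dots> \<le> m * n" using that by (intro mult_right_mono) auto
    finally show ?thesis .
  qed
  then have V: "vectors n m ?\<sigma> ?V"
    by (auto simp: vectors_def input_mem_def supported_def)
  have "nats ?\<sigma> 0 0 = n" "nats ?\<sigma> 0 1 = m" "nats ?\<sigma> 1 0 = 0" "reals ?\<sigma> 0 0 = \<epsilon>" "\<forall>j<m. reals ?\<sigma> 2 j = 0"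
    by (simp_all add: input_mem_def)
  from exec_sparsify[OF assms(1,2) this(1-3) V this(4) assms(3,4) this(5)]
  obtain t \<tau> where "run sparsify_prog ?\<sigma> t \<tau>"
    and t: "real t \<le> 100000 * (real m * real n ^ 2 / \<epsilon>\<^sup>2 + real n ^ 4 / \<epsilon> ^ 4)"
    and "\<forall>j<m. 0 \<le> reals \<tau> 2 j" "int (support_size m (reals \<tau> 2)) \<le> \<lceil>real n / \<epsilon>\<^sup>2\<rceil>"
    "\<And>x. (1 - \<epsilon>) ^ 3 * (\<Sum>j<m. (dot n (?V j) x)\<^sup>2) \<le> (\<Sum>j<m. reals \<tau> 2 j * (dot n (?V j) x)\<^sup>2)"
    "\<And>x. (\<Sum>j<m. reals \<tau> 2 j * (dot n (?V j) x)\<^sup>2) \<le> (1 + \<epsilon>) ^ 3 * (\<Sum>j<m. (dot n (?V j) x)\<^sup>2)"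
    by blast
  with sparsifier_weightsI[OF assms(5), of "reals \<tau> 2" \<epsilon>] show ?thesis
    unfolding output_weights_def by blast
qed

theorem theorem7:
  shows "(\<forall>(n::nat) (m::nat) (\<epsilon>::real) (v :: nat \<Rightarrow> real vec).
            1 \<le> n \<and> n \<le> m \<and> 0 < \<epsilon> \<and> \<epsilon> < 1 \<and> (\<forall>i<m. v i \<in> carrier_vec n) \<longrightarrow>
            (\<exists>s. sparsifier_weights n m \<epsilon> v s))
       \<and> sparsifier_computable_in_soft_O
            (\<lambda>n m \<epsilon>. real m * real n ^ 2 * lg (real n) ^ 3 / \<epsilon> ^ 2
                    + real n ^ 4 * lg (real n) / \<epsilon> ^ 4)"
proof
  show "\<forall>(n::nat) (m::nat) (\<epsilon>::real) (v :: nat \<Rightarrow> real vec).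
            1 \<le> n \<and> n \<le> m \<and> 0 < \<epsilon> \<and> \<epsilon> < 1 \<and> (\<forall>i<m. v i \<in> carrier_vec n) \<longrightarrow>
            (\<exists>s. sparsifier_weights n m \<epsilon> v s)"
    using sparsify_correct by blast
  \<comment> \<open>Since \<open>lg\<close> is truncated below at 1, the logarithmic factors only
    enlarge the bound, also for \<open>n = 1\<close>.\<close>
  have "100000 * (real m * real n ^ 2 / \<epsilon>\<^sup>2 + real n ^ 4 / \<epsilon> ^ 4) \<le>
    100000 * (real m * real n ^ 2 * lg (real n) ^ 3 / \<epsilon> ^ 2 + real n ^ 4 * lg (real n) / \<epsilon> ^ 4)" for n m :: nat and \<epsilon> :: real
  proof -
    have lg: "1 \<le> lg (real n)" "1 \<le> lg (real n) ^ 3" by (simp_all add: lg_def)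
    have "x * 1 / y \<le> x * z / y" if "0 \<le> x" "0 \<le> y" "1 \<le> z" for x y z :: real
      using that by (intro divide_right_mono mult_left_mono) auto
    from this[of "real m * real n ^ 2" "\<epsilon>\<^sup>2", OF _ _ lg(2)] this[of "real n ^ 4" "\<epsilon> ^ 4", OF _ _ lg(1)]
    show ?thesis by (simp add: add_mono)
  qed
  note bound = this
  show "sparsifier_computable_in_soft_O
            (\<lambda>n m \<epsilon>. real m * real n ^ 2 * lg (real n) ^ 3 / \<epsilon> ^ 2 + real n ^ 4 * lg (real n) / \<epsilon> ^ 4)"
    unfolding sparsifier_computable_in_soft_O_def
  \<comment> \<open>Exponent 0: the program needs no iterated logarithms, and its constant is the
    same for all inputs.\<close>
  proof (rule exI[of _ sparsify_prog], rule exI[of _ 100000], rule exI[of _ 0], intro allI impI, elim conjE)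
    fix n m :: nat and \<epsilon> :: real and v :: "nat \<Rightarrow> real vec"
    assume "1 \<le> n" "n \<le> m" "0 < \<epsilon>" "\<epsilon> < 1" "\<forall>i<m. v i \<in> carrier_vec n"
    from sparsify_correct[OF this] obtain t \<tau> where
      "run sparsify_prog (input_mem n m \<epsilon> v) t \<tau>" "sparsifier_weights n m \<epsilon> v (output_weights \<tau>)"
      "real t \<le> 100000 * (real m * real n ^ 2 / \<epsilon>\<^sup>2 + real n ^ 4 / \<epsilon> ^ 4)" by blast
    with order_trans[OF this(3) bound]
    show "\<exists>t \<tau>. run sparsify_prog (input_mem n m \<epsilon> v) t \<tau> \<and> sparsifier_weights n m \<epsilon> v (output_weights \<tau>) \<and>
      real t \<le> 100000 * (real m * real n ^ 2 * lg (real n) ^ 3 / \<epsilon> ^ 2 + real n ^ 4 * lg (real n) / \<epsilon> ^ 4) *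
        lg (lg (real n)) ^ 0 * lg (lg (1 / \<epsilon>)) ^ 0" by auto
  qed
qed

end
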